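(* Let $d\geqslant1$, $k\geqslant0$, $1\leqslant p\leqslant\infty$, and let $1\leqslant r\leqslant k+1$ be an integer. Let $\mathbb E$ be a finite-dimensional real vector space with $m=\dim\mathbb E\geqslant1$, identified with $\mathbb R^m$ through a fixed basis. Let $M=\binom{d+k}{d}$ and let $\{\mathcal T_h\}$ be a shape-regular family of conforming simplicial meshes of a bounded polyhedral domain $\Omega\subset\mathbb R^d$, with $h=\max_{\tau\in\mathcal T_h}\operatorname{diam}(\tau)\leqslant1$. For every $\boldsymbol v\in W^{r,p}(\Omega;\mathbb E)$ there exists a network $\boldsymbol{\mathcal N}\in\mathrm{NN}_d^m(k;2H_{\mathcal T_h},MN_{\mathcal T_h})$ such that, for any $s=0,\dots,r$, $$\|\boldsymbol v-\boldsymbol{\mathcal N}\|_{W^{s,p}(\mathcal T_h;\mathbb E)}\leqslant C h^{r-s}|\boldsymbol v|_{W^{r,p}(\Omega;\mathbb E)}.$$ The constant $C$ depends only on $d$, $k$, $r$, $p$, $m$, and the shape-regularity bound, and is independent of $h$ and $\boldsymbol v$.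
   Context: Mesh. A conforming simplicial mesh $\mathcal T=\{\tau_1,\dots,\tau_{N_{\mathcal T}}\}$ of $\Omega$ is a finite collection of pairwise disjoint open $d$-simplices $\tau_i\subset\Omega$ (elements) with $\bigcup_{\tau\in\mathcal T}\overline\tau=\overline\Omega$ such that for $i\neq j$ the set $\overline\tau_i\cap\overline\tau_j$ is either empty or a common subsimplex (face) of both. $N_{\mathcal T}$ is the number of elements; $H_{\mathcal T}$ is the number of distinct unoriented affine hyperplanes supporting the $(d-1)$-dimensional facets of elements (coplanar facets contribute only once). Shape-regular is meant in the usual finite element sense: the ratios of element diameter to inscribed-ball diameter are uniformly bounded over the family (the shape-regularity bound). Norms. $\mathbb E$ carries the Euclidean norm in the chosen basis, and $L^p(\Omega;\mathbb E)$, $W^{s,p}(\Omega;\mathbb E)$ carry the corresponding norms and seminorms $|\cdot|_{W^{r,p}}$. The broken Sobolev norm is $$\|\boldsymbol w\|_{W^{s,p}(\mathcal T;\mathbb E)}=\Big(\sum_{\tau\in\mathcal T}\|\boldsymbol w\|_{W^{s,p}(\tau;\mathbb E)}^p\Big)^{1/p}\ (1\leqslant p<\infty),\qquad \|\boldsymbol w\|_{W^{s,\infty}(\mathcal T;\mathbb E)}=\max_{\tau\in\mathcal T}\|\boldsymbol w\|_{W^{s,\infty}(\tau;\mathbb E)},$$ all derivatives being taken within individual (open) elements. Networks. $\varrho_0(t)=\mathbf 1_{\{t>0\}}$ and $\varrho_j(t)=(\max\{t,0\})^j$ for $j\geqslant1$, applied componentwise to vectors. For positive integers $d,m,n_1,n_2$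 and $k\in\mathbb N_0$, $\mathrm{NN}_d^m(k;n_1,n_2)$ is the class of functions $\mathbb R^d\to\mathbb R^m$ of the form $$\boldsymbol x\mapsto\boldsymbol W_{\mathrm{III}}\,\varrho_k\big(\boldsymbol W_{\mathrm{II},0}\varrho_0(\boldsymbol W_{\mathrm I}\boldsymbol x+\boldsymbol b_{\mathrm I})+\boldsymbol W_{\mathrm{II},1}\varrho_1(\boldsymbol W_{\mathrm I}\boldsymbol x+\boldsymbol b_{\mathrm I})+\boldsymbol b_{\mathrm{II}}\big)$$ with $\boldsymbol W_{\mathrm I}\in\mathbb R^{n_1\times d}$, $\boldsymbol b_{\mathrm I}\in\mathbb R^{n_1}$, $\boldsymbol W_{\mathrm{II},0},\boldsymbol W_{\mathrm{II},1}\in\mathbb R^{n_2\times n_1}$, $\boldsymbol b_{\mathrm{II}}\in\mathbb R^{n_2}$, $\boldsymbol W_{\mathrm{III}}\in\mathbb R^{m\times n_2}$. *)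

theory Defs
  imports "HOL-Analysis.Analysis" "HOL-Probability.Essential_Supremum"
begin

section \<open>Lebesgue and Sobolev spaces\<close>

text \<open>
  Functions on an open set \<open>U\<close> are total functions whose values outside \<open>U\<close> are irrelevant.
  The exponent ranges over the extended reals; only \<open>p \<ge> 1\<close> is meant. All norms below are
  real-valued, so an inequality between them is informative only together with membership in the
  corresponding space.
\<close>

definition lp_space :: "ereal \<Rightarrow> (real^'d) set \<Rightarrow> (real^'d \<Rightarrow> real^'m) set" where
  "lp_space p U =
     {f \<in> borel_measurable (lebesgue_on U).
        if p = \<infinity> then esssup (lebesgue_on U) (\<lambda>x. ereal (norm (f x))) < \<infinity>
        else integrable (lebesgue_on U) (\<lambda>x. norm (f x) powr real_of_ereal p)}"

definition lp_norm :: "ereal \<Rightarrow> (real^'d) set \<Rightarrow> (real^'d \<Rightarrow> real^'m) \<Rightarrow> real" where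
  "lp_norm p U f =
     (if p = \<infinity> then real_of_ereal (esssup (lebesgue_on U) (\<lambda>x. ereal (norm (f x))))
      else (LINT x|lebesgue_on U. norm (f x) powr real_of_ereal p) powr (1 / real_of_ereal p))"

definition partial_deriv :: "'d \<Rightarrow> (real^'d \<Rightarrow> real) \<Rightarrow> real^'d \<Rightarrow> real" where
  "partial_deriv i f = (\<lambda>x. frechet_derivative f (at x) (axis i 1))"

definition iter_partial_deriv :: "'d list \<Rightarrow> (real^'d \<Rightarrow> real) \<Rightarrow> real^'d \<Rightarrow> real" where
  "iter_partial_deriv is f = foldr partial_deriv is f"

definition smooth :: "(real^'d \<Rightarrow> real) \<Rightarrow> bool" where
  "smooth f \<longleftrightarrow> (\<forall>is. iter_partial_deriv is f differentiable_on UNIV)"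

definition test_function :: "(real^'d) set \<Rightarrow> (real^'d \<Rightarrow> real) \<Rightarrow> bool" where
  "test_function U \<phi> \<longleftrightarrow>
     smooth \<phi> \<and> compact (closure {x. \<phi> x \<noteq> 0}) \<and> closure {x. \<phi> x \<noteq> 0} \<subseteq> U"

text \<open>Multi-indices are functions \<open>\<alpha> :: 'd \<Rightarrow> nat\<close>.\<close>

definition mi_order :: "('d::finite \<Rightarrow> nat) \<Rightarrow> nat" where
  "mi_order \<alpha> = (\<Sum>i\<in>UNIV. \<alpha> i)"

text \<open>
  The order in which the partial derivatives are taken is chosen arbitrarily. The operator is only
  applied to smooth functions, for which the order does not matter.
\<close>

definition multi_deriv :: "('d \<Rightarrow> nat) \<Rightarrow> (real^'d \<Rightarrow> real) \<Rightarrow> real^'d \<Rightarrow> real" where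
  "multi_deriv \<alpha> f = iter_partial_deriv (SOME is. \<forall>i. count_list is i = \<alpha> i) f"

definition locally_integrable_on :: "(real^'d \<Rightarrow> real^'m) \<Rightarrow> (real^'d) set \<Rightarrow> bool"
    (infixr \<open>locally'_integrable'_on\<close> 46) where
  "f locally_integrable_on U \<longleftrightarrow>
     (\<forall>K. compact K \<and> K \<subseteq> U \<longrightarrow> f absolutely_integrable_on K)"

definition is_weak_deriv ::
    "(real^'d) set \<Rightarrow> ('d \<Rightarrow> nat) \<Rightarrow> (real^'d \<Rightarrow> real^'m) \<Rightarrow> (real^'d \<Rightarrow> real^'m) \<Rightarrow> bool" where
  "is_weak_deriv U \<alpha> u w \<longleftrightarrow>
     u locally_integrable_on U \<and> w locally_integrable_on U \<and>
     (\<forall>\<phi>. test_function U \<phi> \<longrightarrow>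
        (LINT x|lebesgue_on U. multi_deriv \<alpha> \<phi> x *\<^sub>R u x) =
        (- 1) ^ mi_order \<alpha> *\<^sub>R (LINT x|lebesgue_on U. \<phi> x *\<^sub>R w x))"

text \<open>Weak derivatives are unique up to null sets, which the \<open>L\<^sup>p\<close> norms do not see.\<close>

definition weak_deriv ::
    "(real^'d) set \<Rightarrow> ('d \<Rightarrow> nat) \<Rightarrow> (real^'d \<Rightarrow> real^'m) \<Rightarrow> real^'d \<Rightarrow> real^'m" where
  "weak_deriv U \<alpha> u = (SOME w. is_weak_deriv U \<alpha> u w)"

definition sobolev_space :: "nat \<Rightarrow> ereal \<Rightarrow> (real^'d) set \<Rightarrow> (real^'d \<Rightarrow> real^'m) set" where
  "sobolev_space s p U =
     {u \<in> lp_space p U.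
        \<forall>\<alpha>. mi_order \<alpha> \<le> s \<longrightarrow> (\<exists>w \<in> lp_space p U. is_weak_deriv U \<alpha> u w)}"

definition sobolev_norm ::
    "nat \<Rightarrow> ereal \<Rightarrow> (real^'d) set \<Rightarrow> (real^'d \<Rightarrow> real^'m) \<Rightarrow> real" where
  "sobolev_norm s p U u =
     (if p = \<infinity> then MAX \<alpha>\<in>{\<alpha>. mi_order \<alpha> \<le> s}. lp_norm p U (weak_deriv U \<alpha> u)
      else (\<Sum>\<alpha> | mi_order \<alpha> \<le> s. lp_norm p U (weak_deriv U \<alpha> u) powr real_of_ereal p)
             powr (1 / real_of_ereal p))"

definition sobolev_seminorm ::
    "nat \<Rightarrow> ereal \<Rightarrow> (real^'d) set \<Rightarrow> (real^'d \<Rightarrow> real^'m) \<Rightarrow> real" where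
  "sobolev_seminorm r p U u =
     (if p = \<infinity> then MAX \<alpha>\<in>{\<alpha>. mi_order \<alpha> = r}. lp_norm p U (weak_deriv U \<alpha> u)
      else (\<Sum>\<alpha> | mi_order \<alpha> = r. lp_norm p U (weak_deriv U \<alpha> u) powr real_of_ereal p)
             powr (1 / real_of_ereal p))"

definition broken_sobolev_space ::
    "nat \<Rightarrow> ereal \<Rightarrow> (real^'d) set set \<Rightarrow> (real^'d \<Rightarrow> real^'m) set" where
  "broken_sobolev_space s p T = (\<Inter>\<tau>\<in>T. sobolev_space s p \<tau>)"

definition broken_sobolev_norm ::
    "nat \<Rightarrow> ereal \<Rightarrow> (real^'d) set set \<Rightarrow> (real^'d \<Rightarrow> real^'m) \<Rightarrow> real" where
  "broken_sobolev_norm s p T w =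
     (if p = \<infinity> then MAX \<tau>\<in>T. sobolev_norm s p \<tau> w
      else (\<Sum>\<tau>\<in>T. sobolev_norm s p \<tau> w powr real_of_ereal p) powr (1 / real_of_ereal p))"


section \<open>Domains and meshes\<close>

text \<open>Polyhedral domains need not be convex, so the predicate \<open>polyhedron\<close> does not apply.\<close>

definition bounded_polyhedral_domain :: "(real^'d) set \<Rightarrow> bool" where
  "bounded_polyhedral_domain \<Omega> \<longleftrightarrow>
     \<Omega> \<noteq> {} \<and> open \<Omega> \<and> connected \<Omega> \<and> bounded \<Omega> \<and>
     (\<exists>F. finite F \<and> (\<forall>P\<in>F. polytope P) \<and> frontier \<Omega> = \<Union>F)"

definition open_simplex :: "(real^'d) set \<Rightarrow> bool" where
  "open_simplex \<tau> \<longleftrightarrow> (\<exists>S. int CARD('d) simplex S \<and> \<tau> = interior S)"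

text \<open>The empty set is a face in the sense of \<open>face_of\<close>.\<close>

definition conforming_mesh :: "(real^'d) set \<Rightarrow> (real^'d) set set \<Rightarrow> bool" where
  "conforming_mesh \<Omega> T \<longleftrightarrow>
     finite T \<and> (\<forall>\<tau>\<in>T. open_simplex \<tau> \<and> \<tau> \<subseteq> \<Omega>) \<and> pairwise disjnt T \<and>
     (\<Union>\<tau>\<in>T. closure \<tau>) = closure \<Omega> \<and>
     (\<forall>\<tau>\<in>T. \<forall>\<tau>'\<in>T. \<tau> \<noteq> \<tau>' \<longrightarrow>
        closure \<tau> \<inter> closure \<tau>' face_of closure \<tau> \<and>
        closure \<tau> \<inter> closure \<tau>' face_of closure \<tau>')"

definition facet_hyperplanes :: "(real^'d) set set \<Rightarrow> (real^'d) set set" where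
  "facet_hyperplanes T = {affine hull F | F \<tau>. \<tau> \<in> T \<and> F facet_of closure \<tau>}"

definition mesh_size :: "(real^'d) set set \<Rightarrow> real" where
  "mesh_size T = (MAX \<tau>\<in>T. diameter \<tau>)"

definition inscribed_diameter :: "(real^'d) set \<Rightarrow> real" where
  "inscribed_diameter \<tau> = Sup {2 * \<rho> | \<rho>. \<rho> > 0 \<and> (\<exists>x. ball x \<rho> \<subseteq> \<tau>)}"

definition shape_regular_family :: "real \<Rightarrow> (real^'d) set set set \<Rightarrow> bool" where
  "shape_regular_family \<sigma> \<T> \<longleftrightarrow>
     (\<forall>T\<in>\<T>. \<forall>\<tau>\<in>T. diameter \<tau> / inscribed_diameter \<tau> \<le> \<sigma>)"


section \<open>Networks\<close>

definition rho :: "nat \<Rightarrow> real \<Rightarrow> real" where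
  "rho j t = (if j = 0 then (if t > 0 then 1 else 0) else (max t 0) ^ j)"

text \<open>
  The widths \<open>n\<^sub>1\<close>, \<open>n\<^sub>2\<close> are numbers, not types: only indices \<open>i < n\<^sub>1\<close> and \<open>j < n\<^sub>2\<close> are used.
  \<open>WI i\<close> is the \<open>i\<close>-th row of the first weight matrix, \<open>WIII j\<close> the \<open>j\<close>-th column of the last.
\<close>

definition NN :: "nat \<Rightarrow> nat \<Rightarrow> nat \<Rightarrow> (real^'d \<Rightarrow> real^'m) set" where
  "NN k n\<^sub>1 n\<^sub>2 =
     {f. \<exists>(WI :: nat \<Rightarrow> real^'d) (bI :: nat \<Rightarrow> real)
           (WII0 :: nat \<Rightarrow> nat \<Rightarrow> real) (WII1 :: nat \<Rightarrow> nat \<Rightarrow> real) (bII :: nat \<Rightarrow> real)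
           (WIII :: nat \<Rightarrow> real^'m).
         f = (\<lambda>x. \<Sum>j<n\<^sub>2. rho k ((\<Sum>i<n\<^sub>1. WII0 j i * rho 0 (WI i \<bullet> x + bI i)) +
                                (\<Sum>i<n\<^sub>1. WII1 j i * rho 1 (WI i \<bullet> x + bI i)) + bII j) *\<^sub>R WIII j)}"


section \<open>Coordinates\<close>

definition is_basis :: "('m::finite \<Rightarrow> 'e::real_vector) \<Rightarrow> bool" where
  "is_basis b \<longleftrightarrow> inj b \<and> independent (range b) \<and> span (range b) = UNIV"

definition coords :: "('m::finite \<Rightarrow> 'e::real_vector) \<Rightarrow> 'e \<Rightarrow> real^'m" where
  "coords b w = (\<chi> i. representation (range b) w (b i))"

end

theory Submission
  imports Defs "HOL-Library.Function_Algebras"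
begin

text \<open>
  On a single element \<open>\<tau>\<close> the network has to equal a polynomial \<open>q\<close> of degree less than \<open>r\<close> that
  approximates the function \<open>u\<close> given by the coordinates. Choose \<open>q\<close> such that every derivative of order
  less than \<open>r\<close> of \<open>u - q\<close> has mean value zero on \<open>\<tau>\<close> (\<open>ex_mpoly_matching_means\<close>). The Poincare inequality,
  applied to the derivatives of \<open>u - q\<close> one order after the other, gains one factor \<open>h\<close> per order and ends
  at the derivatives of order \<open>r\<close>, where \<open>q\<close> has disappeared (\<open>bramble_hilbert\<close>). On a convex set the
  constant of the Poincare inequality depends only on dimension and diameter, because \<open>u x - u y\<close> is the integral
  of the gradient along the chord from \<open>y\<close> to \<open>x\<close>, and the average over all chords of a nonnegative
  function is controlled by its integral: one of the two maps
  \<open>x \<mapsto> y + t (x - y)\<close> and \<open>y \<mapsto> y + t (x - y)\<close> scales by a factor of at least \<open>1/2\<close>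
  (\<open>chord_integral_le\<close>). So the constant is the same for all simplices.

  The derivatives are weak derivatives, and the chord formula is obtained for them by mollification
  (\<open>conv_difference_le\<close>, \<open>difference_le_chord\<close>). The mollifiers are tensor products of functions of one
  variable. Their partial derivatives are again tensor products and visibly independent of the order
  of differentiation, so that \<open>weak_deriv_chain\<close> and the uniqueness of weak derivatives
  (\<open>weak_deriv_unique\<close>) follow without a theorem on mixed partial derivatives.

  The piecewise polynomial obtained in this way is a network (\<open>piecewise_polynomial_network\<close>). A
  polynomial of degree at most \<open>k\<close> is a linear combination of \<open>k\<close>-th powers of affine functions \<open>l\<close> that are
  positive on \<open>\<tau>\<close>, and \<open>(d + k) choose d\<close> of them suffice since this number bounds the dimension of the
  space of these polynomials (\<open>mpoly_as_sum_of_powers\<close>). The neuron with input \<open>l - B v\<close>, where \<open>v\<close>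
  counts the facet inequalities of \<open>\<tau>\<close> that are violated and \<open>B\<close> is an upper bound of \<open>l\<close>, has the
  output \<open>l\<^sup>k\<close> on \<open>\<tau>\<close> and \<open>0\<close> on all other elements. Two neurons per hyperplane in the first layer, one for
  each side, produce \<open>v\<close> as well as all affine functions (\<open>first_layer_for_hyperplanes\<close>).
\<close>

section \<open>Smooth functions of one variable\<close>

text \<open>A smooth function of one variable together with all its derivatives.\<close>

definition tower :: "(nat \<Rightarrow> real \<Rightarrow> real) \<Rightarrow> bool" where
  "tower F \<longleftrightarrow> (\<forall>n x. (F n has_real_derivative F (Suc n) x) (at x))"

lemma towerD: "tower F \<Longrightarrow> (F n has_real_derivative F (Suc n) x) (at x)"
  by (auto simp: tower_def)

lemma tower_affine:
  assumes "tower F"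
  shows "tower (\<lambda>n t. a ^ n * F n (a * t + b))"
  unfolding tower_def
proof (intro allI)
  fix n x
  show "((\<lambda>t. a ^ n * F n (a * t + b)) has_real_derivative a ^ Suc n * F (Suc n) (a * x + b)) (at x)"
  proof -
    have "((\<lambda>t. a * t + b) has_real_derivative a) (at x)"
      by (auto intro!: derivative_eq_intros)
    from DERIV_cmult[OF DERIV_chain2[where f = "F n", OF towerD[OF assms] this], of "a ^ n"]
    show ?thesis by (simp add: mult_ac)
  qed
qed

lemma tower_poly: "tower (\<lambda>n. poly ((pderiv ^^ n) P))"
  unfolding tower_def by (auto intro: poly_DERIV)

text \<open>Leibniz' rule, without its binomial coefficients: the list \<open>leibniz n\<close> contains
  \<open>(i, n - i)\<close> exactly \<open>n choose i\<close> times.\<close>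

primrec leibniz :: "nat \<Rightarrow> (nat \<times> nat) list" where
  "leibniz 0 = [(0, 0)]"
| "leibniz (Suc n) = concat (map (\<lambda>(i, j). [(Suc i, j), (i, Suc j)]) (leibniz n))"

lemma tower_mult:
  assumes "tower F" "tower G"
  shows "tower (\<lambda>n t. \<Sum>(i, j)\<leftarrow>leibniz n. F i t * G j t)"
proof -
  have "((\<lambda>t. \<Sum>(i, j)\<leftarrow>xs. F i t * G j t) has_real_derivative
      (\<Sum>(i, j)\<leftarrow>concat (map (\<lambda>(i, j). [(Suc i, j), (i, Suc j)]) xs). F i x * G j x)) (at x)" for xs x
  proof (induction xs)
    case (Cons a xs)
    obtain i j where a: "a = (i, j)" by force
    show ?case unfolding a
      using DERIV_add[OF DERIV_mult[OF towerD[OF assms(1), of i x] towerD[OF assms(2), of j x]] Cons.IH]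
      by (simp add: algebra_simps)
  qed simp
  then show ?thesis by (simp add: tower_def)
qed

text \<open>For \<open>P = 1\<close> this is the standard smooth function that is flat at the origin; the polynomial factors make
  the family closed under differentiation.\<close>

definition flat :: "real poly \<Rightarrow> real \<Rightarrow> real" where
  "flat P t = (if t > 0 then poly P (1 / t) * exp (- (1 / t)) else 0)"

lemma poly_exp_tendsto_0: "((\<lambda>x. poly P x * exp (- x)) \<longlongrightarrow> (0::real)) at_top"
proof -
  have "((\<lambda>x. \<Sum>i\<le>degree P. coeff P i * (x ^ i / exp x)) \<longlongrightarrow> (\<Sum>i\<le>degree P. coeff P i * 0)) at_top"
    by (intro tendsto_sum tendsto_mult tendsto_const tendsto_power_div_exp_0)
  moreover have "(\<Sum>i\<le>degree P. coeff P i * (x ^ i / exp x)) = poly P x * exp (- x)" for x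
    by (simp add: poly_altdef exp_minus sum_distrib_right divide_inverse mult.assoc)
  ultimately show ?thesis by simp
qed

text \<open>At the origin the difference quotient tends to zero, since the exponential decay beats every power of
  \<open>1/t\<close>.\<close>

lemma flat_has_derivative:
  "(flat P has_real_derivative flat ([:0, 0, 1:] * (P - pderiv P)) x) (at x)"
proof -
  consider "x > 0" | "x < 0" | "x = 0" by linarith
  then show ?thesis
  proof cases
    case 1
    have "((\<lambda>t. poly P (1 / t) * exp (- (1 / t))) has_real_derivative
        flat ([:0, 0, 1:] * (P - pderiv P)) x) (at x)"
    proof -
      have inv: "((\<lambda>t::real. 1 / t) has_real_derivative - (1 / x\<^sup>2)) (at x)"
        using 1 by (auto intro!: derivative_eq_intros simp: power2_eq_square)
      show ?thesis
        using DERIV_mult[OF DERIV_chain2[OF poly_DERIV[of P] inv] DERIV_chain2[OF DERIV_exp DERIV_minus[OF inv]]] 1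
        by (simp add: flat_def field_simps power2_eq_square)
    qed
    then show ?thesis
      by (rule has_field_derivative_transform_within_open[of _ _ _ "{0<..}"])
         (use 1 in \<open>auto simp: flat_def\<close>)
  next
    case 2
    have "((\<lambda>t. 0) has_real_derivative flat ([:0, 0, 1:] * (P - pderiv P)) x) (at x)"
      using 2 by (simp add: flat_def)
    then show ?thesis
      by (rule has_field_derivative_transform_within_open[of _ _ _ "{..<0}"])
         (use 2 in \<open>auto simp: flat_def\<close>)
  next
    case 3
    have "((\<lambda>h. flat P h / h) \<longlongrightarrow> 0) (at_right 0)"
    proof -
      have "((\<lambda>h::real. poly ([:0, 1:] * P) (inverse h) * exp (- (inverse h))) \<longlongrightarrow> 0) (at_right 0)"
        by (rule filterlim_compose[OF poly_exp_tendsto_0 filterlim_inverse_at_top_right])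
      then show ?thesis
        by (rule Lim_transform_eventually)
           (auto simp: flat_def field_simps eventually_at_filter)
    qed
    moreover have "((\<lambda>h. flat P h / h) \<longlongrightarrow> 0) (at_left 0)"
      by (rule Lim_transform_eventually[of "\<lambda>_. 0"])
         (auto simp: flat_def eventually_at_filter)
    ultimately have "((\<lambda>h. flat P h / h) \<longlongrightarrow> 0) (at 0)"
      by (simp add: filterlim_split_at)
    then show ?thesis using 3 by (simp add: DERIV_def flat_def)
  qed
qed

lemma tower_flat: "tower (\<lambda>n. flat (((\<lambda>P. [:0, 0, 1:] * (P - pderiv P)) ^^ n) P))"
  unfolding tower_def funpow.simps o_apply by (intro allI flat_has_derivative)

lemma bump_tower:
  obtains j where "tower j" "\<And>t. j 0 t \<ge> 0" "\<And>t. \<bar>t\<bar> < 1 \<Longrightarrow> j 0 t > 0" "\<And>n t. \<bar>t\<bar> \<ge> 1 \<Longrightarrow> j n t = 0"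
proof -
  define f where "f n = flat (((\<lambda>P. [:0, 0, 1:] * (P - pderiv P)) ^^ n) 1)" for n
  have f: "tower f" unfolding f_def by (rule tower_flat)
  have f0: "f n t = 0" if "t \<le> 0" for n t using that by (simp add: f_def flat_def)
  \<comment> \<open>The product \<open>f (1 + t) * f (1 - t)\<close> is positive exactly on the open unit interval around \<open>0\<close>.\<close>
  define l r where "l n t = 1 ^ n * f n (1 * t + 1)" and "r n t = (-1) ^ n * f n (-1 * t + 1)" for n t
  have lr: "tower l" "tower r" unfolding l_def r_def by (rule tower_affine[OF f])+
  show thesis
  proof (rule that[OF tower_mult[OF lr]])
    fix n t assume "\<bar>t::real\<bar> \<ge> 1"
    then have "l i t = 0 \<or> r i' t = 0" for i i' by (cases "t \<ge> 0") (auto simp: l_def r_def intro!: f0)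
    then have "(\<lambda>(i, j). l i t * r j t) = (\<lambda>_. 0)" by (auto simp: fun_eq_iff)
    then show "(\<Sum>(i, j)\<leftarrow>leibniz n. l i t * r j t) = 0" by simp
  qed (auto simp: l_def r_def f_def flat_def)
qed

section \<open>Tensor products\<close>

definition tens :: "('d::finite \<Rightarrow> nat \<Rightarrow> real \<Rightarrow> real) \<Rightarrow> ('d \<Rightarrow> nat) \<Rightarrow> real^'d \<Rightarrow> real" where
  "tens F \<alpha> x = (\<Prod>i\<in>UNIV. F i (\<alpha> i) (x $ i))"

text \<open>Differentiation in direction \<open>i\<close> raises the \<open>i\<close>-th index by one. All later computations
  with derivatives of tensor products use only this rule.\<close>

lemma tens_has_derivative:
  fixes F :: "'d::finite \<Rightarrow> nat \<Rightarrow> real \<Rightarrow> real"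
  assumes "\<And>i. tower (F i)"
  shows "(tens F \<alpha> has_derivative (\<lambda>h. \<Sum>i\<in>UNIV. h $ i * tens F (\<alpha>(i := Suc (\<alpha> i))) x)) (at x)"
proof -
  have "((\<lambda>x::real^'d. F i (\<alpha> i) (x $ i)) has_derivative (\<lambda>h. h $ i * F i (Suc (\<alpha> i)) (x $ i))) (at x)" for i
  proof -
    have "((\<lambda>x::real^'d. x $ i) has_derivative (\<lambda>h. h $ i)) (at x)"
      by (rule bounded_linear_imp_has_derivative[OF bounded_linear_vec_nth])
    from has_derivative_compose[OF this towerD[OF assms, unfolded has_field_derivative_def]]
    show ?thesis by (simp add: mult.commute)
  qed
  then have "((\<lambda>x. \<Prod>i\<in>UNIV. F i (\<alpha> i) (x $ i)) has_derivative
      (\<lambda>h. \<Sum>i\<in>UNIV. h $ i * F i (Suc (\<alpha> i)) (x $ i) * (\<Prod>j\<in>UNIV - {i}. F j (\<alpha> j) (x $ j)))) (at x)"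
    by (rule has_derivative_prod)
  moreover have "F i (Suc (\<alpha> i)) (x $ i) * (\<Prod>j\<in>UNIV - {i}. F j (\<alpha> j) (x $ j)) = tens F (\<alpha>(i := Suc (\<alpha> i))) x" for i
    unfolding tens_def by (subst (2) prod.remove[of _ i]) (auto intro!: prod.cong)
  ultimately show ?thesis
    by (simp add: tens_def[abs_def] mult.assoc)
qed

lemma partial_deriv_tens:
  fixes F :: "'d::finite \<Rightarrow> nat \<Rightarrow> real \<Rightarrow> real"
  assumes "\<And>i. tower (F i)"
  shows "partial_deriv i (tens F \<alpha>) = tens F (\<alpha>(i := Suc (\<alpha> i)))"
proof
  fix x
  have "partial_deriv i (tens F \<alpha>) x = (\<Sum>j\<in>UNIV. axis i 1 $ j * tens F (\<alpha>(j := Suc (\<alpha> j))) x)"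
    unfolding partial_deriv_def
    by (subst frechet_derivative_at[OF tens_has_derivative[OF assms], symmetric]) simp
  also have "\<dots> = (\<Sum>j\<in>UNIV. if j = i then tens F (\<alpha>(j := Suc (\<alpha> j))) x else 0)"
    by (intro sum.cong) (auto simp: axis_def)
  finally show "partial_deriv i (tens F \<alpha>) x = tens F (\<alpha>(i := Suc (\<alpha> i))) x"
    by simp
qed

lemma iter_partial_deriv_tens:
  fixes F :: "'d::finite \<Rightarrow> nat \<Rightarrow> real \<Rightarrow> real"
  assumes "\<And>i. tower (F i)"
  shows "iter_partial_deriv is (tens F \<alpha>) = tens F (\<lambda>i. \<alpha> i + count_list is i)"
proof (induction "is")
  case (Cons i "is")
  then show ?case
    by (simp add: iter_partial_deriv_def partial_deriv_tens[OF assms])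
       (rule arg_cong[where f="tens F"], auto)
qed (simp add: iter_partial_deriv_def)

lemma ex_list_with_counts:
  fixes \<alpha> :: "'d::finite \<Rightarrow> nat"
  shows "\<exists>is. \<forall>i. count_list is i = \<alpha> i"
proof -
  obtain xs where "mset xs = Abs_multiset \<alpha>" using ex_mset by blast
  moreover have "count (Abs_multiset \<alpha>) = \<alpha>" by (simp add: Abs_multiset_inverse)
  ultimately show ?thesis by (metis count_mset)
qed

text \<open>Only the number of occurrences of each direction matters in the list that \<open>multi_deriv\<close> picks.\<close>

lemma multi_deriv_tens:
  fixes F :: "'d::finite \<Rightarrow> nat \<Rightarrow> real \<Rightarrow> real"
  assumes "\<And>i. tower (F i)"
  shows "multi_deriv \<beta> (tens F \<alpha>) = tens F (\<lambda>i. \<alpha> i + \<beta> i)"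
  unfolding multi_deriv_def iter_partial_deriv_tens[OF assms]
  using someI_ex[OF ex_list_with_counts[of \<beta>]] by simp

lemma smooth_tens:
  fixes F :: "'d::finite \<Rightarrow> nat \<Rightarrow> real \<Rightarrow> real"
  assumes "\<And>i. tower (F i)"
  shows "smooth (tens F \<alpha>)"
  unfolding smooth_def differentiable_on_def differentiable_def
    iter_partial_deriv_tens[of F, OF assms]
  using tens_has_derivative[of F, OF assms] by simp blast

lemma tens_continuous: "(\<And>i. tower (F i)) \<Longrightarrow> continuous_on S (tens F \<alpha>)"
  by (meson continuous_at_imp_continuous_on has_derivative_continuous tens_has_derivative)

lemma tens_measurable [measurable]: "(\<And>i. tower (F i)) \<Longrightarrow> tens F \<alpha> \<in> borel_measurable borel"
  by (intro borel_measurable_continuous_onI tens_continuous)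

section \<open>Integration by parts\<close>

lemma integrable_compact_support:
  fixes f :: "'a::euclidean_space \<Rightarrow> 'b::{banach, second_countable_topology}"
  assumes "continuous_on UNIV f" "compact C" "\<And>x. x \<notin> C \<Longrightarrow> f x = 0"
  shows "integrable lborel f"
proof -
  have "integrable lborel (\<lambda>x. indicator C x *\<^sub>R f x)"
    using assms(1,2) by (intro borel_integrable_compact) (auto intro: continuous_on_subset)
  moreover have "(\<lambda>x. indicator C x *\<^sub>R f x) = f"
    using assms(3) by (auto simp: fun_eq_iff indicator_def)
  ultimately show ?thesis by simp
qed

lemma bounded_compact_support:
  fixes f :: "'a::euclidean_space \<Rightarrow> 'b::real_normed_vector"
  assumes "continuous_on UNIV f" "compact C" "\<And>x. x \<notin> C \<Longrightarrow> f x = 0"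
  obtains B where "B \<ge> 0" "\<And>x. norm (f x) \<le> B"
proof -
  have "bounded (f ` C)"
    using assms(1,2) by (meson compact_continuous_image compact_imp_bounded continuous_on_subset subset_UNIV)
  then obtain B where "B > 0" "\<And>x. x \<in> C \<Longrightarrow> norm (f x) \<le> B"
    by (auto simp: bounded_pos)
  then show thesis using assms(3) by (intro that[of B]) (metis less_imp_le norm_zero)+
qed

lemma integral_translate:
  fixes f :: "'a::euclidean_space \<Rightarrow> 'b::{banach, second_countable_topology}"
  assumes "integrable lborel f"
  shows "integrable lborel (\<lambda>x. f (x + c))" "(\<integral>x. f (x + c) \<partial>lborel) = (\<integral>x. f x \<partial>lborel)"
proof -
  have m: "f \<in> borel_measurable borel" using assms by (auto dest: borel_measurable_integrable)
  have "integrable (distr lborel borel ((+) c)) f" by (simp add: lborel_distr_plus assms)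
  then show "integrable lborel (\<lambda>x. f (x + c))"
    by (subst (asm) integrable_distr_eq) (use m in \<open>auto simp: add.commute\<close>)
  have "(\<integral>x. f x \<partial>lborel) = (\<integral>x. f x \<partial>distr lborel borel ((+) c))" by (simp add: lborel_distr_plus)
  also have "\<dots> = (\<integral>x. f (c + x) \<partial>lborel)" using m by (subst integral_distr) auto
  finally show "(\<integral>x. f (x + c) \<partial>lborel) = (\<integral>x. f x \<partial>lborel)" by (simp add: add.commute)
qed

text \<open>The integrals of the difference quotients vanish by translation invariance. The mean value theorem
  dominates the quotients by a constant on a ball, so that the limit may be taken under the integral.\<close>

lemma integral_directional_derivative:
  fixes f :: "'a::euclidean_space \<Rightarrow> real"
  assumes f: "\<And>x. (f has_derivative f' x) (at x)"
    and cont: "continuous_on UNIV (\<lambda>x. f' x e)" and C: "compact C" "\<And>x. x \<notin> C \<Longrightarrow> f x = 0"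
    and z: "\<And>x. x \<notin> C \<Longrightarrow> f' x e = 0"
  shows "(\<integral>x. f' x e \<partial>lborel) = 0"
proof -
  have cf: "continuous_on UNIV f"
    using f by (meson continuous_at_imp_continuous_on has_derivative_continuous)
  obtain B where B: "B \<ge> 0" "\<And>x. \<bar>f' x e\<bar> \<le> B"
    using bounded_compact_support[OF cont C(1) z] by auto
  obtain R where R: "\<And>x. x \<in> C \<Longrightarrow> norm x \<le> R" using compact_imp_bounded[OF C(1)] by (auto simp: bounded_iff)
  define D where "D n x = real (Suc n) * (f (x + (1 / real (Suc n)) *\<^sub>R e) - f x)" for n x
  have line: "((\<lambda>t. f (x + t *\<^sub>R e)) has_real_derivative f' (x + t *\<^sub>R e) e) (at t)" for x t
  proof -
    have "((\<lambda>t. x + t *\<^sub>R e) has_derivative (\<lambda>t. t *\<^sub>R e)) (at t)"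
      by (auto intro!: derivative_eq_intros)
    from has_derivative_compose[OF this f]
    have "((\<lambda>t. f (x + t *\<^sub>R e)) has_derivative (\<lambda>s. f' (x + t *\<^sub>R e) (s *\<^sub>R e))) (at t)" .
    then show ?thesis
      unfolding has_field_derivative_def
      by (simp add: linear_cmul[OF has_derivative_linear[OF f]] mult.commute[of _ "f' _ e"])
  qed
  have dom: "norm (D n x) \<le> indicator (cball 0 (R + norm e)) x * B" for n x
  proof (cases "norm x \<le> R + norm e")
    case True
    obtain t where "f (x + (1 / real (Suc n)) *\<^sub>R e) - f (x + 0 *\<^sub>R e)
        = (1 / real (Suc n) - 0) * f' (x + t *\<^sub>R e) e"
      using MVT2[of 0 "1 / real (Suc n)" "\<lambda>t. f (x + t *\<^sub>R e)", OF _ line] by auto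
    then have "D n x = f' (x + t *\<^sub>R e) e" by (simp add: D_def del: of_nat_Suc)
    then show ?thesis using B True by (auto simp: indicator_def)
  next
    case False
    then have "x \<notin> C" using R[of x] norm_ge_zero[of e] by linarith
    moreover have "x + (1 / real (Suc n)) *\<^sub>R e \<notin> C"
    proof
      assume "x + (1 / real (Suc n)) *\<^sub>R e \<in> C"
      then have "norm (x + (1 / real (Suc n)) *\<^sub>R e) \<le> R" by (rule R)
      moreover have "norm ((1 / real (Suc n)) *\<^sub>R e) \<le> norm e"
        using mult_left_mono[of 1 "1 + real n" "norm e"] by (simp add: divide_le_eq)
      ultimately show False using False norm_triangle_ineq2[of x "- ((1 / real (Suc n)) *\<^sub>R e)"] by simp
    qed
    ultimately show ?thesis using B by (simp add: D_def C(2))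
  qed
  have "(\<lambda>n. \<integral>x. D n x \<partial>lborel) \<longlonglongrightarrow> (\<integral>x. f' x e \<partial>lborel)"
  proof (rule integral_dominated_convergence)
    show "(\<lambda>x. f' x e) \<in> borel_measurable lborel" using borel_measurable_continuous_onI[OF cont] by simp
    have [measurable]: "f \<in> borel_measurable borel" by (rule borel_measurable_continuous_onI[OF cf])
    show "D n \<in> borel_measurable lborel" for n unfolding D_def by measurable
    show "integrable lborel (\<lambda>x. indicator (cball 0 (R + norm e)) x * B)"
      using borel_integrable_compact[of "cball 0 (R + norm e)" "\<lambda>_. B"] by simp
    show "AE x in lborel. (\<lambda>n. D n x) \<longlonglongrightarrow> f' x e"
    proof (rule AE_I2)
      fix x
      have "((\<lambda>h. (f (x + h *\<^sub>R e) - f x) / h) \<longlongrightarrow> f' x e) (at 0)"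
        using line[of x 0] by (simp add: DERIV_def)
      moreover have "filterlim (\<lambda>n. 1 / real (Suc n)) (at 0) sequentially"
        unfolding filterlim_at using LIMSEQ_inverse_real_of_nat by (auto simp: inverse_eq_divide)
      ultimately have "(\<lambda>n. (f (x + (1 / real (Suc n)) *\<^sub>R e) - f x) / (1 / real (Suc n))) \<longlonglongrightarrow> f' x e"
        by (rule filterlim_compose)
      then show "(\<lambda>n. D n x) \<longlonglongrightarrow> f' x e" by (simp add: D_def mult.commute)
    qed
  qed (use dom in auto)
  moreover have "(\<integral>x. D n x \<partial>lborel) = 0" for n
    using integrable_compact_support[OF cf C] by (simp add: D_def integral_translate)
  ultimately show ?thesis by (simp add: LIMSEQ_const_iff)
qed

lemma partial_deriv_outside_support:
  assumes "closed C" "\<And>x. x \<notin> C \<Longrightarrow> f x = 0" "x \<notin> C"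
  shows "partial_deriv i f x = 0"
proof -
  have "(f has_derivative (\<lambda>_. 0)) (at x)"
    by (rule has_derivative_transform_within_open[where f = "\<lambda>_. 0" and s = "- C"]) (use assms in auto)
  then show ?thesis unfolding partial_deriv_def by (metis frechet_derivative_at)
qed

lemma iter_partial_deriv_outside_support:
  assumes "closed C" "\<And>x. x \<notin> C \<Longrightarrow> f x = 0" "x \<notin> C"
  shows "iter_partial_deriv is f x = 0"
proof -
  have "\<forall>x. x \<notin> C \<longrightarrow> iter_partial_deriv is f x = 0"
  proof (induction "is")
    case (Cons i "is")
    then show ?case
      using partial_deriv_outside_support[OF assms(1), of "iter_partial_deriv is f"]
      by (auto simp: iter_partial_deriv_def)
  qed (use assms in \<open>auto simp: iter_partial_deriv_def\<close>)
  then show ?thesis using assms(3) by blast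
qed

lemma iter_partial_deriv_continuous: "smooth f \<Longrightarrow> continuous_on S (iter_partial_deriv is f)"
  unfolding smooth_def using continuous_on_subset differentiable_imp_continuous_on by blast

text \<open>One derivative is moved at a time: the integral of a partial derivative of the product vanishes.
  The second factor is a tensor product, which keeps track of the derivatives that it has received.\<close>

lemma integration_by_parts:
  fixes \<phi> :: "real^'d::finite \<Rightarrow> real"
  assumes "smooth \<phi>" "compact C" "\<And>x. x \<notin> C \<Longrightarrow> \<phi> x = 0" "\<And>i. tower (F i)"
  shows "(\<integral>x. iter_partial_deriv is \<phi> x * tens F \<alpha> x \<partial>lborel)
    = (- 1) ^ length is * (\<integral>x. \<phi> x * tens F (\<lambda>i. \<alpha> i + count_list is i) x \<partial>lborel)"
proof (induction "is" arbitrary: \<alpha>)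
  case Nil
  show ?case by (simp add: iter_partial_deriv_def)
next
  case (Cons i "is")
  define \<psi> where "\<psi> = iter_partial_deriv is \<phi>"
  have i\<psi>: "iter_partial_deriv (i # is) \<phi> = partial_deriv i \<psi>" by (simp add: iter_partial_deriv_def \<psi>_def)
  have vanish: "iter_partial_deriv js \<phi> x = 0" if "x \<notin> C" for js x
    using iter_partial_deriv_outside_support[OF compact_imp_closed[OF assms(2)] assms(3) that] .
  have cont: "continuous_on UNIV (iter_partial_deriv js \<phi>)" for js
    by (rule iter_partial_deriv_continuous[OF assms(1)])
  note tc = tens_continuous[of F UNIV, OF assms(4)]
  have der: "(\<psi> has_derivative frechet_derivative \<psi> (at x)) (at x)" for x
    using assms(1) by (auto simp: smooth_def \<psi>_def differentiable_on_def frechet_derivative_works)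
  let ?D = "\<lambda>x h. \<psi> x * (\<Sum>j\<in>UNIV. h $ j * tens F (\<alpha>(j := Suc (\<alpha> j))) x)
      + frechet_derivative \<psi> (at x) h * tens F \<alpha> x"
  let ?a = "\<alpha>(i := Suc (\<alpha> i))"
  have D: "((\<lambda>x. \<psi> x * tens F \<alpha> x) has_derivative ?D x) (at x)" for x
    by (rule has_derivative_mult[OF der tens_has_derivative[OF assms(4)]])
  have Di: "?D x (axis i 1) = \<psi> x * tens F ?a x + iter_partial_deriv (i # is) \<phi> x * tens F \<alpha> x" for x
  proof -
    have "(\<Sum>j\<in>UNIV. (axis i 1 :: real^'d) $ j * tens F (\<alpha>(j := Suc (\<alpha> j))) x)
        = (\<Sum>j\<in>UNIV. if j = i then tens F (\<alpha>(j := Suc (\<alpha> j))) x else 0)"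
      by (intro sum.cong) (auto simp: axis_def)
    then show ?thesis by (simp add: i\<psi> partial_deriv_def)
  qed
  have int: "integrable lborel (\<lambda>x. \<psi> x * tens F ?a x)"
      "integrable lborel (\<lambda>x. iter_partial_deriv (i # is) \<phi> x * tens F \<alpha> x)"
    by (rule integrable_compact_support[OF _ assms(2)];
        use vanish in \<open>auto intro!: continuous_intros cont tc simp: \<psi>_def\<close>)+
  have "(\<integral>x. ?D x (axis i 1) \<partial>lborel) = 0"
  proof (rule integral_directional_derivative[OF D _ assms(2)])
    show "continuous_on UNIV (\<lambda>x. ?D x (axis i 1))"
      unfolding Di unfolding \<psi>_def by (intro continuous_intros cont tc)
    show "\<psi> x * tens F \<alpha> x = 0" "?D x (axis i 1) = 0" if "x \<notin> C" for x
      unfolding Di unfolding \<psi>_def using vanish[OF that] by simp_all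
  qed
  then have "(\<integral>x. iter_partial_deriv (i # is) \<phi> x * tens F \<alpha> x \<partial>lborel) = - (\<integral>x. \<psi> x * tens F ?a x \<partial>lborel)"
    unfolding Di using int by simp
  also have "\<dots> = - ((- 1) ^ length is * (\<integral>x. \<phi> x * tens F (\<lambda>j. ?a j + count_list is j) x \<partial>lborel))"
    unfolding \<psi>_def Cons.IH ..
  also have "(\<lambda>j. ?a j + count_list is j) = (\<lambda>j. \<alpha> j + count_list (i # is) j)" by auto
  finally show ?case by simp
qed


section \<open>Weak derivatives\<close>

lemma integral_lebesgue_on_support:
  fixes g :: "'a::euclidean_space \<Rightarrow> 'b::{banach, second_countable_topology}"
  assumes "g \<in> borel_measurable borel" "open U" "\<And>x. x \<notin> U \<Longrightarrow> g x = 0"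
  shows "(LINT x|lebesgue_on U. g x) = (\<integral>x. g x \<partial>lborel)"
proof -
  have "(LINT x|lebesgue_on U. g x) = (LINT x|lebesgue. indicator U x *\<^sub>R g x)"
    using assms(2) by (intro integral_restrict_space) auto
  also have "(\<lambda>x. indicator U x *\<^sub>R g x) = g" using assms(3) by (auto simp: fun_eq_iff indicator_def)
  finally show ?thesis using integral_completion[of g lborel] assms(1) by simp
qed

lemma integral_lebesgue_on_subset:
  fixes g :: "'a::euclidean_space \<Rightarrow> 'b::{banach, second_countable_topology}"
  assumes "open V" "open U" "V \<subseteq> U" "\<And>x. x \<notin> V \<Longrightarrow> g x = 0"
  shows "(LINT x|lebesgue_on V. g x) = (LINT x|lebesgue_on U. g x)"
proof -
  have "(\<lambda>x. indicator V x *\<^sub>R g x) = (\<lambda>x. indicator U x *\<^sub>R g x)"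
    using assms(3,4) by (auto simp: fun_eq_iff indicator_def)
  then show ?thesis using assms(1,2) by (simp add: integral_restrict_space)
qed

lemma integrable_locally_integrable_times:
  fixes f :: "real^'d::finite \<Rightarrow> real^'m::finite"
  assumes "f locally_integrable_on U" "open U" "continuous_on UNIV g" "compact C" "C \<subseteq> U"
    "\<And>x. x \<notin> C \<Longrightarrow> g x = (0::real)"
  shows "integrable (lebesgue_on U) (\<lambda>x. g x *\<^sub>R f x)"
proof -
  obtain B where B: "B \<ge> 0" "\<And>x. norm (g x) \<le> B"
    using bounded_compact_support[OF assms(3,4,6)] by auto
  have f: "integrable lebesgue (\<lambda>x. indicator C x *\<^sub>R f x)"
    using assms(1,4,5) by (auto simp: locally_integrable_on_def set_integrable_def)
  have g: "g \<in> borel_measurable lebesgue"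
    using borel_measurable_continuous_onI[OF assms(3)] by (simp add: measurable_completion)
  have eq: "g x *\<^sub>R indicator C x *\<^sub>R f x = indicator U x *\<^sub>R g x *\<^sub>R f x" for x
    using assms(5,6) by (auto simp: indicator_def)
  have "integrable lebesgue (\<lambda>x. g x *\<^sub>R indicator C x *\<^sub>R f x)"
  proof (rule Bochner_Integration.integrable_bound)
    show "integrable lebesgue (\<lambda>x. B *\<^sub>R (indicator C x *\<^sub>R f x))" using f by (rule integrable_scaleR_right)
    show "(\<lambda>x. g x *\<^sub>R indicator C x *\<^sub>R f x) \<in> borel_measurable lebesgue"
      by (intro borel_measurable_scaleR g borel_measurable_integrable[OF f])
    show "AE x in lebesgue. norm (g x *\<^sub>R indicator C x *\<^sub>R f x) \<le> norm (B *\<^sub>R (indicator C x *\<^sub>R f x))"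
      using B by (auto intro!: AE_I2 mult_right_mono simp: abs_mult indicator_def)
  qed
  then show ?thesis unfolding eq using assms(2) by (simp add: integrable_restrict_space)
qed

text \<open>Collects what is needed of a test function: its derivative of order \<open>\<alpha>\<close> is an iterated partial derivative in
  some order, and both functions are continuous with support in a common compact set.\<close>

lemma test_function_multi_deriv:
  assumes "test_function U \<phi>"
  obtains "is" C where "multi_deriv \<alpha> \<phi> = iter_partial_deriv is \<phi>" "\<And>i. count_list is i = \<alpha> i"
    "smooth \<phi>" "compact C" "C \<subseteq> U" "\<And>x. x \<notin> C \<Longrightarrow> \<phi> x = 0" "\<And>x. x \<notin> C \<Longrightarrow> multi_deriv \<alpha> \<phi> x = 0"
    "continuous_on UNIV \<phi>" "continuous_on UNIV (multi_deriv \<alpha> \<phi>)"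
proof -
  let ?is = "SOME is. \<forall>i. count_list is i = \<alpha> i" and ?C = "closure {x. \<phi> x \<noteq> 0}"
  have \<phi>: "smooth \<phi>" "compact ?C" "?C \<subseteq> U" using assms by (auto simp: test_function_def)
  have 0: "\<phi> x = 0" if "x \<notin> ?C" for x using that closure_subset[of "{x. \<phi> x \<noteq> 0}"] by blast
  show thesis
  proof (rule that[of ?is ?C])
    show "multi_deriv \<alpha> \<phi> = iter_partial_deriv ?is \<phi>" by (simp add: multi_deriv_def)
    show "count_list ?is i = \<alpha> i" for i using someI_ex[OF ex_list_with_counts[of \<alpha>]] by blast
    show "multi_deriv \<alpha> \<phi> x = 0" if "x \<notin> ?C" for x
      unfolding multi_deriv_def
      by (rule iter_partial_deriv_outside_support[OF compact_imp_closed[OF \<phi>(2)] 0 that])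
    show "continuous_on UNIV \<phi>"
      using iter_partial_deriv_continuous[OF \<phi>(1), of UNIV "[]"] by (simp add: iter_partial_deriv_def)
    show "continuous_on UNIV (multi_deriv \<alpha> \<phi>)"
      unfolding multi_deriv_def by (rule iter_partial_deriv_continuous[OF \<phi>(1)])
  qed (fact \<phi> 0)+
qed

lemma is_weak_deriv_diff:
  assumes "open U" "is_weak_deriv U \<alpha> u w" "is_weak_deriv U \<alpha> u' w'"
  shows "is_weak_deriv U \<alpha> (\<lambda>x. u x - u' x) (\<lambda>x. w x - w' x)"
  unfolding is_weak_deriv_def
proof (intro conjI allI impI)
  have li: "u locally_integrable_on U" "w locally_integrable_on U" "u' locally_integrable_on U" "w' locally_integrable_on U"
    using assms(2,3) by (auto simp: is_weak_deriv_def)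
  then show "(\<lambda>x. u x - u' x) locally_integrable_on U" "(\<lambda>x. w x - w' x) locally_integrable_on U"
    by (auto simp: locally_integrable_on_def intro!: set_integral_diff(1))
  fix \<phi> assume \<phi>: "test_function U \<phi>"
  obtain "is" C where C: "multi_deriv \<alpha> \<phi> = iter_partial_deriv is \<phi>" "\<And>i. count_list is i = \<alpha> i"
    "smooth \<phi>" "compact C" "C \<subseteq> U" "\<And>x. x \<notin> C \<Longrightarrow> \<phi> x = 0" "\<And>x. x \<notin> C \<Longrightarrow> multi_deriv \<alpha> \<phi> x = 0"
    "continuous_on UNIV \<phi>" "continuous_on UNIV (multi_deriv \<alpha> \<phi>)"
    by (rule test_function_multi_deriv[OF \<phi>, of \<alpha>]) (rule that)
  note i = integrable_locally_integrable_times[OF _ assms(1) _ C(4,5)]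
  show "(LINT x|lebesgue_on U. multi_deriv \<alpha> \<phi> x *\<^sub>R (u x - u' x)) =
        (- 1) ^ mi_order \<alpha> *\<^sub>R (LINT x|lebesgue_on U. \<phi> x *\<^sub>R (w x - w' x))"
    using assms(2,3) \<phi> i[OF li(1) C(9,7)] i[OF li(2) C(8,6)] i[OF li(3) C(9,7)] i[OF li(4) C(8,6)]
    by (simp add: scaleR_diff_right is_weak_deriv_def)
qed

lemma is_weak_deriv_subset:
  assumes "open U" "open V" "V \<subseteq> U" "is_weak_deriv U \<alpha> u w"
  shows "is_weak_deriv V \<alpha> u w"
  unfolding is_weak_deriv_def
proof (intro conjI allI impI)
  show "u locally_integrable_on V" "w locally_integrable_on V"
    using assms(3,4) unfolding is_weak_deriv_def locally_integrable_on_def by blast+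
  fix \<phi> assume \<phi>: "test_function V \<phi>"
  then have \<phi>U: "test_function U \<phi>" using assms(3) by (auto simp: test_function_def)
  obtain "is" C where C: "multi_deriv \<alpha> \<phi> = iter_partial_deriv is \<phi>" "\<And>i. count_list is i = \<alpha> i"
    "smooth \<phi>" "compact C" "C \<subseteq> V" "\<And>x. x \<notin> C \<Longrightarrow> \<phi> x = 0" "\<And>x. x \<notin> C \<Longrightarrow> multi_deriv \<alpha> \<phi> x = 0"
    "continuous_on UNIV \<phi>" "continuous_on UNIV (multi_deriv \<alpha> \<phi>)"
    by (rule test_function_multi_deriv[OF \<phi>, of \<alpha>]) (rule that)
  have "(LINT x|lebesgue_on V. multi_deriv \<alpha> \<phi> x *\<^sub>R u x) = (LINT x|lebesgue_on U. multi_deriv \<alpha> \<phi> x *\<^sub>R u x)"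
    "(LINT x|lebesgue_on V. \<phi> x *\<^sub>R w x) = (LINT x|lebesgue_on U. \<phi> x *\<^sub>R w x)"
    by (rule integral_lebesgue_on_subset[OF assms(2,1,3)]; use C(5-7) in auto)+
  then show "(LINT x|lebesgue_on V. multi_deriv \<alpha> \<phi> x *\<^sub>R u x) =
        (- 1) ^ mi_order \<alpha> *\<^sub>R (LINT x|lebesgue_on V. \<phi> x *\<^sub>R w x)"
    using assms(4) \<phi>U by (simp add: is_weak_deriv_def)
qed

section \<open>Polynomials\<close>

text \<open>The derivative of order \<open>\<alpha>\<close> of the monomial with exponents \<open>\<beta>\<close>.\<close>

definition mono_deriv :: "('d::finite \<Rightarrow> nat) \<Rightarrow> ('d \<Rightarrow> nat) \<Rightarrow> real^'d \<Rightarrow> real" where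
  "mono_deriv \<beta> = tens (\<lambda>i n. poly ((pderiv ^^ n) (monom 1 (\<beta> i))))"

lemma mono_deriv_0: "mono_deriv \<beta> (\<lambda>_. 0) x = (\<Prod>i\<in>UNIV. x $ i ^ \<beta> i)"
  by (simp add: mono_deriv_def tens_def poly_monom)

lemma higher_pderiv_monom: "n > m \<Longrightarrow> (pderiv ^^ n) (monom (a::real) m) = 0"
proof (induction n arbitrary: a m)
  case (Suc n)
  then show ?case
    by (cases "m = 0") (auto simp: funpow_Suc_right pderiv_monom monom_0 simp del: funpow.simps)
qed simp

lemma higher_pderiv_monom_same: "(pderiv ^^ n) (monom (a::real) n) = [:a * fact n:]"
  by (induction n arbitrary: a)
     (auto simp: funpow_Suc_right pderiv_monom monom_0 mult_ac simp del: funpow.simps)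

lemma mono_deriv_eq_0: "\<alpha> i > \<beta> i \<Longrightarrow> mono_deriv \<beta> \<alpha> x = 0"
  unfolding mono_deriv_def tens_def by (rule prod_zero) (auto simp: higher_pderiv_monom intro!: exI[of _ i])

lemma mono_deriv_same: "mono_deriv \<beta> \<beta> x = (\<Prod>i\<in>UNIV. fact (\<beta> i))"
  by (simp add: mono_deriv_def tens_def higher_pderiv_monom_same)

lemma mono_deriv_continuous: "continuous_on S (mono_deriv \<beta> \<alpha>)"
  unfolding mono_deriv_def by (rule tens_continuous) (rule tower_poly)

text \<open>The derivative of order \<open>\<alpha>\<close> of the polynomial with vector coefficients \<open>c\<close>. Polynomials are only used
  through their derivatives, the polynomial itself being the case \<open>\<alpha> = 0\<close>.\<close>

definition mpoly_deriv :: "('d::finite \<Rightarrow> nat) set \<Rightarrow> (('d \<Rightarrow> nat) \<Rightarrow> real^'m::finite) \<Rightarrow> ('d \<Rightarrow> nat) \<Rightarrow> real^'d \<Rightarrow> real^'m" where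
  "mpoly_deriv B c \<alpha> x = (\<Sum>\<beta>\<in>B. mono_deriv \<beta> \<alpha> x *\<^sub>R c \<beta>)"

lemma mpoly_deriv_continuous: "continuous_on S (mpoly_deriv B c \<alpha>)"
  unfolding mpoly_deriv_def by (intro continuous_intros mono_deriv_continuous)

lemma continuous_locally_integrable:
  fixes f :: "real^'d::finite \<Rightarrow> real^'m::finite"
  assumes "continuous_on UNIV f"
  shows "f locally_integrable_on U"
  unfolding locally_integrable_on_def
proof (intro allI impI)
  fix K :: "(real^'d) set" assume K: "compact K \<and> K \<subseteq> U"
  then have "integrable lborel (\<lambda>x. indicator K x *\<^sub>R f x)"
    using assms by (intro borel_integrable_compact) (auto intro: continuous_on_subset)
  then show "f absolutely_integrable_on K"
    unfolding set_integrable_def by (subst integrable_completion) (auto dest: borel_measurable_integrable)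
qed

lemma is_weak_deriv_mpoly:
  fixes c :: "('d::finite \<Rightarrow> nat) \<Rightarrow> real^'m::finite"
  assumes "open U"
  shows "is_weak_deriv U \<alpha> (mpoly_deriv B c (\<lambda>_. 0)) (mpoly_deriv B c \<alpha>)"
  unfolding is_weak_deriv_def
proof (intro conjI allI impI)
  show "mpoly_deriv B c (\<lambda>_. 0) locally_integrable_on U" "mpoly_deriv B c \<alpha> locally_integrable_on U"
    by (intro continuous_locally_integrable mpoly_deriv_continuous)+
  fix \<phi> assume \<phi>: "test_function U \<phi>"
  obtain "is" C where C: "multi_deriv \<alpha> \<phi> = iter_partial_deriv is \<phi>" "\<And>i. count_list is i = \<alpha> i"
    "smooth \<phi>" "compact C" "C \<subseteq> U" "\<And>x. x \<notin> C \<Longrightarrow> \<phi> x = 0" "\<And>x. x \<notin> C \<Longrightarrow> multi_deriv \<alpha> \<phi> x = 0"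
    "continuous_on UNIV \<phi>" "continuous_on UNIV (multi_deriv \<alpha> \<phi>)"
    by (rule test_function_multi_deriv[OF \<phi>, of \<alpha>]) (rule that)
  have len: "length is = mi_order \<alpha>"
    using sum_count_set[of "is" UNIV] by (simp add: mi_order_def C(2))
  have one: "(\<integral>x. multi_deriv \<alpha> \<phi> x * mono_deriv \<beta> (\<lambda>_. 0) x \<partial>lborel)
      = (- 1) ^ mi_order \<alpha> * (\<integral>x. \<phi> x * mono_deriv \<beta> \<alpha> x \<partial>lborel)" for \<beta>
    unfolding C(1) mono_deriv_def
    by (subst integration_by_parts[OF C(3,4,6)]) (auto simp: len C(2) intro: tower_poly)
  have sum: "(LINT x|lebesgue_on U. g x *\<^sub>R mpoly_deriv B c \<gamma> x)
      = (\<Sum>\<beta>\<in>B. (\<integral>x. g x * mono_deriv \<beta> \<gamma> x \<partial>lborel) *\<^sub>R c \<beta>)"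
    if g: "continuous_on UNIV g" "\<And>x. x \<notin> C \<Longrightarrow> g x = 0" for g \<gamma>
  proof -
    have int: "integrable lborel (\<lambda>x. g x * mono_deriv \<beta> \<gamma> x)" for \<beta>
      by (rule integrable_compact_support[OF _ C(4)])
         (use g in \<open>auto intro!: continuous_intros mono_deriv_continuous\<close>)
    have "(LINT x|lebesgue_on U. g x *\<^sub>R mpoly_deriv B c \<gamma> x) = (\<integral>x. g x *\<^sub>R mpoly_deriv B c \<gamma> x \<partial>lborel)"
      by (rule integral_lebesgue_on_support[OF _ assms])
         (use g C(5) in \<open>auto intro!: borel_measurable_continuous_onI continuous_intros mpoly_deriv_continuous\<close>)
    also have "\<dots> = (\<integral>x. (\<Sum>\<beta>\<in>B. (g x * mono_deriv \<beta> \<gamma> x) *\<^sub>R c \<beta>) \<partial>lborel)"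
      by (simp add: mpoly_deriv_def scaleR_sum_right)
    also have "\<dots> = (\<Sum>\<beta>\<in>B. (\<integral>x. g x * mono_deriv \<beta> \<gamma> x \<partial>lborel) *\<^sub>R c \<beta>)"
      using int by (subst Bochner_Integration.integral_sum) (auto intro!: integrable_scaleR_left)
    finally show ?thesis .
  qed
  show "(LINT x|lebesgue_on U. multi_deriv \<alpha> \<phi> x *\<^sub>R mpoly_deriv B c (\<lambda>_. 0) x) =
        (- 1) ^ mi_order \<alpha> *\<^sub>R (LINT x|lebesgue_on U. \<phi> x *\<^sub>R mpoly_deriv B c \<alpha> x)"
    by (subst sum[OF C(9,7)], assumption, subst sum[OF C(8,6)], assumption) (simp add: one scaleR_sum_right)
qed

section \<open>Continuity of translations in the mean\<close>

text \<open>The denominator is increased by one so that \<open>n = 0\<close> needs no separate treatment in later estimates.\<close>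

lemma times_divide_Suc_le: "n * (e / (n + 1)) \<le> e" if "n \<ge> 0" "e \<ge> 0" for n e :: real
proof -
  have "n * (e / (n + 1)) = e * (n / (n + 1))" by simp
  also have "\<dots> \<le> e * 1" using that by (intro mult_left_mono) auto
  finally show ?thesis by simp
qed

lemma nn_integral_affine:
  fixes f :: "'a::euclidean_space \<Rightarrow> ennreal"
  assumes [measurable]: "f \<in> borel_measurable borel" and "c \<noteq> 0"
  shows "(\<integral>\<^sup>+x. f x \<partial>lborel) = ennreal (\<bar>c\<bar> ^ DIM('a)) * (\<integral>\<^sup>+x. f (t + c *\<^sub>R x) \<partial>lborel)"
  by (subst lborel_affine[OF assms(2), of t])
     (simp add: nn_integral_density nn_integral_distr nn_integral_cmult)

lemma nn_integral_reflect:
  fixes f :: "'a::euclidean_space \<Rightarrow> ennreal"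
  assumes "f \<in> borel_measurable borel"
  shows "(\<integral>\<^sup>+x. f (t - x) \<partial>lborel) = (\<integral>\<^sup>+x. f x \<partial>lborel)"
  using nn_integral_affine[OF assms, of "-1" t] by simp

lemma nn_integral_shift:
  fixes f :: "'a::euclidean_space \<Rightarrow> ennreal"
  assumes "f \<in> borel_measurable borel"
  shows "(\<integral>\<^sup>+x. f (x - t) \<partial>lborel) = (\<integral>\<^sup>+x. f x \<partial>lborel)"
  using nn_integral_affine[OF assms, of 1 "- t"] by (simp add: algebra_simps)

definition L1_translation_continuous :: "('a::euclidean_space \<Rightarrow> 'b::{banach, second_countable_topology}) \<Rightarrow> bool" where
  "L1_translation_continuous f \<longleftrightarrow>
     (\<forall>e>0. \<exists>\<delta>>0. \<forall>z. norm z < \<delta> \<longrightarrow> (\<integral>\<^sup>+x. norm (f (x - z) - f x) \<partial>lborel) \<le> ennreal e)"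

text \<open>The property passes to approximations in the mean, because translations preserve the \<open>L\<^sup>1\<close> distance.\<close>

lemma L1_translation_continuous_approx:
  fixes f :: "'a::euclidean_space \<Rightarrow> 'b::{banach, second_countable_topology}"
  assumes f[measurable]: "f \<in> borel_measurable borel"
    and g: "\<And>e. e > 0 \<Longrightarrow> \<exists>g\<in>borel_measurable borel. L1_translation_continuous g \<and>
      (\<integral>\<^sup>+x. norm (f x - g x) \<partial>lborel) \<le> ennreal e"
  shows "L1_translation_continuous f"
  unfolding L1_translation_continuous_def
proof (intro allI impI)
  fix e :: real assume "e > 0"
  then obtain g where [measurable]: "g \<in> borel_measurable borel" and "L1_translation_continuous g"
    and fg: "(\<integral>\<^sup>+x. norm (f x - g x) \<partial>lborel) \<le> ennreal (e / 3)" using g[of "e / 3"] by auto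
  then obtain \<delta> where \<delta>: "\<delta> > 0" "\<And>z. norm z < \<delta> \<Longrightarrow> (\<integral>\<^sup>+x. norm (g (x - z) - g x) \<partial>lborel) \<le> ennreal (e / 3)"
    using \<open>e > 0\<close> \<open>L1_translation_continuous g\<close>[unfolded L1_translation_continuous_def, rule_format, of "e / 3"] by auto
  have "(\<integral>\<^sup>+x. norm (f (x - z) - f x) \<partial>lborel) \<le> ennreal e" if "norm z < \<delta>" for z
  proof -
    have "norm (f (x - z) - f x) \<le> norm (f (x - z) - g (x - z)) + norm (g (x - z) - g x) + norm (f x - g x)" for x
      using norm_triangle_ineq[of "f (x - z) - g (x - z)" "g (x - z) - g x"]
        norm_triangle_ineq4[of "f (x - z) - g x" "f x - g x"] by simp
    then have "(\<integral>\<^sup>+x. norm (f (x - z) - f x) \<partial>lborel)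
        \<le> (\<integral>\<^sup>+x. ennreal (norm (f (x - z) - g (x - z))) + norm (g (x - z) - g x) + norm (f x - g x) \<partial>lborel)"
      by (intro nn_integral_mono) (simp flip: ennreal_plus)
    also have "\<dots> = (\<integral>\<^sup>+x. norm (f (x - z) - g (x - z)) \<partial>lborel) + (\<integral>\<^sup>+x. norm (g (x - z) - g x) \<partial>lborel)
        + (\<integral>\<^sup>+x. norm (f x - g x) \<partial>lborel)"
      by (simp add: nn_integral_add)
    also have "(\<integral>\<^sup>+x. norm (f (x - z) - g (x - z)) \<partial>lborel) = (\<integral>\<^sup>+x. norm (f x - g x) \<partial>lborel)"
      using nn_integral_shift[of "\<lambda>x. norm (f x - g x)" z] by simp
    also have "(\<integral>\<^sup>+x. norm (f x - g x) \<partial>lborel) + (\<integral>\<^sup>+x. norm (g (x - z) - g x) \<partial>lborel)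
        + (\<integral>\<^sup>+x. norm (f x - g x) \<partial>lborel) \<le> ennreal (e / 3) + ennreal (e / 3) + ennreal (e / 3)"
      using fg \<delta>(2)[OF that] by (intro add_mono)
    also have "\<dots> = ennreal e" using \<open>e > 0\<close> by (simp flip: ennreal_plus)
    finally show ?thesis .
  qed
  then show "\<exists>\<delta>>0. \<forall>z. norm z < \<delta> \<longrightarrow> (\<integral>\<^sup>+x. norm (f (x - z) - f x) \<partial>lborel) \<le> ennreal e"
    using \<delta>(1) by blast
qed

lemma L1_translation_continuous_limit:
  fixes f :: "'a::euclidean_space \<Rightarrow> 'b::{banach, second_countable_topology}"
  assumes [measurable]: "f \<in> borel_measurable borel" "\<And>n. s n \<in> borel_measurable borel"
    and "\<And>n::nat. L1_translation_continuous (s n)"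
    and "(\<lambda>n. \<integral>\<^sup>+x. norm (f x - s n x) \<partial>lborel) \<longlonglongrightarrow> 0"
  shows "L1_translation_continuous f"
proof (rule L1_translation_continuous_approx)
  fix e :: real assume "e > 0"
  then have "\<forall>\<^sub>F n in sequentially. (\<integral>\<^sup>+x. norm (f x - s n x) \<partial>lborel) < ennreal e"
    using assms(4) by (intro order_tendstoD) auto
  then obtain n where "(\<integral>\<^sup>+x. norm (f x - s n x) \<partial>lborel) < ennreal e"
    by (auto simp: eventually_sequentially)
  then show "\<exists>g\<in>borel_measurable borel. L1_translation_continuous g \<and>
      (\<integral>\<^sup>+x. norm (f x - g x) \<partial>lborel) \<le> ennreal e"
    using assms(3) by (intro bexI[of _ "s n"]) auto
qed fact

text \<open>Let \<open>U\<close> be an open neighbourhood of \<open>K\<close> with \<open>U - K\<close> of small measure. A small translate of \<open>K\<close> stays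
  inside \<open>U\<close>, and the part of \<open>K\<close> that leaves \<open>K + z\<close> is a translate of the part of \<open>K - z\<close> outside \<open>K\<close>.\<close>

lemma L1_translation_continuous_compact:
  fixes c :: "'b::{banach, second_countable_topology}" and K :: "'a::euclidean_space set"
  assumes "compact K"
  shows "L1_translation_continuous (\<lambda>x. indicator K x *\<^sub>R c)"
  unfolding L1_translation_continuous_def
proof (intro allI impI)
  fix e :: real assume "e > 0"
  define e0 where "e0 = e / (norm c + 1)"
  define e' where "e' = e0 / 2"
  have "e' > 0" using \<open>e > 0\<close> by (simp add: e'_def e0_def add_nonneg_pos)
  have [measurable]: "K \<in> sets borel" using assms by (simp add: borel_compact)
  obtain U where U: "open U" "K \<subseteq> U" "emeasure lborel (U - K) < e'"
    using outer_regular_lborel[of K e'] \<open>e' > 0\<close> by auto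
  obtain \<delta> where \<delta>: "\<delta> > 0" "(\<Union>x\<in>K. ball x \<delta>) \<subseteq> U"
    using compact_subset_open_imp_ball_epsilon_subset[OF assms U(1,2)] .
  have mU[measurable]: "U \<in> sets borel" using U(1) by simp
  have shift: "(\<integral>\<^sup>+x. indicator K (x - z) * indicator (- K) x \<partial>lborel) \<le> ennreal e'" if "norm z < \<delta>" for z
  proof -
    have "x \<in> U" if "x - z \<in> K" for x
    proof -
      have "x \<in> ball (x - z) \<delta>" using \<open>norm z < \<delta>\<close> by (simp add: dist_norm)
      then show ?thesis using that \<delta>(2) by blast
    qed
    then have "(\<integral>\<^sup>+x. indicator K (x - z) * indicator (- K) x \<partial>lborel) \<le> (\<integral>\<^sup>+x. indicator (U - K) x \<partial>lborel)"
      by (intro nn_integral_mono) (auto simp: indicator_def)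
    also have "\<dots> = emeasure lborel (U - K)" by simp
    finally show ?thesis using U(3) by order
  qed
  have "(\<integral>\<^sup>+x. norm (indicator K (x - z) *\<^sub>R c - indicator K x *\<^sub>R c) \<partial>lborel) \<le> ennreal e" if "norm z < \<delta>" for z
  proof -
    have "(\<integral>\<^sup>+x. norm (indicator K (x - z) *\<^sub>R c - indicator K x *\<^sub>R c) \<partial>lborel)
       = (\<integral>\<^sup>+x. ennreal (norm c) * (indicator K (x - z) * indicator (- K) x + indicator K x * indicator (- K) (x - z)) \<partial>lborel)"
      by (intro nn_integral_cong) (auto simp: indicator_def)
    also have "\<dots> = ennreal (norm c) * ((\<integral>\<^sup>+x. indicator K (x - z) * indicator (- K) x \<partial>lborel)
       + (\<integral>\<^sup>+x. indicator K x * indicator (- K) (x - z) \<partial>lborel))"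
      by (simp add: nn_integral_cmult nn_integral_add)
    also have "(\<integral>\<^sup>+x. indicator K x * indicator (- K) (x - z) \<partial>lborel)
       = (\<integral>\<^sup>+x. indicator K (x - (- z)) * indicator (- K) x \<partial>lborel)"
      using nn_integral_shift[of "\<lambda>x. indicator K (x - (- z)) * indicator (- K) x" z] by simp
    also have "ennreal (norm c) * ((\<integral>\<^sup>+x. indicator K (x - z) * indicator (- K) x \<partial>lborel)
       + (\<integral>\<^sup>+x. indicator K (x - (- z)) * indicator (- K) x \<partial>lborel)) \<le> ennreal (norm c) * (ennreal e' + ennreal e')"
      using shift[OF that] shift[of "- z"] that by (intro mult_left_mono add_mono) auto
    also have "\<dots> = ennreal (norm c * (2 * e'))"
      using \<open>e' > 0\<close> by (simp flip: ennreal_plus ennreal_mult')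
    also have "\<dots> \<le> ennreal e"
      using \<open>e > 0\<close> times_divide_Suc_le[of "norm c" e, folded e0_def] by (intro ennreal_leI) (simp add: e'_def)
    finally show ?thesis .
  qed
  then show "\<exists>\<delta>>0. \<forall>z. norm z < \<delta> \<longrightarrow>
      (\<integral>\<^sup>+x. norm (indicator K (x - z) *\<^sub>R c - indicator K x *\<^sub>R c) \<partial>lborel) \<le> ennreal e"
    using \<delta>(1) by blast
qed

lemma L1_translation_continuous_closed:
  fixes c :: "'b::{banach, second_countable_topology}" and T :: "'a::euclidean_space set"
  assumes "closed T" "emeasure lborel T < \<infinity>"
  shows "L1_translation_continuous (\<lambda>x. indicator T x *\<^sub>R c)"
proof -
  have T: "T \<in> sets borel" using assms(1) by simp
  have "(\<lambda>n. \<integral>\<^sup>+x. norm (indicator T x *\<^sub>R c - indicator (T \<inter> cball 0 (real n)) x *\<^sub>R c) \<partial>lborel) \<longlonglongrightarrow> 0"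
  proof (rule nn_integral_dominated_convergence_norm[where w = "\<lambda>x. indicator T x * norm c"])
    have "(\<integral>\<^sup>+x. indicator T x * ennreal (norm c) \<partial>lborel) < \<infinity>"
      using assms T by (simp add: nn_integral_multc ennreal_mult_less_top)
    then show "(\<integral>\<^sup>+x. ennreal (indicator T x * norm c) \<partial>lborel) < \<infinity>"
      by (simp add: ennreal_mult' ennreal_indicator)
    show "(\<lambda>x. indicator T x * norm c) \<in> borel_measurable lborel" using T by simp
    show "(\<lambda>x. indicator T x *\<^sub>R c) \<in> borel_measurable lborel" using T by simp
    show "(\<lambda>x. indicator (T \<inter> cball 0 (real n)) x *\<^sub>R c) \<in> borel_measurable lborel" for n
      using T by (intro borel_measurable_scaleR borel_measurable_indicator) auto
    show "AE x in lborel. norm (indicator (T \<inter> cball 0 (real n)) x *\<^sub>R c) \<le> indicator T x * norm c" for n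
      by (auto simp: indicator_def)
    show "AE x in lborel. (\<lambda>n. indicator (T \<inter> cball 0 (real n)) x *\<^sub>R c) \<longlonglongrightarrow> indicator T x *\<^sub>R c"
    proof (rule AE_I2)
      fix x :: 'a
      obtain N where "norm x \<le> real N" using real_arch_simple by blast
      then have "\<forall>\<^sub>F n in sequentially. indicator (T \<inter> cball 0 (real n)) x *\<^sub>R c = indicator T x *\<^sub>R c"
        by (intro eventually_sequentiallyI[of N]) (auto simp: indicator_def)
      then show "(\<lambda>n. indicator (T \<inter> cball 0 (real n)) x *\<^sub>R c) \<longlonglongrightarrow> indicator T x *\<^sub>R c"
        by (rule tendsto_eventually)
    qed
  qed
  then show ?thesis
    using T assms(1)
    by (intro L1_translation_continuous_limit[OF _ _ L1_translation_continuous_compact]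
        borel_measurable_scaleR borel_measurable_indicator) auto
qed

text \<open>Indicator functions are approximated from inside by closed sets, and these by compact sets; sums and
  limits give all integrable functions.\<close>

lemma L1_translation_continuous_integrable:
  fixes f :: "'a::euclidean_space \<Rightarrow> 'b::{banach, second_countable_topology}"
  assumes "integrable lborel f"
  shows "L1_translation_continuous f"
  using assms
proof (induction f rule: integrable_induct)
  case (base A c)
  show ?case
  proof (rule L1_translation_continuous_approx)
    show "(\<lambda>x. indicator A x *\<^sub>R c) \<in> borel_measurable borel" using base by simp
    fix e :: real assume "e > 0"
    then have "e / (norm c + 1) > 0" by (simp add: add_nonneg_pos)
    moreover have "A \<in> sets lebesgue" using base(1) by simp
    ultimately obtain T where T: "closed T" "T \<subseteq> A" "emeasure lebesgue (A - T) < ennreal (e / (norm c + 1))"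
      by (metis sets_lebesgue_inner_closed)
    have TA: "A \<in> sets borel" "T \<in> sets borel" using T(1) base(1) by auto
    have "emeasure lborel T < \<infinity>" using emeasure_mono[OF T(2), of lborel] base by (simp add: order_le_less_trans)
    then have "L1_translation_continuous (\<lambda>x. indicator T x *\<^sub>R c)"
      by (intro L1_translation_continuous_closed T)
    moreover have "(\<integral>\<^sup>+x. norm (indicator A x *\<^sub>R c - indicator T x *\<^sub>R c) \<partial>lborel) \<le> ennreal e"
    proof -
      have "(\<integral>\<^sup>+x. norm (indicator A x *\<^sub>R c - indicator T x *\<^sub>R c) \<partial>lborel)
          = (\<integral>\<^sup>+x. ennreal (norm c) * indicator (A - T) x \<partial>lborel)"
        using T(2) by (intro nn_integral_cong) (auto simp: indicator_def)
      also have "\<dots> = ennreal (norm c) * emeasure lborel (A - T)"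
        using TA by (simp add: nn_integral_cmult)
      also have "\<dots> \<le> ennreal (norm c) * ennreal (e / (norm c + 1))"
        using T(3) TA by (intro mult_left_mono) auto
      also have "\<dots> \<le> ennreal e"
        using \<open>e > 0\<close> times_divide_Suc_le[of "norm c" e] by (subst ennreal_mult'[symmetric]) (auto intro!: ennreal_leI)
      finally show ?thesis .
    qed
    ultimately show "\<exists>g\<in>borel_measurable borel. L1_translation_continuous g \<and>
        (\<integral>\<^sup>+x. norm (indicator A x *\<^sub>R c - g x) \<partial>lborel) \<le> ennreal e"
      using TA by (intro bexI[of _ "\<lambda>x. indicator T x *\<^sub>R c"]) auto
  qed
next
  case (add f g)
  have [measurable]: "f \<in> borel_measurable borel" "g \<in> borel_measurable borel"
    using add(1,2) by (auto dest: borel_measurable_integrable)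
  show ?case
    unfolding L1_translation_continuous_def
  proof (intro allI impI)
    fix e :: real assume "e > 0"
    obtain d1 where d1: "d1 > 0" "\<And>z. norm z < d1 \<Longrightarrow> (\<integral>\<^sup>+x. norm (f (x - z) - f x) \<partial>lborel) \<le> ennreal (e / 2)"
      using add.IH(1)[unfolded L1_translation_continuous_def, rule_format, of "e / 2"] \<open>e > 0\<close> by auto
    obtain d2 where d2: "d2 > 0" "\<And>z. norm z < d2 \<Longrightarrow> (\<integral>\<^sup>+x. norm (g (x - z) - g x) \<partial>lborel) \<le> ennreal (e / 2)"
      using add.IH(2)[unfolded L1_translation_continuous_def, rule_format, of "e / 2"] \<open>e > 0\<close> by auto
    have "(\<integral>\<^sup>+x. norm (f (x - z) + g (x - z) - (f x + g x)) \<partial>lborel) \<le> ennreal e" if "norm z < min d1 d2" for z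
    proof -
      have "(\<integral>\<^sup>+x. norm (f (x - z) + g (x - z) - (f x + g x)) \<partial>lborel)
          \<le> (\<integral>\<^sup>+x. ennreal (norm (f (x - z) - f x)) + norm (g (x - z) - g x) \<partial>lborel)"
        by (intro nn_integral_mono) (simp add: norm_diff_triangle_ineq flip: ennreal_plus)
      also have "\<dots> = (\<integral>\<^sup>+x. norm (f (x - z) - f x) \<partial>lborel) + (\<integral>\<^sup>+x. norm (g (x - z) - g x) \<partial>lborel)"
        by (simp add: nn_integral_add)
      also have "\<dots> \<le> ennreal (e / 2) + ennreal (e / 2)"
        using d1(2) d2(2) that by (intro add_mono) auto
      also have "\<dots> = ennreal e" using \<open>e > 0\<close> by (simp flip: ennreal_plus)
      finally show ?thesis .
    qed
    then show "\<exists>\<delta>>0. \<forall>z. norm z < \<delta> \<longrightarrow>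
        (\<integral>\<^sup>+x. norm (f (x - z) + g (x - z) - (f x + g x)) \<partial>lborel) \<le> ennreal e"
      using d1(1) d2(1) by (intro exI[of _ "min d1 d2"]) auto
  qed
next
  case (lim f s)
  have m: "f \<in> borel_measurable borel" "\<And>i. s i \<in> borel_measurable borel"
    using \<open>integrable lborel f\<close> \<open>\<And>i. integrable lborel (s i)\<close> by (auto dest: borel_measurable_integrable)
  show ?case
  proof (rule L1_translation_continuous_limit[of f s])
    show "(\<lambda>n. \<integral>\<^sup>+x. norm (f x - s n x) \<partial>lborel) \<longlonglongrightarrow> 0"
    proof (rule nn_integral_dominated_convergence_norm[where w = "\<lambda>x. 2 * norm (f x)"])
      show "(\<integral>\<^sup>+x. ennreal (2 * norm (f x)) \<partial>lborel) < \<infinity>"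
        using \<open>integrable lborel f\<close> m(1)
        by (simp add: integrable_iff_bounded ennreal_mult' nn_integral_cmult ennreal_mult_less_top)
    qed (use lim m in auto)
  qed (use lim m in auto)
qed

section \<open>Mollification\<close>

lemma tens_scale: "tens (\<lambda>i n t. s * F i n t) \<alpha> x = s ^ CARD('d) * tens F \<alpha> (x :: real^'d::finite)"
  by (simp add: tens_def prod.distrib)

text \<open>The same function of one variable is used in every coordinate. The supports shrink with \<open>\<epsilon>\<close> for all
  derivatives at once.\<close>

lemma mollifier_exists:
  assumes "\<epsilon> > 0"
  obtains F where "tower F" "\<And>x::real^'d::finite. tens (\<lambda>_. F) (\<lambda>_. 0) x \<ge> 0"
    "\<And>\<alpha> x::real^'d. norm x \<ge> \<epsilon> \<Longrightarrow> tens (\<lambda>_. F) \<alpha> x = 0"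
    "(\<integral>\<^sup>+x. ennreal (tens (\<lambda>_::'d. F) (\<lambda>_. 0) x) \<partial>lborel) = 1"
proof -
  obtain j where j: "tower j" "\<And>t. j 0 t \<ge> 0" "\<And>t. \<bar>t\<bar> < 1 \<Longrightarrow> j 0 t > 0" "\<And>n t. \<bar>t\<bar> \<ge> 1 \<Longrightarrow> j n t = 0"
    using bump_tower by blast
  \<comment> \<open>All coordinates below \<open>\<epsilon> / d\<close> in modulus force the norm below \<open>\<epsilon>\<close>.\<close>
  define a where "a = CARD('d) / \<epsilon>"
  have "a > 0" using assms by (simp add: a_def)
  define G where "G n t = a ^ n * j n (a * t + 0)" for n t
  have G: "tower G" unfolding G_def by (rule tower_affine[OF j(1)])
  let ?T = "tens (\<lambda>_::'d. G)"
  have nn: "?T (\<lambda>_. 0) x \<ge> 0" for x by (auto simp: tens_def G_def j(2) intro!: prod_nonneg)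
  have supp: "?T \<alpha> x = 0" if "norm x \<ge> \<epsilon>" for \<alpha> x
  proof (rule ccontr)
    assume "?T \<alpha> x \<noteq> 0"
    then have "j (\<alpha> i) (a * x $ i) \<noteq> 0" for i by (auto simp: tens_def G_def)
    then have "\<bar>a * x $ i\<bar> < 1" for i using j(4) by (metis not_less)
    then have "\<bar>x $ i\<bar> < \<epsilon> / CARD('d)" for i
      using \<open>a > 0\<close> assms by (simp add: a_def abs_mult field_simps)
    then have "(\<Sum>i\<in>UNIV. \<bar>x $ i\<bar>) < (\<Sum>i\<in>(UNIV::'d set). \<epsilon> / CARD('d))"
      by (intro sum_strict_mono) auto
    with norm_le_l1_cart[of x] that show False by simp
  qed
  have cont: "continuous_on UNIV (?T (\<lambda>_. 0))" by (intro tens_continuous G)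
  have int: "integrable lborel (?T (\<lambda>_. 0))"
    by (rule integrable_compact_support[OF cont, of "cball 0 \<epsilon>"]) (auto intro: supp)
  define I where "I = (\<integral>x. ?T (\<lambda>_. 0) x \<partial>lborel)"
  have nnI: "(\<integral>\<^sup>+x. ennreal (?T (\<lambda>_. 0) x) \<partial>lborel) = ennreal I"
    unfolding I_def using int nn by (intro nn_integral_eq_integral) auto
  have "I \<ge> 0" unfolding I_def using nn by (intro integral_nonneg_AE) auto
  moreover have "I \<noteq> 0"
  proof
    assume "I = 0"
    then have "AE x in lborel. ?T (\<lambda>_. 0) x = 0"
    proof -
      have "(\<integral>\<^sup>+x. ennreal (?T (\<lambda>_. 0) x) \<partial>lborel) = 0" using nnI \<open>I = 0\<close> by simp
      then have "AE x in lborel. ennreal (?T (\<lambda>_. 0) x) = 0"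
        using measurable_compose[OF tens_measurable[of "\<lambda>_::'d. G" "\<lambda>_. 0", OF G] measurable_ennreal]
        by (subst (asm) nn_integral_0_iff_AE) auto
      then show ?thesis using nn by (auto simp: ennreal_eq_0_iff elim!: eventually_mono intro!: order.antisym)
    qed
    then have "AE x in lborel. x \<notin> {x. ?T (\<lambda>_. 0) x > 0}" by auto
    moreover have op: "open {x. ?T (\<lambda>_. 0) x > 0}" using cont by (intro open_Collect_less) auto
    ultimately have "{x. ?T (\<lambda>_. 0) x > 0} \<in> null_sets lborel" by (subst AE_iff_null_sets) (auto dest: borel_open)
    then have "negligible {x. ?T (\<lambda>_. 0) x > 0}"
      unfolding negligible_iff_null_sets by (rule null_sets_completionI)
    moreover have "0 \<in> {x. ?T (\<lambda>_. 0) x > 0}" using j(3)[of 0] by (simp add: tens_def G_def)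
    ultimately show False using open_not_negligible[OF op] by blast
  qed
  ultimately have "I > 0" by simp
  \<comment> \<open>Scaling each factor by \<open>s\<close> multiplies the tensor product by \<open>s\<close> to the power of the dimension.\<close>
  define s where "s = (1 / I) powr (1 / CARD('d))"
  have s: "s > 0" using \<open>I > 0\<close> by (simp add: s_def)
  have "s ^ CARD('d) = s powr CARD('d)" using s by (simp add: powr_realpow)
  also have "\<dots> = 1 / I" using \<open>I > 0\<close> by (simp add: s_def powr_powr)
  finally have sI: "s ^ CARD('d) = 1 / I" .
  show thesis
  proof (rule that[of "\<lambda>n t. s * G n t"])
    show "tower (\<lambda>n t. s * G n t)" using G by (auto simp: tower_def intro: DERIV_cmult)
    have "(\<integral>\<^sup>+x. ennreal (tens (\<lambda>_::'d. \<lambda>n t. s * G n t) (\<lambda>_. 0) x) \<partial>lborel)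
        = (\<integral>\<^sup>+x. ennreal (1 / I) * ennreal (?T (\<lambda>_. 0) x) \<partial>lborel)"
      unfolding tens_scale sI using \<open>I > 0\<close> by (intro nn_integral_cong) (simp flip: ennreal_mult')
    also have "\<dots> = ennreal (1 / I) * ennreal I"
      unfolding nnI[symmetric] using measurable_compose[OF tens_measurable[of "\<lambda>_::'d. G" "\<lambda>_. 0", OF G] measurable_ennreal]
      by (intro nn_integral_cmult) auto
    also have "\<dots> = 1" using \<open>I > 0\<close> by (simp flip: ennreal_mult')
    finally show "(\<integral>\<^sup>+x. ennreal (tens (\<lambda>_::'d. \<lambda>n t. s * G n t) (\<lambda>_. 0) x) \<partial>lborel) = 1" .
  qed (use nn s supp in \<open>auto simp: tens_scale\<close>)
qed

definition conv :: "('a::euclidean_space \<Rightarrow> real) \<Rightarrow> ('a \<Rightarrow> 'b::{banach, second_countable_topology}) \<Rightarrow> 'a \<Rightarrow> 'b" where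
  "conv \<eta> f x = (\<integral>y. \<eta> (x - y) *\<^sub>R f y \<partial>lborel)"

lemma conv_measurable [measurable]:
  assumes [measurable]: "\<eta> \<in> borel_measurable borel" "f \<in> borel_measurable borel"
  shows "conv \<eta> f \<in> borel_measurable borel"
  unfolding conv_def[abs_def] by measurable

lemma integrable_bounded_times:
  fixes f :: "'a::euclidean_space \<Rightarrow> 'b::{banach, second_countable_topology}"
  assumes [measurable]: "g \<in> borel_measurable borel" and "\<And>x. \<bar>g x\<bar> \<le> B" and f: "integrable lborel f"
  shows "integrable lborel (\<lambda>x. g x *\<^sub>R f x)"
proof (rule Bochner_Integration.integrable_bound)
  have [measurable]: "f \<in> borel_measurable borel" using f by (auto dest: borel_measurable_integrable)
  show "integrable lborel (\<lambda>x. B *\<^sub>R f x)" using f by simp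
  show "(\<lambda>x. g x *\<^sub>R f x) \<in> borel_measurable lborel" by measurable
  have "\<bar>g x\<bar> \<le> \<bar>B\<bar>" for x using assms(2)[of x] by linarith
  then show "AE x in lborel. norm (g x *\<^sub>R f x) \<le> norm (B *\<^sub>R f x)"
    by (auto intro!: AE_I2 mult_right_mono)
qed

text \<open>The mollified function is an average of translates.\<close>

lemma conv_L1_distance:
  fixes f :: "'a::euclidean_space \<Rightarrow> 'b::{banach, second_countable_topology}"
  assumes [measurable]: "\<eta> \<in> borel_measurable borel" and \<eta>: "\<And>x. 0 \<le> \<eta> x" "\<And>x. \<eta> x \<le> B"
    and \<eta>1: "(\<integral>\<^sup>+x. ennreal (\<eta> x) \<partial>lborel) = 1" and supp: "\<And>x. norm x \<ge> \<delta> \<Longrightarrow> \<eta> x = 0"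
    and f: "integrable lborel f"
    and e: "\<And>z. norm z < \<delta> \<Longrightarrow> (\<integral>\<^sup>+x. norm (f (x - z) - f x) \<partial>lborel) \<le> ennreal e"
  shows "(\<integral>\<^sup>+x. norm (conv \<eta> f x - f x) \<partial>lborel) \<le> ennreal e"
proof -
  have [measurable]: "f \<in> borel_measurable borel" using f by (auto dest: borel_measurable_integrable)
  have "norm (conv \<eta> f x - f x) \<le> (\<integral>\<^sup>+z. ennreal (\<eta> z) * norm (f (x - z) - f x) \<partial>lborel)" for x
  proof -
    have 1: "(\<integral>\<^sup>+y. ennreal (\<eta> (x - y)) \<partial>lborel) = 1"
      using nn_integral_reflect[of "\<lambda>y. ennreal (\<eta> y)" x] \<eta>1 by simp
    have i\<eta>: "integrable lborel (\<lambda>y. \<eta> (x - y))"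
      using 1 \<eta>(1) by (intro integrableI_bounded) auto
    have "(\<integral>y. \<eta> (x - y) \<partial>lborel) = 1"
      using 1 \<eta>(1) by (subst integral_eq_nn_integral) auto
    then have "f x = (\<integral>y. \<eta> (x - y) *\<^sub>R f x \<partial>lborel)" by (simp add: integral_scaleR_left i\<eta>)
    moreover have i1: "integrable lborel (\<lambda>y. \<eta> (x - y) *\<^sub>R f y)"
      using \<eta> by (intro integrable_bounded_times[OF _ _ f, of _ B]) auto
    ultimately have "conv \<eta> f x - f x = (\<integral>y. \<eta> (x - y) *\<^sub>R (f y - f x) \<partial>lborel)"
      unfolding conv_def using i\<eta> by (simp add: scaleR_diff_right)
    moreover have "integrable lborel (\<lambda>y. \<eta> (x - y) *\<^sub>R (f y - f x))"
      unfolding scaleR_diff_right using i1 i\<eta> by (intro Bochner_Integration.integrable_diff) auto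
    ultimately have "norm (conv \<eta> f x - f x) \<le> (\<integral>\<^sup>+y. norm (\<eta> (x - y) *\<^sub>R (f y - f x)) \<partial>lborel)"
      by (metis integral_norm_bound_ennreal)
    also have "\<dots> = (\<integral>\<^sup>+y. ennreal (\<eta> (x - y)) * norm (f (x - (x - y)) - f x) \<partial>lborel)"
      using \<eta>(1) by (simp add: ennreal_mult')
    also have "\<dots> = (\<integral>\<^sup>+z. ennreal (\<eta> z) * norm (f (x - z) - f x) \<partial>lborel)"
      by (rule nn_integral_reflect) simp
    finally show ?thesis .
  qed
  then have "(\<integral>\<^sup>+x. norm (conv \<eta> f x - f x) \<partial>lborel)
      \<le> (\<integral>\<^sup>+x. \<integral>\<^sup>+z. ennreal (\<eta> z) * norm (f (x - z) - f x) \<partial>lborel \<partial>lborel)"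
    by (intro nn_integral_mono)
  also have "\<dots> = (\<integral>\<^sup>+z. \<integral>\<^sup>+x. ennreal (\<eta> z) * norm (f (x - z) - f x) \<partial>lborel \<partial>lborel)"
    by (rule lborel_pair.Fubini') simp
  also have "\<dots> = (\<integral>\<^sup>+z. ennreal (\<eta> z) * (\<integral>\<^sup>+x. norm (f (x - z) - f x) \<partial>lborel) \<partial>lborel)"
    by (simp add: nn_integral_cmult)
  also have "\<dots> \<le> (\<integral>\<^sup>+z. ennreal (\<eta> z) * ennreal e \<partial>lborel)"
  proof (rule nn_integral_mono)
    fix z show "ennreal (\<eta> z) * (\<integral>\<^sup>+x. norm (f (x - z) - f x) \<partial>lborel) \<le> ennreal (\<eta> z) * ennreal e"
      using e[of z] supp[of z] by (cases "norm z < \<delta>") (auto intro: mult_left_mono)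
  qed
  also have "\<dots> = ennreal e" by (simp add: nn_integral_multc \<eta>1)
  finally show ?thesis .
qed

text \<open>One mollifier serves finitely many functions, here a function and its weak partial derivatives.\<close>

lemma mollify:
  fixes f :: "'i \<Rightarrow> real^'d::finite \<Rightarrow> 'b::{banach, second_countable_topology}"
  assumes "finite I" "\<And>i. i \<in> I \<Longrightarrow> integrable lborel (f i)" "e > 0" "r > 0"
  obtains F where "tower F" "\<And>\<alpha> x::real^'d. norm x \<ge> r \<Longrightarrow> tens (\<lambda>_. F) \<alpha> x = 0"
    "\<And>i. i \<in> I \<Longrightarrow> (\<integral>\<^sup>+x. norm (conv (tens (\<lambda>_. F) (\<lambda>_. 0)) (f i) x - f i x) \<partial>lborel) \<le> ennreal e"
proof -
  have "\<exists>\<delta>>0. \<forall>z. norm z < \<delta> \<longrightarrow> (\<integral>\<^sup>+x. norm (f i (x - z) - f i x) \<partial>lborel) \<le> ennreal e" if "i \<in> I" for i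
    using L1_translation_continuous_integrable[OF assms(2)[OF that]] assms(3)
    unfolding L1_translation_continuous_def by blast
  then obtain \<delta> where \<delta>: "\<And>i. i \<in> I \<Longrightarrow> \<delta> i > 0"
    "\<And>i z. i \<in> I \<Longrightarrow> norm z < \<delta> i \<Longrightarrow> (\<integral>\<^sup>+x. norm (f i (x - z) - f i x) \<partial>lborel) \<le> ennreal e" by metis
  define d where "d = Min (insert r (\<delta> ` I))"
  have d: "d > 0" "d \<le> r" "\<And>i. i \<in> I \<Longrightarrow> d \<le> \<delta> i"
    using assms(1,4) \<delta>(1) by (auto simp: d_def)
  obtain F where F: "tower F" "\<And>x::real^'d::finite. tens (\<lambda>_. F) (\<lambda>_. 0) x \<ge> 0"
    "\<And>\<alpha> x::real^'d. norm x \<ge> d \<Longrightarrow> tens (\<lambda>_. F) \<alpha> x = 0"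
    "(\<integral>\<^sup>+x. ennreal (tens (\<lambda>_::'d. F) (\<lambda>_. 0) x) \<partial>lborel) = 1"
    using mollifier_exists[OF d(1)] by blast
  note m = tens_measurable[of "\<lambda>_::'d. F", OF F(1)] and c = tens_continuous[of "\<lambda>_::'d. F", OF F(1)]
  have v: "tens (\<lambda>_. F) (\<lambda>_. 0) x = 0" if "x \<notin> cball 0 d" for x :: "real^'d"
    by (rule F(3)) (use that in simp)
  obtain B where B: "\<And>x::real^'d. norm (tens (\<lambda>_. F) (\<lambda>_. 0) x) \<le> B"
    using bounded_compact_support[OF c compact_cball v] by blast
  show thesis
  proof (rule that[OF F(1)])
    show "(\<integral>\<^sup>+x. norm (conv (tens (\<lambda>_. F) (\<lambda>_. 0)) (f i) x - f i x) \<partial>lborel) \<le> ennreal e" if "i \<in> I" for i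
    proof (rule conv_L1_distance[OF m F(2) _ F(4) F(3) assms(2)[OF that]])
      show "tens (\<lambda>_. F) (\<lambda>_. 0) x \<le> B" for x :: "real^'d" using B[of x] by auto
      show "(\<integral>\<^sup>+x. norm (f i (x - z) - f i x) \<partial>lborel) \<le> ennreal e" if "norm z < d" for z
        using \<delta>(2)[OF \<open>i \<in> I\<close>, of z] d(3)[OF \<open>i \<in> I\<close>] that by linarith
    qed
    show "tens (\<lambda>_. F) \<alpha> x = 0" if "norm x \<ge> r" for \<alpha> and x :: "real^'d"
      by (rule F(3)) (use d(2) that in linarith)
  qed
qed

section \<open>Testing with tensor products\<close>

lemma tower_reflect: "tower F \<Longrightarrow> tower (\<lambda>n t. (- 1) ^ n * F n ((- 1) * t + c))"
  by (rule tower_affine)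

text \<open>The function \<open>y \<mapsto> \<eta> (x - y)\<close>, which occurs in a convolution at \<open>x\<close>, is again a tensor product.\<close>

lemma tens_reflect:
  "tens (\<lambda>i n t. (- 1) ^ n * F i n ((- 1) * t + x $ i)) \<alpha> y = (- 1) ^ mi_order \<alpha> * tens F \<alpha> (x - y)"
  by (simp add: tens_def prod.distrib mi_order_def power_sum)

text \<open>The mollifications of \<open>f\<close> vanish on \<open>A\<close> and converge to \<open>f\<close> in the mean.\<close>

lemma zero_if_tensor_tests_vanish:
  fixes f :: "real^'d::finite \<Rightarrow> 'b::{banach, second_countable_topology}"
  assumes f: "integrable lborel f" and [measurable]: "A \<in> sets borel" and "r > 0"
    and test: "\<And>x F. x \<in> A \<Longrightarrow> (\<And>i. tower (F i)) \<Longrightarrow> (\<And>y. y \<notin> ball x r \<Longrightarrow> tens F (\<lambda>_. 0) y = 0)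
      \<Longrightarrow> (\<integral>y. tens F (\<lambda>_. 0) y *\<^sub>R f y \<partial>lborel) = 0"
  shows "AE x in lborel. x \<in> A \<longrightarrow> f x = 0"
proof -
  have [measurable]: "f \<in> borel_measurable borel" using f by (auto dest: borel_measurable_integrable)
  have "(\<integral>\<^sup>+x. indicator A x * ennreal (norm (f x)) \<partial>lborel) \<le> 0"
  proof (rule ennreal_le_epsilon)
    fix e :: real assume "e > 0"
    then obtain F where F: "tower F" "\<And>\<alpha> x::real^'d. norm x \<ge> r \<Longrightarrow> tens (\<lambda>_. F) \<alpha> x = 0"
      "(\<integral>\<^sup>+x. norm (conv (tens (\<lambda>_. F) (\<lambda>_. 0)) f x - f x) \<partial>lborel) \<le> ennreal e"
      using mollify[of "{()}" "\<lambda>_. f" e r] f assms(3) by auto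
    have "conv (tens (\<lambda>_. F) (\<lambda>_. 0)) f x = 0" if "x \<in> A" for x
    proof -
      define R where "R i n t = (- 1) ^ n * F n ((- 1) * t + x $ i)" for i n t
      have R: "tens R (\<lambda>_. 0) y = tens (\<lambda>_. F) (\<lambda>_. 0) (x - y)" for y
        using tens_reflect[of "\<lambda>_. F" x "\<lambda>_. 0" y] by (simp add: R_def[abs_def] mi_order_def)
      have "tower (R i)" for i unfolding R_def by (rule tower_reflect[OF F(1)])
      moreover have "tens R (\<lambda>_. 0) y = 0" if "y \<notin> ball x r" for y
        using that F(2)[of "x - y"] by (simp add: R dist_norm)
      ultimately have "(\<integral>y. tens R (\<lambda>_. 0) y *\<^sub>R f y \<partial>lborel) = 0" by (rule test[OF that])
      then show ?thesis by (simp add: conv_def R)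
    qed
    then have "(\<integral>\<^sup>+x. indicator A x * ennreal (norm (f x)) \<partial>lborel)
        \<le> (\<integral>\<^sup>+x. norm (conv (tens (\<lambda>_. F) (\<lambda>_. 0)) f x - f x) \<partial>lborel)"
      by (intro nn_integral_mono) (auto simp: indicator_def)
    then show "(\<integral>\<^sup>+x. indicator A x * ennreal (norm (f x)) \<partial>lborel) \<le> 0 + ennreal e"
      using F(3) by simp
  qed
  then have "AE x in lborel. indicator A x * ennreal (norm (f x)) = 0"
    by (subst nn_integral_0_iff_AE[symmetric]) auto
  then show ?thesis by eventually_elim (auto simp: indicator_def split: if_splits)
qed

lemma test_function_tens:
  assumes "\<And>i. tower (F i)" "\<And>y. y \<notin> cball x r \<Longrightarrow> tens F (\<lambda>_. 0) y = 0" "cball x r \<subseteq> U"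
  shows "test_function U (tens F (\<lambda>_. 0))"
proof -
  have sub: "closure {x. tens F (\<lambda>_. 0) x \<noteq> 0} \<subseteq> cball x r"
  proof (rule closure_minimal)
    show "{x. tens F (\<lambda>_. 0) x \<noteq> 0} \<subseteq> cball x r" using assms(2) by blast
  qed simp
  then have "compact (closure {x. tens F (\<lambda>_. 0) x \<noteq> 0})"
    by (meson bounded_cball bounded_subset closed_closure compact_eq_bounded_closed)
  then show ?thesis
    unfolding test_function_def using smooth_tens[of F, OF assms(1)] sub assms(3) by auto
qed

lemma ex_borel_representative:
  fixes f :: "'a::euclidean_space \<Rightarrow> 'b::euclidean_space"
  assumes "f \<in> borel_measurable lebesgue"
  obtains g where "g \<in> borel_measurable borel" "AE x in lborel. f x = g x"
proof -
  have "\<exists>h\<in>borel_measurable lborel. AE x in lborel. f x \<bullet> b = h x" for b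
    using assms by (intro completion_ex_borel_measurable_real) auto
  then obtain h where h: "\<And>b. h b \<in> borel_measurable lborel" "\<And>b. AE x in lborel. f x \<bullet> b = h b x" by metis
  show thesis
  proof (rule that[of "\<lambda>x. \<Sum>b\<in>Basis. h b x *\<^sub>R b"])
    have [measurable]: "h b \<in> borel_measurable borel" for b using h(1)[of b] by simp
    show "(\<lambda>x. \<Sum>b\<in>Basis. h b x *\<^sub>R b) \<in> borel_measurable borel" by measurable
    have "AE x in lborel. \<forall>b\<in>Basis. f x \<bullet> b = h b x" using h(2) by (intro AE_finite_allI) auto
    then show "AE x in lborel. f x = (\<Sum>b\<in>Basis. h b x *\<^sub>R b)"
    proof eventually_elim
      case (elim x)
      have "f x = (\<Sum>b\<in>Basis. (f x \<bullet> b) *\<^sub>R b)" by (rule euclidean_representation[symmetric])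
      then show ?case using elim by simp
    qed
  qed
qed

lemma AE_lebesgue_iff_negligible: "(AE x in lebesgue. P x) \<longleftrightarrow> negligible {x. \<not> P x}"
  using completion.AE_iff_null_sets[of P lborel] by (simp add: negligible_iff_null_sets)

text \<open>The difference of two weak derivatives is tested with tensor products supported in a small ball around
  each point, where it is integrable; being negligible is a local property.\<close>

lemma weak_deriv_unique:
  fixes u :: "real^'d::finite \<Rightarrow> real^'m::finite"
  assumes U: "open U" and w: "is_weak_deriv U \<alpha> u w" "is_weak_deriv U \<alpha> u w'"
  shows "AE x in lebesgue_on U. w x = w' x"
proof -
  define f where "f x = w x - w' x" for x
  have d: "is_weak_deriv U \<alpha> (\<lambda>x. u x - u x) f"
    unfolding f_def by (rule is_weak_deriv_diff[OF U w])
  have test: "(LINT x|lebesgue_on U. \<phi> x *\<^sub>R f x) = 0" if "test_function U \<phi>" for \<phi>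
    using d that by (simp add: is_weak_deriv_def)
  have "negligible {x\<in>U. f x \<noteq> 0}"
  proof (subst locally_negligible_alt, intro ballI)
    fix x0 assume x0: "x0 \<in> {x\<in>U. f x \<noteq> 0}"
    then obtain R where R: "R > 0" "cball x0 R \<subseteq> U" using U by (metis (mono_tags) mem_Collect_eq open_contains_cball)
    define r where "r = R / 2"
    define K where "K = cball x0 R"
    have r: "r > 0" using R by (simp add: r_def)
    have f: "integrable lebesgue (\<lambda>x. indicator K x *\<^sub>R f x)"
      using d R by (auto simp: is_weak_deriv_def locally_integrable_on_def set_integrable_def K_def)
    then obtain g where g: "g \<in> borel_measurable borel" "AE x in lborel. indicator K x *\<^sub>R f x = g x"
      using ex_borel_representative borel_measurable_integrable by blast
    have g': "AE x in lebesgue. indicator K x *\<^sub>R f x = g x" by (rule AE_completion[OF g(2)])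
    have gl: "g \<in> borel_measurable lebesgue" using g(1) by (simp add: measurable_completion)
    have "integrable lebesgue g"
      using f g' integrable_cong_AE[OF borel_measurable_integrable[OF f] gl] by simp
    then have ig: "integrable lborel g" using g(1) by (simp add: integrable_completion)
    have "AE x in lborel. x \<in> ball x0 r \<longrightarrow> g x = 0"
    proof (rule zero_if_tensor_tests_vanish[OF ig _ r])
      fix x F assume x: "x \<in> ball x0 r" and F: "\<And>i. tower (F i)" and v: "\<And>y. y \<notin> ball x r \<Longrightarrow> tens F (\<lambda>_. 0) y = 0"
      have sub: "cball x r \<subseteq> K"
      proof
        fix y assume "y \<in> cball x r"
        then show "y \<in> K" using x dist_triangle[of x0 y x] by (simp add: K_def r_def)
      qed
      let ?t = "tens F (\<lambda>_. 0)"
      have m: "?t \<in> borel_measurable borel" by (rule tens_measurable[OF F])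
      have ml: "?t \<in> borel_measurable lebesgue" using m by (simp add: measurable_completion)
      have "(\<integral>y. ?t y *\<^sub>R g y \<partial>lborel) = (LINT y|lebesgue. ?t y *\<^sub>R g y)"
        using m g(1) by (subst integral_completion) auto
      also have "\<dots> = (LINT y|lebesgue. ?t y *\<^sub>R (indicator K y *\<^sub>R f y))"
      proof (rule integral_cong_AE)
        show "AE y in lebesgue. ?t y *\<^sub>R g y = ?t y *\<^sub>R (indicator K y *\<^sub>R f y)"
          using g' by eventually_elim simp
      qed (rule borel_measurable_scaleR[OF ml gl] borel_measurable_scaleR[OF ml borel_measurable_integrable[OF f]])+
      also have "(\<lambda>y. ?t y *\<^sub>R (indicator K y *\<^sub>R f y)) = (\<lambda>y. indicator U y *\<^sub>R (?t y *\<^sub>R f y))"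
      proof
        fix y
        show "?t y *\<^sub>R (indicator K y *\<^sub>R f y) = indicator U y *\<^sub>R (?t y *\<^sub>R f y)"
        proof (cases "y \<in> ball x r")
          case True
          then have "y \<in> K" "y \<in> U" using sub R(2) ball_subset_cball[of x r] unfolding K_def by blast+
          then show ?thesis by simp
        qed (use v in auto)
      qed
      also have "(LINT y|lebesgue. indicator U y *\<^sub>R (?t y *\<^sub>R f y)) = (LINT y|lebesgue_on U. ?t y *\<^sub>R f y)"
        using U by (simp add: integral_restrict_space)
      also have "\<dots> = 0"
      proof (rule test, rule test_function_tens[OF F])
        show "tens F (\<lambda>_. 0) y = 0" if "y \<notin> cball x r" for y using v that by simp
        show "cball x r \<subseteq> U" using sub R(2) K_def by blast
      qed
      finally show "(\<integral>y. ?t y *\<^sub>R g y \<partial>lborel) = 0" .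
    qed simp
    from AE_completion[OF this] g' have "AE x in lebesgue. x \<in> ball x0 r \<longrightarrow> f x = 0"
    proof eventually_elim
      case (elim x)
      have "x \<in> K" if "x \<in> ball x0 r" using that r by (simp add: K_def r_def)
      then show ?case using elim by (auto simp: indicator_def)
    qed
    then have "negligible {x. \<not> (x \<in> ball x0 r \<longrightarrow> f x = 0)}" by (simp only: AE_lebesgue_iff_negligible)
    then have "negligible ({x\<in>U. f x \<noteq> 0} \<inter> ball x0 r)" by (rule negligible_subset) auto
    then show "\<exists>V. openin (top_of_set {x\<in>U. f x \<noteq> 0}) V \<and> x0 \<in> V \<and> negligible V"
      using x0 r by (intro exI[of _ "{x\<in>U. f x \<noteq> 0} \<inter> ball x0 r"]) (auto simp: openin_open_Int)
  qed
  then have "negligible {x. \<not> (x \<in> U \<longrightarrow> f x = 0)}" by (rule negligible_subset) auto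
  then have "AE x in lebesgue. x \<in> U \<longrightarrow> f x = 0" by (simp only: AE_lebesgue_iff_negligible)
  then have "AE x in lebesgue_on U. f x = 0" using U by (subst AE_restrict_space_iff) auto
  then show ?thesis by (simp add: f_def)
qed

section \<open>Averages over chords\<close>

text \<open>The integral of \<open>\<Gamma>\<close> over the segment from \<open>y\<close> to \<open>x\<close>, parametrised by the unit interval.\<close>

definition chord :: "('a::euclidean_space \<Rightarrow> ennreal) \<Rightarrow> 'a \<Rightarrow> 'a \<Rightarrow> ennreal" where
  "chord \<Gamma> x y = (\<integral>\<^sup>+t. indicator {0..1::real} t * \<Gamma> (y + t *\<^sub>R (x - y)) \<partial>lborel)"

lemma chord_measurable [measurable]:
  assumes [measurable]: "\<Gamma> \<in> borel_measurable borel"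
  shows "(\<lambda>(x, y). chord \<Gamma> x y) \<in> borel_measurable (borel \<Otimes>\<^sub>M borel)"
  unfolding chord_def by measurable

text \<open>The substitution costs the factor \<open>c\<close> to the power minus the dimension.\<close>

lemma nn_integral_contraction_le:
  fixes f :: "'a::euclidean_space \<Rightarrow> ennreal"
  assumes "f \<in> borel_measurable borel" "c \<ge> 1 / 2"
  shows "(\<integral>\<^sup>+x. f (a + c *\<^sub>R x) \<partial>lborel) \<le> 2 ^ DIM('a) * (\<integral>\<^sup>+x. f x \<partial>lborel)"
proof -
  have "1 \<le> (2 * c) ^ DIM('a)" using assms(2) by (intro one_le_power) auto
  then have "ennreal 1 \<le> ennreal (2 ^ DIM('a) * \<bar>c\<bar> ^ DIM('a))"
    using assms(2) by (intro ennreal_leI) (simp add: power_mult_distrib)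
  then have "1 * (\<integral>\<^sup>+x. f (a + c *\<^sub>R x) \<partial>lborel)
      \<le> (ennreal (2 ^ DIM('a) * \<bar>c\<bar> ^ DIM('a))) * (\<integral>\<^sup>+x. f (a + c *\<^sub>R x) \<partial>lborel)"
    by (intro mult_right_mono) auto
  also have "\<dots> = 2 ^ DIM('a) * (\<integral>\<^sup>+x. f x \<partial>lborel)"
    using assms(2) by (subst nn_integral_affine[OF assms(1), of c a]) (auto simp: ennreal_mult' mult.assoc simp flip: ennreal_power)
  finally show ?thesis by simp
qed

text \<open>For a parameter \<open>t\<close> in the upper half of the unit interval the point \<open>y + t (x - y)\<close> is substituted
  for \<open>x\<close>, for \<open>t\<close> in the lower half it is substituted for \<open>y\<close>. The remaining variable contributes the
  measure of \<open>K\<close>.\<close>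

lemma chord_integral_le:
  fixes \<Gamma> :: "'a::euclidean_space \<Rightarrow> ennreal"
  assumes [measurable]: "\<Gamma> \<in> borel_measurable borel" "K \<in> sets borel"
  shows "(\<integral>\<^sup>+x. indicator K x * (\<integral>\<^sup>+y. indicator K y * chord \<Gamma> x y \<partial>lborel) \<partial>lborel)
    \<le> 2 ^ DIM('a) * emeasure lborel K * (\<integral>\<^sup>+x. \<Gamma> x \<partial>lborel)"
proof -
  define I where "I = (\<integral>\<^sup>+x. \<Gamma> x \<partial>lborel)"
  let ?g = "\<lambda>x y t. indicator K x * indicator K y * (indicator {0..1::real} t * \<Gamma> (y + t *\<^sub>R (x - y)))"
  have "(\<integral>\<^sup>+x. indicator K x * (\<integral>\<^sup>+y. indicator K y * chord \<Gamma> x y \<partial>lborel) \<partial>lborel)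
      = (\<integral>\<^sup>+x. \<integral>\<^sup>+y. \<integral>\<^sup>+t. ?g x y t \<partial>lborel \<partial>lborel \<partial>lborel)"
    unfolding chord_def by (simp add: nn_integral_cmult mult.assoc)
  also have "\<dots> = (\<integral>\<^sup>+x. \<integral>\<^sup>+t. \<integral>\<^sup>+y. ?g x y t \<partial>lborel \<partial>lborel \<partial>lborel)"
    by (intro nn_integral_cong lborel_pair.Fubini'[symmetric]) measurable
  also have "\<dots> = (\<integral>\<^sup>+t. \<integral>\<^sup>+x. \<integral>\<^sup>+y. ?g x y t \<partial>lborel \<partial>lborel \<partial>lborel)"
    by (rule lborel_pair.Fubini'[symmetric]) measurable
  also have "\<dots> \<le> (\<integral>\<^sup>+t. indicator {0..1::real} t * (2 ^ DIM('a) * emeasure lborel K * I) \<partial>lborel)"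
  proof (rule nn_integral_mono)
    fix t :: real
    consider "t \<notin> {0..1}" | "t \<in> {0..1}" "t \<ge> 1/2" | "t \<in> {0..1}" "1 - t \<ge> 1/2" by linarith
    then show "(\<integral>\<^sup>+x. \<integral>\<^sup>+y. ?g x y t \<partial>lborel \<partial>lborel) \<le> indicator {0..1} t * (2 ^ DIM('a) * emeasure lborel K * I)"
    proof cases
      case 2
      have "(\<integral>\<^sup>+x. \<integral>\<^sup>+y. ?g x y t \<partial>lborel \<partial>lborel) = (\<integral>\<^sup>+y. \<integral>\<^sup>+x. ?g x y t \<partial>lborel \<partial>lborel)"
        by (rule lborel_pair.Fubini'[symmetric]) measurable
      also have "\<dots> \<le> (\<integral>\<^sup>+y. indicator K y * (\<integral>\<^sup>+x. \<Gamma> ((1 - t) *\<^sub>R y + t *\<^sub>R x) \<partial>lborel) \<partial>lborel)"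
        by (simp add: nn_integral_cmult[symmetric])
           (intro nn_integral_mono, auto simp: indicator_def algebra_simps)
      also have "\<dots> \<le> (\<integral>\<^sup>+y. indicator K y * (2 ^ DIM('a) * I) \<partial>lborel)"
        unfolding I_def using 2 by (intro nn_integral_mono mult_left_mono nn_integral_contraction_le) auto
      also have "\<dots> = 2 ^ DIM('a) * emeasure lborel K * I" by (subst nn_integral_multc) (auto simp: mult_ac)
      finally show ?thesis using 2 by simp
    next
      case 3
      have "(\<integral>\<^sup>+x. \<integral>\<^sup>+y. ?g x y t \<partial>lborel \<partial>lborel)
          \<le> (\<integral>\<^sup>+x. indicator K x * (\<integral>\<^sup>+y. \<Gamma> (t *\<^sub>R x + (1 - t) *\<^sub>R y) \<partial>lborel) \<partial>lborel)"
        by (simp add: nn_integral_cmult[symmetric])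
           (intro nn_integral_mono, auto simp: indicator_def algebra_simps)
      also have "\<dots> \<le> (\<integral>\<^sup>+x. indicator K x * (2 ^ DIM('a) * I) \<partial>lborel)"
        unfolding I_def using 3 by (intro nn_integral_mono mult_left_mono nn_integral_contraction_le) auto
      also have "\<dots> = 2 ^ DIM('a) * emeasure lborel K * I" by (subst nn_integral_multc) (auto simp: mult_ac)
      finally show ?thesis using 3 by simp
    qed simp
  qed
  also have "\<dots> = 2 ^ DIM('a) * emeasure lborel K * I" by (simp add: nn_integral_multc)
  finally show ?thesis unfolding I_def .
qed

section \<open>Differences of mollified functions\<close>

definition unit_mi :: "'d \<Rightarrow> 'd \<Rightarrow> nat" where
  "unit_mi i = (\<lambda>_. 0)(i := Suc 0)"

lemma mi_order_unit [simp]: "mi_order (unit_mi i) = 1"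
  by (simp add: mi_order_def unit_mi_def fun_upd_def sum.If_cases)

text \<open>A weak first partial derivative, where only tensor products supported in balls serve as test functions
  and \<open>w\<close> and \<open>g\<close> are defined everywhere.\<close>

definition tensor_weak_deriv ::
    "(real^'d::finite) set \<Rightarrow> 'd \<Rightarrow> (real^'d \<Rightarrow> 'b::{banach, second_countable_topology}) \<Rightarrow> (real^'d \<Rightarrow> 'b) \<Rightarrow> bool" where
  "tensor_weak_deriv K i w g \<longleftrightarrow>
     (\<forall>F x r. (\<forall>j. tower (F j)) \<and> cball x r \<subseteq> K \<and> (\<forall>y. y \<notin> cball x r \<longrightarrow> tens F (\<lambda>_. 0) y = 0) \<longrightarrow>
        (\<integral>y. tens F (unit_mi i) y *\<^sub>R w y \<partial>lborel) = - (\<integral>y. tens F (\<lambda>_. 0) y *\<^sub>R g y \<partial>lborel))"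

lemma tens_difference:
  fixes F :: "'d::finite \<Rightarrow> nat \<Rightarrow> real \<Rightarrow> real"
  assumes "\<And>i. tower (F i)"
  shows "tens F (\<lambda>_. 0) (a + v) - tens F (\<lambda>_. 0) a
    = (\<integral>t. indicator {0..1} t * (\<Sum>i\<in>UNIV. v $ i * tens F (unit_mi i) (a + t *\<^sub>R v)) \<partial>lborel)"
proof -
  have "((\<lambda>t. tens F (\<lambda>_. 0) (a + t *\<^sub>R v)) has_real_derivative
      (\<Sum>i\<in>UNIV. v $ i * tens F (unit_mi i) (a + t *\<^sub>R v))) (at t)" for t
  proof -
    have "((\<lambda>t. a + t *\<^sub>R v) has_derivative (\<lambda>t. t *\<^sub>R v)) (at t)"
      by (auto intro!: derivative_eq_intros)
    from has_derivative_compose[OF this tens_has_derivative[where F = F and \<alpha> = "\<lambda>_. 0", OF assms]]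
    have "((\<lambda>t. tens F (\<lambda>_. 0) (a + t *\<^sub>R v)) has_derivative
        (\<lambda>s. \<Sum>i\<in>UNIV. (s *\<^sub>R v) $ i * tens F (unit_mi i) (a + t *\<^sub>R v))) (at t)"
      by (simp add: unit_mi_def)
    moreover have "(\<lambda>s. \<Sum>i\<in>UNIV. (s *\<^sub>R v) $ i * tens F (unit_mi i) (a + t *\<^sub>R v))
        = (*) (\<Sum>i\<in>UNIV. v $ i * tens F (unit_mi i) (a + t *\<^sub>R v))"
      by (auto simp: fun_eq_iff sum_distrib_left sum_distrib_right mult_ac)
    ultimately show ?thesis unfolding has_field_derivative_def by simp
  qed
  moreover have "isCont (\<lambda>t. \<Sum>i\<in>UNIV. v $ i * tens F (unit_mi i) (a + t *\<^sub>R v)) t" for t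
  proof -
    have "continuous_on UNIV (\<lambda>t. tens F (unit_mi i) (a + t *\<^sub>R v))" for i
      by (rule continuous_on_compose2[OF tens_continuous[OF assms, of UNIV]]) (auto intro!: continuous_intros)
    then have "continuous_on UNIV (\<lambda>t. \<Sum>i\<in>UNIV. v $ i * tens F (unit_mi i) (a + t *\<^sub>R v))"
      by (intro continuous_intros)
    then show ?thesis by (simp add: continuous_on_eq_continuous_at)
  qed
  ultimately show ?thesis
    using integral_FTC_Icc_real[of 0 1 "\<lambda>t. tens F (\<lambda>_. 0) (a + t *\<^sub>R v)"
      "\<lambda>t. \<Sum>i\<in>UNIV. v $ i * tens F (unit_mi i) (a + t *\<^sub>R v)"]
    by (simp add: mult.commute)
qed

text \<open>Away from the boundary mollification commutes with differentiation. The sign from the reflected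
  mollifier cancels the one in the definition of the weak derivative.\<close>

lemma conv_partial_deriv:
  fixes w :: "real^'d::finite \<Rightarrow> 'b::{banach, second_countable_topology}"
  assumes F: "tower F" and supp: "\<And>\<alpha> x::real^'d. norm x \<ge> r \<Longrightarrow> tens (\<lambda>_. F) \<alpha> x = 0"
    and wd: "tensor_weak_deriv K i w g" and "cball x r \<subseteq> K"
  shows "(\<integral>y. tens (\<lambda>_. F) (unit_mi i) (x - y) *\<^sub>R w y \<partial>lborel) = conv (tens (\<lambda>_. F) (\<lambda>_. 0)) g x"
proof -
  define R where "R i n t = (- 1) ^ n * F n ((- 1) * t + x $ i)" for i n t
  have R: "tens R \<alpha> y = (- 1) ^ mi_order \<alpha> * tens (\<lambda>_. F) \<alpha> (x - y)" for y \<alpha>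
    using tens_reflect[of "\<lambda>_. F" x \<alpha> y] by (simp add: R_def[abs_def])
  have "tower (R i)" for i unfolding R_def by (rule tower_reflect[OF F])
  moreover have "tens R (\<lambda>_. 0) y = 0" if "y \<notin> cball x r" for y
    using that supp[of "x - y"] by (simp add: R dist_norm)
  ultimately have "(\<integral>y. tens R (unit_mi i) y *\<^sub>R w y \<partial>lborel) = - (\<integral>y. tens R (\<lambda>_. 0) y *\<^sub>R g y \<partial>lborel)"
    using wd \<open>cball x r \<subseteq> K\<close> unfolding tensor_weak_deriv_def by blast
  then show ?thesis by (simp add: R conv_def mi_order_def[of "\<lambda>_. 0"])
qed

text \<open>The fundamental theorem of calculus is applied to the mollifier, not to \<open>w\<close>; Fubini then moves the
  integral over the chord outside, and the weak derivative takes over the derivative of the mollifier.\<close>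

lemma conv_difference_le:
  fixes w :: "real^'d::finite \<Rightarrow> 'b::{banach, second_countable_topology}"
  assumes F: "tower F" and supp: "\<And>\<alpha> x::real^'d. norm x \<ge> r \<Longrightarrow> tens (\<lambda>_. F) \<alpha> x = 0"
    and w: "integrable lborel w" and g: "\<And>i. integrable lborel (g i)"
    and wd: "\<And>i. tensor_weak_deriv K i w (g i)"
    and K: "\<And>t. t \<in> {0..1} \<Longrightarrow> cball (y + t *\<^sub>R (x - y)) r \<subseteq> K"
    and h: "norm (x - y) \<le> h"
  defines "\<eta> \<equiv> tens (\<lambda>_::'d. F) (\<lambda>_. 0)"
  shows "ennreal (norm (conv \<eta> w x - conv \<eta> w y))
    \<le> ennreal h * chord (\<lambda>z. \<Sum>i\<in>UNIV. ennreal (norm (conv \<eta> (g i) z))) x y"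
proof -
  let ?T = "tens (\<lambda>_::'d. F)"
  have mT[measurable]: "?T \<alpha> \<in> borel_measurable borel" for \<alpha> by (rule tens_measurable) (rule F)
  have [measurable]: "w \<in> borel_measurable borel" "g i \<in> borel_measurable borel" for i
    using w g by (auto dest: borel_measurable_integrable)
  have bnd: "\<exists>B\<ge>0. \<forall>x. \<bar>?T \<alpha> x\<bar> \<le> B" for \<alpha>
  proof -
    have "?T \<alpha> x = 0" if "x \<notin> cball 0 r" for x by (rule supp) (use that in simp)
    from bounded_compact_support[OF tens_continuous[where F = "\<lambda>_. F" and \<alpha> = \<alpha>, OF F] compact_cball this]
    show ?thesis by (metis real_norm_def)
  qed
  then obtain B where B: "\<And>\<alpha>. B \<alpha> \<ge> 0" "\<And>\<alpha> x. \<bar>?T \<alpha> x\<bar> \<le> B \<alpha>" by metis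
  define v where "v = x - y"
  let ?h = "\<lambda>z t. (indicator {0..1} t * (\<Sum>i\<in>UNIV. v $ i * ?T (unit_mi i) (y + t *\<^sub>R v - z))) *\<^sub>R w z"
  have i1: "integrable lborel (\<lambda>z. ?T \<alpha> (a - z) *\<^sub>R w z)" for a \<alpha>
    using B by (intro integrable_bounded_times[OF _ _ w, of _ "B \<alpha>"]) auto
  have diff: "?T (\<lambda>_. 0) (x - z) - ?T (\<lambda>_. 0) (y - z)
      = (\<integral>t. indicator {0..1} t * (\<Sum>i\<in>UNIV. v $ i * ?T (unit_mi i) (y + t *\<^sub>R v - z)) \<partial>lborel)" for z
    using tens_difference[of "\<lambda>_. F" "y - z" v, OF F] by (simp add: v_def algebra_simps)
  define C where "C = (\<Sum>i\<in>UNIV. \<bar>v $ i\<bar> * B (unit_mi i))"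
  have bC: "\<bar>indicator {0..1} t * (\<Sum>i\<in>UNIV. v $ i * ?T (unit_mi i) (y + t *\<^sub>R v - z))\<bar> \<le> C * indicator {0..1} t" for t z
  proof -
    have "\<bar>\<Sum>i\<in>UNIV. v $ i * ?T (unit_mi i) (y + t *\<^sub>R v - z)\<bar> \<le> C"
      unfolding C_def using B(2) by (intro order.trans[OF sum_abs] sum_mono) (simp add: abs_mult mult_left_mono)
    then show ?thesis by (auto simp: indicator_def)
  qed
  have "C \<ge> 0" unfolding C_def using B by (intro sum_nonneg) auto
  have "conv \<eta> w x - conv \<eta> w y = (\<integral>z. (?T (\<lambda>_. 0) (x - z) - ?T (\<lambda>_. 0) (y - z)) *\<^sub>R w z \<partial>lborel)"
    unfolding conv_def \<eta>_def scaleR_diff_left by (intro Bochner_Integration.integral_diff[symmetric] i1)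
  also have "\<dots> = (\<integral>z. \<integral>t. ?h z t \<partial>lborel \<partial>lborel)"
    unfolding diff
  proof (rule Bochner_Integration.integral_cong[OF refl])
    fix z
    have "integrable lborel (\<lambda>t. indicator {0..1} t * (\<Sum>i\<in>UNIV. v $ i * ?T (unit_mi i) (y + t *\<^sub>R v - z)))"
    proof (rule Bochner_Integration.integrable_bound)
      show "integrable lborel (\<lambda>t. C * indicator {0..1::real} t)" by simp
      show "AE t in lborel. norm (indicator {0..1} t * (\<Sum>i\<in>UNIV. v $ i * ?T (unit_mi i) (y + t *\<^sub>R v - z)))
          \<le> norm (C * indicator {0..1::real} t)"
        using bC \<open>C \<ge> 0\<close> by (auto simp: abs_mult)
    qed measurable
    then show "(\<integral>t. indicator {0..1} t * (\<Sum>i\<in>UNIV. v $ i * ?T (unit_mi i) (y + t *\<^sub>R v - z)) \<partial>lborel) *\<^sub>R w z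
      = (\<integral>t. ?h z t \<partial>lborel)" by simp
  qed
  also have "\<dots> = (\<integral>t. \<integral>z. ?h z t \<partial>lborel \<partial>lborel)"
  proof (rule lborel_pair.Fubini_integral, rule integrableI_bounded)
    show m: "(\<lambda>(t, z). ?h z t) \<in> borel_measurable (lborel \<Otimes>\<^sub>M lborel)" by measurable
    have "(\<integral>\<^sup>+p. ennreal (norm (case p of (t, z) \<Rightarrow> ?h z t)) \<partial>(lborel \<Otimes>\<^sub>M lborel))
        \<le> (\<integral>\<^sup>+p. (case p of (t, z) \<Rightarrow> ennreal (C * indicator {0..1::real} t) * ennreal (norm (w z))) \<partial>(lborel \<Otimes>\<^sub>M lborel))"
    proof (intro nn_integral_mono)
      fix p :: "real \<times> (real^'d)"
      obtain t z where p: "p = (t, z)" by force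
      show "ennreal (norm (case p of (t, z) \<Rightarrow> ?h z t))
          \<le> (case p of (t, z) \<Rightarrow> ennreal (C * indicator {0..1::real} t) * ennreal (norm (w z)))"
        unfolding p prod.case norm_scaleR
        by (subst ennreal_mult''[symmetric]) (auto intro!: ennreal_leI mult_right_mono bC)
    qed
    also have "\<dots> = (\<integral>\<^sup>+t. \<integral>\<^sup>+z. ennreal (C * indicator {0..1::real} t) * ennreal (norm (w z)) \<partial>lborel \<partial>lborel)"
      by (subst lborel.nn_integral_fst[symmetric]) auto
    also have "\<dots> = (\<integral>\<^sup>+t. ennreal (C * indicator {0..1::real} t) \<partial>lborel) * (\<integral>\<^sup>+z. ennreal (norm (w z)) \<partial>lborel)"
      by (simp add: nn_integral_cmult nn_integral_multc)
    also have "(\<integral>\<^sup>+t. ennreal (C * indicator {0..1::real} t) \<partial>lborel) = ennreal C"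
      using \<open>C \<ge> 0\<close> by (simp add: ennreal_mult' ennreal_indicator nn_integral_cmult)
    also have "ennreal C * (\<integral>\<^sup>+z. ennreal (norm (w z)) \<partial>lborel) < \<infinity>"
      using w by (simp add: integrable_iff_bounded ennreal_mult_less_top)
    finally show "(\<integral>\<^sup>+p. ennreal (norm (case p of (t, z) \<Rightarrow> ?h z t)) \<partial>(lborel \<Otimes>\<^sub>M lborel)) < \<infinity>" .
  qed
  also have "\<dots> = (\<integral>t. indicator {0..1} t *\<^sub>R (\<Sum>i\<in>UNIV. v $ i *\<^sub>R conv \<eta> (g i) (y + t *\<^sub>R v)) \<partial>lborel)"
  proof (rule Bochner_Integration.integral_cong[OF refl])
    fix t :: real
    have "(\<integral>z. ?h z t \<partial>lborel)
        = (\<integral>z. indicator {0..1} t *\<^sub>R (\<Sum>i\<in>UNIV. v $ i *\<^sub>R (?T (unit_mi i) (y + t *\<^sub>R v - z) *\<^sub>R w z)) \<partial>lborel)"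
      by (rule Bochner_Integration.integral_cong[OF refl])
         (simp add: sum_distrib_left scaleR_sum_left scaleR_sum_right mult.assoc)
    also have "\<dots> = indicator {0..1} t *\<^sub>R (\<Sum>i\<in>UNIV. v $ i *\<^sub>R (\<integral>z. ?T (unit_mi i) (y + t *\<^sub>R v - z) *\<^sub>R w z \<partial>lborel))"
    proof -
      have "(\<integral>z. (\<Sum>i\<in>UNIV. v $ i *\<^sub>R (?T (unit_mi i) (y + t *\<^sub>R v - z) *\<^sub>R w z)) \<partial>lborel)
          = (\<Sum>i\<in>UNIV. v $ i *\<^sub>R (\<integral>z. ?T (unit_mi i) (y + t *\<^sub>R v - z) *\<^sub>R w z \<partial>lborel))"
        using i1 by (subst Bochner_Integration.integral_sum)
          (auto intro!: Bochner_Integration.integrable_scaleR_right simp del: scaleR_scaleR)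
      then show ?thesis by (simp del: scaleR_scaleR)
    qed
    also have "\<dots> = indicator {0..1} t *\<^sub>R (\<Sum>i\<in>UNIV. v $ i *\<^sub>R conv \<eta> (g i) (y + t *\<^sub>R v))"
    proof (cases "t \<in> {0..1}")
      case True
      then show ?thesis
        using conv_partial_deriv[OF F supp wd, where x = "y + t *\<^sub>R v"] K[OF True] by (simp add: \<eta>_def v_def)
    qed simp
    finally show "(\<integral>z. ?h z t \<partial>lborel) = indicator {0..1} t *\<^sub>R (\<Sum>i\<in>UNIV. v $ i *\<^sub>R conv \<eta> (g i) (y + t *\<^sub>R v))" .
  qed
  finally have eq: "conv \<eta> w x - conv \<eta> w y
    = (\<integral>t. indicator {0..1} t *\<^sub>R (\<Sum>i\<in>UNIV. v $ i *\<^sub>R conv \<eta> (g i) (y + t *\<^sub>R v)) \<partial>lborel)" (is "_ = (\<integral>t. ?k t \<partial>lborel)") .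
  have [measurable]: "\<eta> \<in> borel_measurable borel" unfolding \<eta>_def by measurable
  have "ennreal (norm (\<integral>t. ?k t \<partial>lborel)) \<le> (\<integral>\<^sup>+t. ennreal (norm (?k t)) \<partial>lborel)"
  proof (cases "integrable lborel ?k")
    case True
    then show ?thesis by (rule integral_norm_bound_ennreal)
  qed (simp add: not_integrable_integral_eq)
  also have "\<dots> \<le> (\<integral>\<^sup>+t. ennreal h * (indicator {0..1} t * (\<Sum>i\<in>UNIV. ennreal (norm (conv \<eta> (g i) (y + t *\<^sub>R (x - y)))))) \<partial>lborel)"
  proof (rule nn_integral_mono)
    fix t :: real
    have "norm (\<Sum>i\<in>UNIV. v $ i *\<^sub>R conv \<eta> (g i) (y + t *\<^sub>R v)) \<le> (\<Sum>i\<in>UNIV. h * norm (conv \<eta> (g i) (y + t *\<^sub>R v)))"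
    proof (rule sum_norm_le)
      fix i
      have "\<bar>v $ i\<bar> \<le> h" using component_le_norm_cart[of v i] h by (simp add: v_def)
      then show "norm (v $ i *\<^sub>R conv \<eta> (g i) (y + t *\<^sub>R v)) \<le> h * norm (conv \<eta> (g i) (y + t *\<^sub>R v))"
        by (simp add: mult_right_mono)
    qed
    moreover have "h \<ge> 0" using h norm_ge_zero order.trans by blast
    ultimately show "ennreal (norm (?k t))
        \<le> ennreal h * (indicator {0..1} t * (\<Sum>i\<in>UNIV. ennreal (norm (conv \<eta> (g i) (y + t *\<^sub>R (x - y))))))"
      by (auto simp: indicator_def sum_distrib_left[symmetric] v_def simp flip: ennreal_mult' intro!: ennreal_leI)
  qed
  also have "\<dots> = ennreal h * chord (\<lambda>z. \<Sum>i\<in>UNIV. ennreal (norm (conv \<eta> (g i) z))) x y"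
    unfolding chord_def by (rule nn_integral_cmult) measurable
  finally show ?thesis unfolding eq .
qed


section \<open>The Poincare inequality\<close>

lemma ennreal_zero_if_small:
  assumes "M < \<infinity>" "\<And>e. e > 0 \<Longrightarrow> Z \<le> M * ennreal e"
  shows "Z = (0 :: ennreal)"
proof -
  obtain m where m: "M = ennreal m" "m \<ge> 0" using assms(1) by (cases M) auto
  have "Z \<le> 0"
  proof (rule ennreal_le_epsilon)
    fix e :: real assume e: "e > 0"
    then have "Z \<le> ennreal m * ennreal (e / (m + 1))" using m assms(2)[of "e / (m + 1)"] by simp
    also have "\<dots> = ennreal (m * (e / (m + 1)))" using m e by (intro ennreal_mult'[symmetric])
    also have "\<dots> \<le> ennreal e" using times_divide_Suc_le[of m e] m e by (intro ennreal_leI) auto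
    finally show "Z \<le> 0 + ennreal e" by simp
  qed
  then show ?thesis by simp
qed

text \<open>The limit of the inequality for mollified functions. The error terms are small in the mean, by
  \<open>chord_integral_le\<close> also those under the integral over the chord. Hence the integral of the truncated
  difference of both sides is arbitrarily small. Only points of distance more than \<open>\<delta>\<close> from the boundary are
  considered before \<open>\<delta>\<close> tends to zero.\<close>

lemma difference_le_chord:
  fixes w :: "real^'d::finite \<Rightarrow> 'b::{banach, second_countable_topology}"
  assumes K: "open K" "convex K" "bounded K"
    and w: "integrable lborel w" and g: "\<And>i. integrable lborel (g i)"
    and wd: "\<And>i. tensor_weak_deriv K i w (g i)"
    and h: "\<And>x y. x \<in> K \<Longrightarrow> y \<in> K \<Longrightarrow> norm (x - y) \<le> h"
  shows "AE x in lborel. x \<in> K \<longrightarrow> (AE y in lborel. y \<in> K \<longrightarrow>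
    ennreal (norm (w x - w y)) \<le> ennreal h * chord (\<lambda>z. \<Sum>i\<in>UNIV. ennreal (norm (g i z))) x y)"
proof -
  have [measurable]: "w \<in> borel_measurable borel" "g i \<in> borel_measurable borel" "K \<in> sets borel" for i
    using w g K by (auto dest: borel_measurable_integrable)
  define \<Gamma> where "\<Gamma> z = (\<Sum>i\<in>UNIV. ennreal (norm (g i z)))" for z
  have \<Gamma>_eq: "(\<lambda>z. \<Sum>i\<in>UNIV. ennreal (norm (g i z))) = \<Gamma>" by (rule ext) (rule \<Gamma>_def[symmetric])
  have [measurable]: "\<Gamma> \<in> borel_measurable borel" unfolding \<Gamma>_def by measurable
  \<comment> \<open>Points of \<open>K\<close> of distance more than \<open>\<delta>\<close> from the complement, around which the mollifier stays inside \<open>K\<close>.\<close>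
  define P where "P \<delta> = {x. \<delta> < infdist x (- K)}" for \<delta> :: real
  have [measurable]: "P \<delta> \<in> sets borel" for \<delta>
  proof -
    have "open (P \<delta>)" unfolding P_def by (intro open_Collect_less continuous_intros)
    then show ?thesis by simp
  qed
  have nonempty: "- K \<noteq> {}" using K(3) not_bounded_UNIV[where 'a = "real^'d"] by (metis double_compl Compl_empty_eq)
  have P: "cball x \<delta> \<subseteq> K" if "x \<in> P \<delta>" for x \<delta>
    using that infdist_le[of _ "- K" x] unfolding P_def by (force simp: dist_commute)
  have P': "x \<in> K" if "x \<in> P \<delta>" "\<delta> > 0" for x \<delta> using P[OF that(1)] that(2) by (meson centre_in_cball less_imp_le subsetD)
  have fin: "emeasure lborel K < \<infinity>" using K(3) by (rule emeasure_bounded_finite)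
  define A where "A x y = ennreal (norm (w x - w y))" for x y
  define B where "B x y = ennreal h * chord \<Gamma> x y" for x y
  have [measurable]: "(\<lambda>(x, y). A x y) \<in> borel_measurable (borel \<Otimes>\<^sub>M borel)" unfolding A_def by measurable
  have [measurable]: "(\<lambda>(x, y). B x y) \<in> borel_measurable (borel \<Otimes>\<^sub>M borel)" unfolding B_def by measurable
  have zero: "(\<integral>\<^sup>+x. indicator (P \<delta>) x * (\<integral>\<^sup>+y. indicator (P \<delta>) y * (A x y - B x y) \<partial>lborel) \<partial>lborel) = 0" if "\<delta> > 0" for \<delta>
  proof (rule ennreal_zero_if_small)
    let ?M = "emeasure lborel K + emeasure lborel K
        + ennreal h * (2 ^ DIM(real^'d) * emeasure lborel K * of_nat CARD('d))"
    show "?M < \<infinity>" using fin by (auto simp: ennreal_mult_less_top power_less_top_ennreal of_nat_less_top)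
    fix e :: real assume "e > 0"
    define fs where "fs = case_option w g"
    have fs: "integrable lborel (fs i)" for i using w g by (cases i) (auto simp: fs_def)
    obtain F where F: "tower F" "\<And>\<alpha> x::real^'d. norm x \<ge> \<delta> \<Longrightarrow> tens (\<lambda>_. F) \<alpha> x = 0"
      and close: "\<And>i. (\<integral>\<^sup>+x. norm (conv (tens (\<lambda>_. F) (\<lambda>_. 0)) (fs i) x - fs i x) \<partial>lborel) \<le> ennreal e"
      using mollify[of UNIV fs e \<delta>] fs \<open>e > 0\<close> \<open>\<delta> > 0\<close> by (metis UNIV_I finite)
    define \<eta> where "\<eta> = tens (\<lambda>_::'d. F) (\<lambda>_. 0)"
    have [measurable]: "\<eta> \<in> borel_measurable borel" unfolding \<eta>_def by (rule tens_measurable) (rule F(1))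
    define D where "D z = ennreal (norm (conv \<eta> w z - w z))" for z
    define E where "E z = (\<Sum>i\<in>UNIV. ennreal (norm (conv \<eta> (g i) z - g i z)))" for z
    have [measurable]: "D \<in> borel_measurable borel" "E \<in> borel_measurable borel"
      unfolding D_def E_def by measurable
    have Dint: "(\<integral>\<^sup>+z. D z \<partial>lborel) \<le> ennreal e" using close[of None] by (simp add: D_def fs_def \<eta>_def)
    have Eint: "(\<integral>\<^sup>+z. E z \<partial>lborel) \<le> of_nat CARD('d) * ennreal e"
    proof -
      have "(\<integral>\<^sup>+z. E z \<partial>lborel) = (\<Sum>i\<in>UNIV. \<integral>\<^sup>+z. ennreal (norm (conv \<eta> (g i) z - g i z)) \<partial>lborel)"
        unfolding E_def by (rule nn_integral_sum) measurable
      also have "\<dots> \<le> (\<Sum>i\<in>(UNIV::'d set). ennreal e)"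
        using close[of "Some i" for i] by (intro sum_mono) (simp add: fs_def \<eta>_def)
      finally show ?thesis by simp
    qed
    have AB: "A x y - B x y \<le> D x + D y + ennreal h * chord E x y" if "x \<in> P \<delta>" "y \<in> P \<delta>" for x y
    proof -
      have xy: "x \<in> K" "y \<in> K" using P' that \<open>\<delta> > 0\<close> by auto
      have "norm (w x - w y) \<le> norm (conv \<eta> w x - w x) + norm (conv \<eta> w y - w y) + norm (conv \<eta> w x - conv \<eta> w y)"
        using norm_triangle_ineq4[of "conv \<eta> w y - w y" "conv \<eta> w x - w x"]
          norm_triangle_ineq[of "(conv \<eta> w y - w y) - (conv \<eta> w x - w x)" "conv \<eta> w x - conv \<eta> w y"]
        by simp
      then have 1: "A x y \<le> D x + D y + ennreal (norm (conv \<eta> w x - conv \<eta> w y))"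
        unfolding A_def D_def by (simp flip: ennreal_plus)
      have 2: "ennreal (norm (conv \<eta> w x - conv \<eta> w y))
          \<le> ennreal h * chord (\<lambda>z. \<Sum>i\<in>UNIV. ennreal (norm (conv \<eta> (g i) z))) x y"
        unfolding \<eta>_def
      proof (rule conv_difference_le[OF F w g wd _ h[OF xy]])
        fix t :: real assume t: "t \<in> {0..1}"
        show "cball (y + t *\<^sub>R (x - y)) \<delta> \<subseteq> K"
        proof
          fix z assume z: "z \<in> cball (y + t *\<^sub>R (x - y)) \<delta>"
          \<comment> \<open>The same displacement at both end points stays in \<open>K\<close>, and \<open>K\<close> is convex.\<close>
          define v where "v = z - (y + t *\<^sub>R (x - y))"
          have v: "norm v \<le> \<delta>" using z by (simp add: v_def dist_norm norm_minus_commute)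
          then have "y + v \<in> K" "x + v \<in> K"
            using P[OF that(1)] P[OF that(2)] by (auto simp: subset_iff dist_norm)
          then have "(1 - t) *\<^sub>R (y + v) + t *\<^sub>R (x + v) \<in> K"
            using K(2) t by (intro convexD) auto
          moreover have "(1 - t) *\<^sub>R (y + v) + t *\<^sub>R (x + v) = z" by (simp add: v_def algebra_simps)
          ultimately show "z \<in> K" by simp
        qed
      qed
      have 3: "chord (\<lambda>z. \<Sum>i\<in>UNIV. ennreal (norm (conv \<eta> (g i) z))) x y \<le> chord \<Gamma> x y + chord E x y"
      proof -
        have "ennreal (norm (conv \<eta> (g i) z)) \<le> ennreal (norm (g i z)) + ennreal (norm (conv \<eta> (g i) z - g i z))" for i z
          using norm_triangle_ineq[of "g i z" "conv \<eta> (g i) z - g i z"] by (simp flip: ennreal_plus)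
        then have le: "(\<Sum>i\<in>UNIV. ennreal (norm (conv \<eta> (g i) z))) \<le> \<Gamma> z + E z" for z
          unfolding \<Gamma>_def E_def sum.distrib[symmetric] by (rule sum_mono)
        have "chord (\<lambda>z. \<Sum>i\<in>UNIV. ennreal (norm (conv \<eta> (g i) z))) x y \<le>
          (\<integral>\<^sup>+t. indicator {0..1::real} t * \<Gamma> (y + t *\<^sub>R (x - y)) + indicator {0..1} t * E (y + t *\<^sub>R (x - y)) \<partial>lborel)"
          unfolding chord_def distrib_left[symmetric] by (intro nn_integral_mono mult_left_mono le) auto
        also have "\<dots> = chord \<Gamma> x y + chord E x y"
          unfolding chord_def by (rule nn_integral_add) measurable
        finally show ?thesis .
      qed
      have "ennreal (norm (conv \<eta> w x - conv \<eta> w y)) \<le> B x y + ennreal h * chord E x y"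
        unfolding B_def distrib_left[symmetric] by (rule order.trans[OF 2 mult_left_mono[OF 3]]) simp
      then have "D x + D y + ennreal (norm (conv \<eta> w x - conv \<eta> w y))
          \<le> D x + D y + (B x y + ennreal h * chord E x y)" by (rule add_left_mono)
      with 1 have "A x y \<le> D x + D y + (B x y + ennreal h * chord E x y)" by (rule order.trans)
      then have "A x y \<le> B x y + (D x + D y + ennreal h * chord E x y)" by (simp add: ac_simps)
      then show ?thesis by (subst ennreal_minus_le_iff) (auto simp: A_def)
    qed
    have "(\<integral>\<^sup>+x. indicator (P \<delta>) x * (\<integral>\<^sup>+y. indicator (P \<delta>) y * (A x y - B x y) \<partial>lborel) \<partial>lborel)
      \<le> (\<integral>\<^sup>+x. indicator K x * (\<integral>\<^sup>+y. indicator K y * (D x + D y + ennreal h * chord E x y) \<partial>lborel) \<partial>lborel)"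
    proof (intro nn_integral_mono)
      fix x
      have "indicator (P \<delta>) x * (indicator (P \<delta>) y * (A x y - B x y))
          \<le> indicator K x * (indicator K y * (D x + D y + ennreal h * chord E x y))" for y
        using AB[of x y] P'[OF _ \<open>\<delta> > 0\<close>] by (auto simp: indicator_def)
      then show "indicator (P \<delta>) x * (\<integral>\<^sup>+y. indicator (P \<delta>) y * (A x y - B x y) \<partial>lborel)
          \<le> indicator K x * (\<integral>\<^sup>+y. indicator K y * (D x + D y + ennreal h * chord E x y) \<partial>lborel)"
        by (simp add: nn_integral_cmult[symmetric] nn_integral_mono)
    qed
    also have "\<dots> = (\<integral>\<^sup>+x. indicator K x * (D x * emeasure lborel K + (\<integral>\<^sup>+y. indicator K y * D y \<partial>lborel)
        + ennreal h * (\<integral>\<^sup>+y. indicator K y * chord E x y \<partial>lborel)) \<partial>lborel)"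
    proof (intro nn_integral_cong arg_cong2[where f = "(*)"] refl)
      fix x
      have "(\<integral>\<^sup>+y. indicator K y * (D x + D y + ennreal h * chord E x y) \<partial>lborel)
        = (\<integral>\<^sup>+y. D x * indicator K y + indicator K y * D y + ennreal h * (indicator K y * chord E x y) \<partial>lborel)"
        by (simp add: algebra_simps)
      also have "\<dots> = D x * emeasure lborel K + (\<integral>\<^sup>+y. indicator K y * D y \<partial>lborel)
        + ennreal h * (\<integral>\<^sup>+y. indicator K y * chord E x y \<partial>lborel)"
        by (simp add: nn_integral_add nn_integral_cmult)
      finally show "(\<integral>\<^sup>+y. indicator K y * (D x + D y + ennreal h * chord E x y) \<partial>lborel) = \<dots>" .
    qed
    also have "\<dots> = (\<integral>\<^sup>+x. indicator K x * D x \<partial>lborel) * emeasure lborel K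
        + (\<integral>\<^sup>+y. indicator K y * D y \<partial>lborel) * emeasure lborel K
        + ennreal h * (\<integral>\<^sup>+x. indicator K x * (\<integral>\<^sup>+y. indicator K y * chord E x y \<partial>lborel) \<partial>lborel)"
    proof -
      have "(\<integral>\<^sup>+x. indicator K x * (D x * emeasure lborel K + (\<integral>\<^sup>+y. indicator K y * D y \<partial>lborel)
        + ennreal h * (\<integral>\<^sup>+y. indicator K y * chord E x y \<partial>lborel)) \<partial>lborel)
        = (\<integral>\<^sup>+x. indicator K x * D x * emeasure lborel K + (\<integral>\<^sup>+y. indicator K y * D y \<partial>lborel) * indicator K x
        + ennreal h * (indicator K x * (\<integral>\<^sup>+y. indicator K y * chord E x y \<partial>lborel)) \<partial>lborel)"
        by (intro nn_integral_cong) (simp add: algebra_simps)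
      then show ?thesis by (simp add: nn_integral_add nn_integral_cmult nn_integral_multc)
    qed
    also have "\<dots> \<le> ennreal e * emeasure lborel K + ennreal e * emeasure lborel K
        + ennreal h * (2 ^ DIM(real^'d) * emeasure lborel K * (of_nat CARD('d) * ennreal e))"
    proof (intro add_mono mult_right_mono mult_left_mono)
      have "(\<integral>\<^sup>+x. indicator K x * D x \<partial>lborel) \<le> (\<integral>\<^sup>+x. D x \<partial>lborel)"
        by (intro nn_integral_mono) (auto simp: indicator_def)
      then show "(\<integral>\<^sup>+x. indicator K x * D x \<partial>lborel) \<le> ennreal e" "(\<integral>\<^sup>+x. indicator K x * D x \<partial>lborel) \<le> ennreal e"
        using Dint by order+
      have "(\<integral>\<^sup>+x. indicator K x * (\<integral>\<^sup>+y. indicator K y * chord E x y \<partial>lborel) \<partial>lborel)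
          \<le> 2 ^ DIM(real^'d) * emeasure lborel K * (\<integral>\<^sup>+z. E z \<partial>lborel)"
        by (rule chord_integral_le) measurable
      also have "\<dots> \<le> 2 ^ DIM(real^'d) * emeasure lborel K * (of_nat CARD('d) * ennreal e)"
        using Eint by (intro mult_left_mono) auto
      finally show "(\<integral>\<^sup>+x. indicator K x * (\<integral>\<^sup>+y. indicator K y * chord E x y \<partial>lborel) \<partial>lborel)
          \<le> 2 ^ DIM(real^'d) * emeasure lborel K * (of_nat CARD('d) * ennreal e)" .
    qed auto
    also have "\<dots> = ?M * ennreal e" by (simp add: algebra_simps)
    finally show "(\<integral>\<^sup>+x. indicator (P \<delta>) x * (\<integral>\<^sup>+y. indicator (P \<delta>) y * (A x y - B x y) \<partial>lborel) \<partial>lborel) \<le> ?M * ennreal e" .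
  qed
  have "AE x in lborel. \<forall>n. indicator (P (1 / real (Suc n))) x *
      (\<integral>\<^sup>+y. indicator (P (1 / real (Suc n))) y * (A x y - B x y) \<partial>lborel) = 0"
    unfolding AE_all_countable
  proof
    fix n
    show "AE x in lborel. indicator (P (1 / real (Suc n))) x *
      (\<integral>\<^sup>+y. indicator (P (1 / real (Suc n))) y * (A x y - B x y) \<partial>lborel) = 0"
    proof -
      have "(\<integral>\<^sup>+x. indicator (P (1 / real (Suc n))) x *
          (\<integral>\<^sup>+y. indicator (P (1 / real (Suc n))) y * (A x y - B x y) \<partial>lborel) \<partial>lborel) = 0"
        by (rule zero) simp
      then show ?thesis by (subst (asm) nn_integral_0_iff_AE) (auto simp del: of_nat_Suc)
    qed
  qed
  then show ?thesis
  proof eventually_elim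
    case (elim x)
    show ?case
    proof
      assume "x \<in> K"
      have reach: "\<exists>n0. \<forall>n\<ge>n0. z \<in> P (1 / real (Suc n))" if "z \<in> K" for z
      proof -
        have "infdist z (- K) > 0"
          using that K(1) nonempty by (intro infdist_pos_not_in_closed) auto
        then have "\<forall>\<^sub>F n in sequentially. 1 / real (Suc n) < infdist z (- K)"
          using LIMSEQ_inverse_real_of_nat by (intro order_tendstoD) (auto simp: inverse_eq_divide)
        then show ?thesis by (auto simp: P_def eventually_sequentially)
      qed
      obtain n0 where n0: "\<And>n. n \<ge> n0 \<Longrightarrow> x \<in> P (1 / real (Suc n))" using reach[OF \<open>x \<in> K\<close>] by blast
      have "AE y in lborel. \<forall>n. n \<ge> n0 \<longrightarrow> indicator (P (1 / real (Suc n))) y * (A x y - B x y) = 0"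
        unfolding AE_all_countable
      proof
        fix n
        show "AE y in lborel. n \<ge> n0 \<longrightarrow> indicator (P (1 / real (Suc n))) y * (A x y - B x y) = 0"
        proof (cases "n \<ge> n0")
          case True
          then have "(\<integral>\<^sup>+y. indicator (P (1 / real (Suc n))) y * (A x y - B x y) \<partial>lborel) = 0"
            using spec[OF elim, of n] n0[OF True] by simp
          then have "AE y in lborel. indicator (P (1 / real (Suc n))) y * (A x y - B x y) = 0"
            by (subst (asm) nn_integral_0_iff_AE) (auto simp del: of_nat_Suc)
          then show ?thesis by eventually_elim simp
        qed simp
      qed
      then show "AE y in lborel. y \<in> K \<longrightarrow>
        ennreal (norm (w x - w y)) \<le> ennreal h * chord (\<lambda>z. \<Sum>i\<in>UNIV. ennreal (norm (g i z))) x y"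
      proof eventually_elim
        case (elim y)
        show ?case
        proof
          assume "y \<in> K"
          obtain n1 where n1: "\<And>n. n \<ge> n1 \<Longrightarrow> y \<in> P (1 / real (Suc n))" using reach[OF \<open>y \<in> K\<close>] by blast
          have "A x y - B x y = 0"
            using elim[rule_format, of "max n0 n1"] n1[of "max n0 n1"] by (simp del: of_nat_Suc)
          then show "ennreal (norm (w x - w y)) \<le> ennreal h * chord (\<lambda>z. \<Sum>i\<in>UNIV. ennreal (norm (g i z))) x y"
            unfolding \<Gamma>_eq by (simp add: diff_eq_0_iff_ennreal A_def B_def)
        qed
      qed
    qed
  qed
qed

lemma chord_mono: "(\<And>z. f z \<le> g z) \<Longrightarrow> chord f x y \<le> chord g x y"
  unfolding chord_def by (intro nn_integral_mono mult_left_mono) auto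

lemma chord_affine:
  assumes [measurable]: "f \<in> borel_measurable borel"
  shows "chord (\<lambda>z. a + b * f z) x y = a + b * chord f x y"
proof -
  have "chord (\<lambda>z. a + b * f z) x y
      = (\<integral>\<^sup>+t. a * indicator {0..1::real} t + b * (indicator {0..1} t * f (y + t *\<^sub>R (x - y))) \<partial>lborel)"
    unfolding chord_def by (intro nn_integral_cong) (simp add: algebra_simps)
  then show ?thesis unfolding chord_def by (simp add: nn_integral_add nn_integral_cmult)
qed

lemma chord_integral_affine:
  assumes [measurable]: "f \<in> borel_measurable borel" "K \<in> sets borel"
  shows "(\<integral>\<^sup>+y. indicator K y * chord (\<lambda>z. a + b * f z) x y \<partial>lborel)
    = a * emeasure lborel K + b * (\<integral>\<^sup>+y. indicator K y * chord f x y \<partial>lborel)"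
proof -
  have "(\<integral>\<^sup>+y. indicator K y * chord (\<lambda>z. a + b * f z) x y \<partial>lborel)
    = (\<integral>\<^sup>+y. a * indicator K y + b * (indicator K y * chord f x y) \<partial>lborel)"
    by (intro nn_integral_cong) (simp add: chord_affine algebra_simps)
  then show ?thesis by (simp add: nn_integral_add nn_integral_cmult)
qed

text \<open>As \<open>w\<close> has mean value zero, \<open>w x\<close> is the average over \<open>y\<close> of \<open>w x - w y\<close>.\<close>

lemma poincare_pointwise:
  fixes w :: "real^'d::finite \<Rightarrow> 'b::{banach, second_countable_topology}"
  assumes K: "open K" "convex K" "bounded K"
    and w: "integrable lborel w" and g: "\<And>i. integrable lborel (g i)"
    and wd: "\<And>i. tensor_weak_deriv K i w (g i)"
    and h: "\<And>x y. x \<in> K \<Longrightarrow> y \<in> K \<Longrightarrow> norm (x - y) \<le> h"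
    and out: "\<And>x. x \<notin> K \<Longrightarrow> w x = 0" and mean: "(\<integral>x. w x \<partial>lborel) = 0"
  shows "AE x in lborel. x \<in> K \<longrightarrow> ennreal (norm (w x)) * emeasure lborel K
    \<le> ennreal h * (\<integral>\<^sup>+y. indicator K y * chord (\<lambda>z. \<Sum>i\<in>UNIV. ennreal (norm (g i z))) x y \<partial>lborel)"
proof -
  have [measurable]: "w \<in> borel_measurable borel" "g i \<in> borel_measurable borel" "K \<in> sets borel" for i
    using w g K by (auto dest: borel_measurable_integrable)
  have fin: "emeasure lborel K < \<infinity>" using K(3) by (rule emeasure_bounded_finite)
  let ?\<Gamma> = "\<lambda>z. \<Sum>i\<in>UNIV. ennreal (norm (g i z))"
  have "AE x in lborel. x \<in> K \<longrightarrow> (AE y in lborel. y \<in> K \<longrightarrow>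
      ennreal (norm (w x - w y)) \<le> ennreal h * chord ?\<Gamma> x y)"
    by (rule difference_le_chord[OF K w g wd h])
  then show ?thesis
  proof eventually_elim
    case (elim x)
    show ?case
    proof
      assume "x \<in> K"
      have iK: "integrable lborel (\<lambda>y. indicator K y *\<^sub>R w x)" using fin by (simp add: less_top)
      have eq: "(\<lambda>y. indicator K y *\<^sub>R (w x - w y)) = (\<lambda>y. indicator K y *\<^sub>R w x - w y)"
        using out by (auto simp: fun_eq_iff indicator_def)
      have "measure lborel K *\<^sub>R w x = (\<integral>y. indicator K y *\<^sub>R (w x - w y) \<partial>lborel)"
        unfolding eq using iK w mean fin by (simp add: less_top)
      moreover have "integrable lborel (\<lambda>y. indicator K y *\<^sub>R (w x - w y))"
        unfolding eq by (rule Bochner_Integration.integrable_diff[OF iK w])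
      ultimately have "ennreal (norm (measure lborel K *\<^sub>R w x)) \<le> (\<integral>\<^sup>+y. norm (indicator K y *\<^sub>R (w x - w y)) \<partial>lborel)"
        by (metis integral_norm_bound_ennreal)
      also have "\<dots> \<le> (\<integral>\<^sup>+y. ennreal h * (indicator K y * chord ?\<Gamma> x y) \<partial>lborel)"
        using elim \<open>x \<in> K\<close> by (intro nn_integral_mono_AE) (auto simp: indicator_def elim: eventually_mono)
      also have "\<dots> = ennreal h * (\<integral>\<^sup>+y. indicator K y * chord ?\<Gamma> x y \<partial>lborel)"
        by (rule nn_integral_cmult) measurable
      also have "ennreal (norm (measure lborel K *\<^sub>R w x)) = ennreal (norm (w x)) * emeasure lborel K"
        using fin by (simp add: emeasure_eq_ennreal_measure less_top ennreal_mult mult.commute)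
      finally show "ennreal (norm (w x)) * emeasure lborel K
          \<le> ennreal h * (\<integral>\<^sup>+y. indicator K y * chord ?\<Gamma> x y \<partial>lborel)" .
    qed
  qed
qed

text \<open>The weighted inequality between arithmetic and geometric mean of \<open>c\<close> and \<open>a\<^sup>p c\<^sup>1\<^sup>-\<^sup>p\<close>. For fixed \<open>c\<close> the
  right-hand side is affine in the power of \<open>a\<close> and can therefore be averaged.\<close>

lemma young_power:
  assumes "p \<ge> 1" "c > 0" "a \<ge> (0::real)"
  shows "a \<le> (1 - 1 / p) * c + c powr (1 - p) / p * a powr p"
proof (cases "a = 0")
  case True
  then show ?thesis using assms by simp
next
  case False
  then have "a > 0" using assms(3) by simp
  have "(a powr p * c powr (1 - p)) powr (1 / p) * c powr (1 - 1 / p)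
      \<le> 1 / p * (a powr p * c powr (1 - p)) + (1 - 1 / p) * c"
    using assms \<open>a > 0\<close> by (intro Youngs_inequality_0) auto
  moreover have "(a powr p * c powr (1 - p)) powr (1 / p) * c powr (1 - 1 / p) = a"
  proof -
    have "(1 - p) * (1 / p) + (1 - 1 / p) = 0" using assms(1) by (simp add: field_simps)
    then have "c powr ((1 - p) * (1 / p)) * c powr (1 - 1 / p) = 1"
      using assms(2) by (metis powr_add powr_zero_eq_one less_irrefl)
    then show ?thesis using assms \<open>a > 0\<close> by (simp add: powr_mult powr_powr mult.assoc)
  qed
  ultimately show ?thesis by (simp add: mult_ac)
qed

text \<open>Together with \<open>young_power\<close> this replaces the inequality of Jensen: the assumption survives averaging because
  it is linear in \<open>b\<close>, and the optimal \<open>c\<close> is chosen afterwards.\<close>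

lemma power_le_if_young:
  assumes "p \<ge> 1" "a \<ge> (0::real)" "b \<ge> 0"
    and "\<And>c. c > 0 \<Longrightarrow> a \<le> (1 - 1 / p) * c + c powr (1 - p) / p * b"
  shows "a powr p \<le> b"
proof (cases "b = 0")
  case True
  have "a = 0"
  proof (rule ccontr)
    assume "a \<noteq> 0"
    then have "a > 0" using assms(2) by simp
    then have "a \<le> (1 - 1 / p) * (a / 2)" using assms(4)[of "a / 2"] True by simp
    also have "\<dots> \<le> 1 * (a / 2)" using assms(1) \<open>a > 0\<close> by (intro mult_right_mono) auto
    finally show False using \<open>a > 0\<close> by simp
  qed
  then show ?thesis using True assms(1) by simp
next
  case False
  then have "b > 0" using assms(3) by simp
  \<comment> \<open>The minimiser of the right-hand side, where it equals \<open>c\<close>.\<close>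
  define c where "c = b powr (1 / p)"
  have c: "c > 0" "c powr p = b" using \<open>b > 0\<close> assms(1) by (auto simp: c_def powr_powr)
  have "c powr (1 - p) * b = c"
    unfolding c(2)[symmetric] powr_add[symmetric] using c(1) by simp
  then have "c powr (1 - p) / p * b = c / p" by (metis times_divide_eq_left)
  with assms(4)[OF c(1)] have "a \<le> (1 - 1 / p) * c + c / p" by (simp only:)
  also have "\<dots> = c" using assms(1) by (simp add: field_simps)
  finally have "a powr p \<le> c powr p" using assms by (intro powr_mono2) auto
  then show ?thesis by (simp add: c)
qed

lemma emeasure_bounded_open:
  fixes K :: "'a::euclidean_space set"
  assumes "open K" "bounded K" "K \<noteq> {}"
  obtains k where "k > 0" "emeasure lborel K = ennreal k"
proof -
  have "emeasure lborel K < \<infinity>" using assms(2) by (rule emeasure_bounded_finite)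
  then have k: "emeasure lborel K = ennreal (measure lborel K)"
    by (simp add: emeasure_eq_ennreal_measure less_top)
  have "\<not> negligible K" using assms by (simp add: open_not_negligible)
  then have "emeasure lborel K \<noteq> 0" using null_sets_completionI[of K lborel] assms(1)
    by (auto simp: negligible_iff_null_sets null_sets_def)
  then have "measure lborel K > 0" using k by (cases "measure lborel K \<le> 0") (auto simp: ennreal_neg)
  then show thesis using k by (rule that)
qed

text \<open>For every \<open>c\<close> the chord average of the gradient is bounded by an affine function of the chord average
  of its power. Optimising in \<open>c\<close> at each point and integrating with \<open>chord_integral_le\<close> gives the claim.\<close>

lemma poincare_powr:
  fixes w :: "real^'d::finite \<Rightarrow> 'b::{banach, second_countable_topology}"
  assumes K: "open K" "convex K" "bounded K" "K \<noteq> {}"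
    and w: "integrable lborel w" and g: "\<And>i. integrable lborel (g i)"
    and wd: "\<And>i. tensor_weak_deriv K i w (g i)"
    and h: "\<And>x y. x \<in> K \<Longrightarrow> y \<in> K \<Longrightarrow> norm (x - y) \<le> h" "h > 0"
    and out: "\<And>x. x \<notin> K \<Longrightarrow> w x = 0" and mean: "(\<integral>x. w x \<partial>lborel) = 0" and p: "p \<ge> 1"
  shows "(\<integral>\<^sup>+x. ennreal (norm (w x) powr p) \<partial>lborel)
    \<le> ennreal (h powr p * 2 ^ CARD('d)) * (\<integral>\<^sup>+z. ennreal ((\<Sum>i\<in>UNIV. norm (g i z)) powr p) \<partial>lborel)"
proof -
  have [measurable]: "w \<in> borel_measurable borel" "g i \<in> borel_measurable borel" "K \<in> sets borel" for i
    using w g K by (auto dest: borel_measurable_integrable)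
  define G where "G z = (\<Sum>i\<in>UNIV. norm (g i z))" for z
  define f where "f z = ennreal (G z powr p)" for z
  have G0: "G z \<ge> 0" for z by (simp add: G_def sum_nonneg)
  have [measurable]: "G \<in> borel_measurable borel" unfolding G_def by measurable
  have [measurable]: "f \<in> borel_measurable borel" unfolding f_def by measurable
  define J where "J x = (\<integral>\<^sup>+y. indicator K y * chord f x y \<partial>lborel)" for x
  have [measurable]: "J \<in> borel_measurable borel" unfolding J_def by measurable
  obtain k where "k > 0" and k: "emeasure lborel K = ennreal k"
    by (rule emeasure_bounded_open[OF K(1,3,4)])
  have "AE x in lborel. x \<in> K \<longrightarrow> ennreal (norm (w x)) * emeasure lborel K
      \<le> ennreal h * (\<integral>\<^sup>+y. indicator K y * chord (\<lambda>z. \<Sum>i\<in>UNIV. ennreal (norm (g i z))) x y \<partial>lborel)"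
    by (rule poincare_pointwise[OF K(1-3) w g wd h(1) out mean])
  then have ptw: "AE x in lborel. x \<in> K \<longrightarrow> ennreal (norm (w x) powr p) * ennreal k \<le> ennreal (h powr p) * J x"
  proof eventually_elim
    case (elim x)
    show ?case
    proof
      assume "x \<in> K"
      show "ennreal (norm (w x) powr p) * ennreal k \<le> ennreal (h powr p) * J x"
      proof (cases "J x")
        case top
        then show ?thesis using h(2) by (simp add: ennreal_mult_top)
      next
        case (real j)
        have "(norm (w x) / h) powr p \<le> j / k"
        proof (rule power_le_if_young[OF p])
          fix c :: real assume "c > 0"
          have c0: "(1 - 1 / p) * c \<ge> 0" "c powr (1 - p) / p \<ge> 0" using p \<open>c > 0\<close> by auto
          have "(\<Sum>i\<in>UNIV. ennreal (norm (g i z))) \<le> ennreal ((1 - 1 / p) * c) + ennreal (c powr (1 - p) / p) * f z" for z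
          proof -
            have "(\<Sum>i\<in>UNIV. ennreal (norm (g i z))) = ennreal (G z)" by (simp add: G_def)
            also have "\<dots> \<le> ennreal ((1 - 1 / p) * c + c powr (1 - p) / p * G z powr p)"
              by (intro ennreal_leI young_power p \<open>c > 0\<close> G0)
            also have "\<dots> = ennreal ((1 - 1 / p) * c) + ennreal (c powr (1 - p) / p) * f z"
              unfolding f_def
              by (subst ennreal_plus[OF c0(1) mult_nonneg_nonneg[OF c0(2) powr_ge_zero]]) (simp only: ennreal_mult'[OF c0(2)])
            finally show ?thesis .
          qed
          then have "(\<integral>\<^sup>+y. indicator K y * chord (\<lambda>z. \<Sum>i\<in>UNIV. ennreal (norm (g i z))) x y \<partial>lborel)
            \<le> (\<integral>\<^sup>+y. indicator K y * chord (\<lambda>z. ennreal ((1 - 1 / p) * c) + ennreal (c powr (1 - p) / p) * f z) x y \<partial>lborel)"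
            by (intro nn_integral_mono mult_left_mono chord_mono) auto
          also have "\<dots> = ennreal ((1 - 1 / p) * c) * ennreal k + ennreal (c powr (1 - p) / p) * J x"
            by (simp add: chord_integral_affine J_def k)
          also have "\<dots> = ennreal ((1 - 1 / p) * c * k + c powr (1 - p) / p * j)"
            unfolding real ennreal_mult'[OF c0(1), symmetric] ennreal_mult'[OF c0(2), symmetric]
            using c0 \<open>k > 0\<close> real by (intro ennreal_plus[symmetric] mult_nonneg_nonneg[OF c0(1)] mult_nonneg_nonneg[OF c0(2)]) auto
          finally have "ennreal (norm (w x)) * ennreal k \<le> ennreal h * ennreal ((1 - 1 / p) * c * k + c powr (1 - p) / p * j)"
            using elim \<open>x \<in> K\<close> unfolding k by (meson mult_left_mono order.trans zero_le)
          then have "ennreal (norm (w x) * k) \<le> ennreal (h * ((1 - 1 / p) * c * k + c powr (1 - p) / p * j))"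
            using h(2) \<open>k > 0\<close> by (simp add: ennreal_mult')
          then have "norm (w x) * k \<le> h * ((1 - 1 / p) * c * k + c powr (1 - p) / p * j)"
            using h(2) \<open>k > 0\<close> real
            by (subst (asm) ennreal_le_iff)
               (auto intro!: mult_nonneg_nonneg[OF less_imp_le] add_nonneg_nonneg
                 mult_nonneg_nonneg[OF c0(1)] mult_nonneg_nonneg[OF c0(2)] simp del: times_divide_eq_left)
          then have "norm (w x) * k / (h * k) \<le> h * ((1 - 1 / p) * c * k + c powr (1 - p) / p * j) / (h * k)"
            using h(2) \<open>k > 0\<close> by (intro divide_right_mono) auto
          also have "\<dots> = (1 - 1 / p) * c + c powr (1 - p) / p * (j / k)"
            using h(2) \<open>k > 0\<close> by (simp add: add_divide_distrib distrib_left)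
          finally show "norm (w x) / h \<le> (1 - 1 / p) * c + c powr (1 - p) / p * (j / k)"
            using \<open>k > 0\<close> by simp
        qed (use h(2) \<open>k > 0\<close> real in auto)
        then have "norm (w x) powr p * k \<le> h powr p * j"
          using h(2) \<open>k > 0\<close> by (simp add: powr_divide field_simps)
        then show ?thesis unfolding real by (simp flip: ennreal_mult' add: ennreal_leI)
      qed
    qed
  qed
  have "ennreal k * (\<integral>\<^sup>+x. ennreal (norm (w x) powr p) \<partial>lborel) = (\<integral>\<^sup>+x. ennreal (norm (w x) powr p) * ennreal k \<partial>lborel)"
    by (simp add: nn_integral_cmult mult.commute)
  also have "\<dots> \<le> (\<integral>\<^sup>+x. ennreal (h powr p) * (indicator K x * J x) \<partial>lborel)"
  proof (rule nn_integral_mono_AE, use ptw in eventually_elim)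
    fix x assume "x \<in> K \<longrightarrow> ennreal (norm (w x) powr p) * ennreal k \<le> ennreal (h powr p) * J x"
    then show "ennreal (norm (w x) powr p) * ennreal k \<le> ennreal (h powr p) * (indicator K x * J x)"
      using out[of x] p by (cases "x \<in> K") auto
  qed
  also have "\<dots> = ennreal (h powr p) * (\<integral>\<^sup>+x. indicator K x * J x \<partial>lborel)"
    by (rule nn_integral_cmult) measurable
  also have "\<dots> \<le> ennreal (h powr p) * (2 ^ CARD('d) * ennreal k * (\<integral>\<^sup>+z. f z \<partial>lborel))"
    unfolding J_def k[symmetric] using chord_integral_le[of f K] by (intro mult_left_mono) auto
  also have "\<dots> = ennreal k * (ennreal (h powr p * 2 ^ CARD('d)) * (\<integral>\<^sup>+z. f z \<partial>lborel))"
    by (simp add: ennreal_mult' mult_ac flip: ennreal_power)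
  finally have *: "ennreal k * (\<integral>\<^sup>+x. ennreal (norm (w x) powr p) \<partial>lborel)
     \<le> ennreal k * (ennreal (h powr p * 2 ^ CARD('d)) * (\<integral>\<^sup>+z. f z \<partial>lborel))" .
  have "ennreal (1 / k) * ennreal k = 1" using \<open>k > 0\<close> by (simp flip: ennreal_mult')
  with mult_left_mono[OF *, of "ennreal (1 / k)"] show ?thesis
    by (simp add: mult.assoc[symmetric] f_def G_def)
qed

text \<open>The excess of the gradient over \<open>c\<close> is a null function, so its chord averages vanish almost everywhere.\<close>

lemma poincare_essbound:
  fixes w :: "real^'d::finite \<Rightarrow> 'b::{banach, second_countable_topology}"
  assumes K: "open K" "convex K" "bounded K" "K \<noteq> {}"
    and w: "integrable lborel w" and g: "\<And>i. integrable lborel (g i)"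
    and wd: "\<And>i. tensor_weak_deriv K i w (g i)"
    and h: "\<And>x y. x \<in> K \<Longrightarrow> y \<in> K \<Longrightarrow> norm (x - y) \<le> h" "h > 0"
    and out: "\<And>x. x \<notin> K \<Longrightarrow> w x = 0" and mean: "(\<integral>x. w x \<partial>lborel) = 0"
    and c: "AE z in lborel. (\<Sum>i\<in>UNIV. norm (g i z)) \<le> c" "c \<ge> 0"
  shows "AE x in lborel. norm (w x) \<le> h * c"
proof -
  have [measurable]: "w \<in> borel_measurable borel" "g i \<in> borel_measurable borel" "K \<in> sets borel" for i
    using w g K by (auto dest: borel_measurable_integrable)
  let ?\<Gamma> = "\<lambda>z. \<Sum>i\<in>UNIV. ennreal (norm (g i z))"
  \<comment> \<open>Truncated subtraction: the excess over \<open>c\<close>.\<close>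
  define f where "f z = ?\<Gamma> z - ennreal c" for z
  have [measurable]: "f \<in> borel_measurable borel" unfolding f_def by measurable
  define J where "J x = (\<integral>\<^sup>+y. indicator K y * chord f x y \<partial>lborel)" for x
  have [measurable]: "J \<in> borel_measurable borel" unfolding J_def by measurable
  have "AE z in lborel. f z = 0"
    using c(1) by eventually_elim (simp add: f_def diff_eq_0_iff_ennreal ennreal_leI)
  then have "(\<integral>\<^sup>+z. f z \<partial>lborel) = 0" by (subst nn_integral_0_iff_AE) auto
  then have "(\<integral>\<^sup>+x. indicator K x * J x \<partial>lborel) = 0"
    using chord_integral_le[of f K] by (simp add: J_def)
  then have J0: "AE x in lborel. indicator K x * J x = 0" by (subst (asm) nn_integral_0_iff_AE) auto
  obtain k where "k > 0" and k: "emeasure lborel K = ennreal k"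
    by (rule emeasure_bounded_open[OF K(1,3,4)])
  have "AE x in lborel. x \<in> K \<longrightarrow> ennreal (norm (w x)) * emeasure lborel K
      \<le> ennreal h * (\<integral>\<^sup>+y. indicator K y * chord ?\<Gamma> x y \<partial>lborel)"
    by (rule poincare_pointwise[OF K(1-3) w g wd h(1) out mean])
  from this J0 show ?thesis
  proof eventually_elim
    case (elim x)
    show ?case
    proof (cases "x \<in> K")
      case True
      have "?\<Gamma> z \<le> ennreal c + 1 * f z" for z
        by (metis f_def ennreal_minus_le_iff mult_1 order_refl)
      then have "(\<integral>\<^sup>+y. indicator K y * chord ?\<Gamma> x y \<partial>lborel)
          \<le> (\<integral>\<^sup>+y. indicator K y * chord (\<lambda>z. ennreal c + 1 * f z) x y \<partial>lborel)"
        by (intro nn_integral_mono mult_left_mono chord_mono) auto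
      also have "\<dots> = ennreal c * ennreal k + 1 * J x"
        unfolding k[symmetric] J_def by (rule chord_integral_affine) auto
      also have "J x = 0" using elim(2) True by simp
      finally have "ennreal (norm (w x)) * ennreal k \<le> ennreal h * (ennreal c * ennreal k)"
        using elim(1) True unfolding k by (simp add: order.trans mult_left_mono)
      then have "ennreal (norm (w x) * k) \<le> ennreal (h * (c * k))"
        using h(2) c(2) \<open>k > 0\<close> by (simp add: ennreal_mult')
      then have "norm (w x) * k \<le> (h * c) * k"
        using h(2) \<open>k > 0\<close> c(2) by (subst (asm) ennreal_le_iff) auto
      then show ?thesis using \<open>k > 0\<close> by simp
    next
      case False
      then show ?thesis using out h(2) c(2) by simp
    qed
  qed
qed

section \<open>Lebesgue norms\<close>

lemma sum_powr_le_powr_sum: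
  assumes "finite A" "\<And>i. i \<in> A \<Longrightarrow> 0 \<le> x i" "q \<ge> 1"
  shows "(\<Sum>i\<in>A. x i powr q) \<le> (\<Sum>i\<in>A. x i) powr (q :: real)"
proof -
  define S where "S = (\<Sum>i\<in>A. x i)"
  have S0: "S \<ge> 0" unfolding S_def using assms by (intro sum_nonneg) auto
  have mult: "y powr q = y * y powr (q - 1)" if "y \<ge> 0" for y
    using powr_mult_base[OF that, of "q - 1"] by simp
  have "(\<Sum>i\<in>A. x i powr q) \<le> (\<Sum>i\<in>A. x i * S powr (q - 1))"
  proof (rule sum_mono)
    fix i assume i: "i \<in> A"
    then have "x i \<le> S" unfolding S_def using assms by (intro member_le_sum) auto
    then show "x i powr q \<le> x i * S powr (q - 1)"
      using assms i by (simp add: mult mult_left_mono powr_mono2)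
  qed
  also have "\<dots> = S powr q" using S0 by (simp add: mult S_def sum_distrib_right)
  finally show ?thesis unfolding S_def .
qed

text \<open>A sum is at most the number of its terms times the largest one.\<close>

lemma powr_sum_le_sum_powr:
  assumes "finite A" "\<And>i. i \<in> A \<Longrightarrow> 0 \<le> x i" "q \<ge> 1"
  shows "(\<Sum>i\<in>A. x i) powr q \<le> real (card A) powr q * (\<Sum>i\<in>A. x i powr (q :: real))"
proof (cases "A = {}")
  case False
  obtain m where m: "m \<in> A" "\<And>i. i \<in> A \<Longrightarrow> x i \<le> x m"
  proof -
    have "Max (x ` A) \<in> x ` A" using assms(1) False by (intro Max_in) auto
    then obtain m where "m \<in> A" "Max (x ` A) = x m" by auto
    moreover have "x i \<le> Max (x ` A)" if "i \<in> A" for i using assms(1) that by (intro Max_ge) auto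
    ultimately show thesis using that by simp
  qed
  have "(\<Sum>i\<in>A. x i) powr q \<le> (real (card A) * x m) powr q"
    using assms m by (intro powr_mono2 sum_bounded_above sum_nonneg) auto
  also have "\<dots> = real (card A) powr q * x m powr q" using assms m by (simp add: powr_mult)
  also have "\<dots> \<le> real (card A) powr q * (\<Sum>i\<in>A. x i powr q)"
    using assms m by (intro mult_left_mono member_le_sum[of m A "\<lambda>i. x i powr q"]) auto
  finally show ?thesis .
qed (use assms in simp)

lemma AE_lp_norm_bound:
  assumes "f \<in> lp_space \<infinity> U"
  shows "AE x in lebesgue_on U. norm (f x) \<le> lp_norm \<infinity> U f"
  using esssup_AE[of "\<lambda>x. ereal (norm (f x))" "lebesgue_on U"]
proof eventually_elim
  case (elim x)
  then show ?case
    using assms by (cases "esssup (lebesgue_on U) (\<lambda>x. ereal (norm (f x)))") (auto simp: lp_space_def lp_norm_def)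
qed

lemma lp_norm_infinity_le:
  assumes "f \<in> borel_measurable (lebesgue_on U)" "AE x in lebesgue_on U. norm (f x) \<le> c" "c \<ge> 0"
  shows "f \<in> lp_space \<infinity> U" "lp_norm \<infinity> U f \<le> c"
proof -
  have *: "esssup (lebesgue_on U) (\<lambda>x. ereal (norm (f x))) \<le> ereal c"
    using assms by (intro esssup_I) auto
  then show "f \<in> lp_space \<infinity> U"
    using assms(1) by (auto simp: lp_space_def dest: order_le_less_trans[of _ "ereal c" \<infinity>])
  show "lp_norm \<infinity> U f \<le> c"
    using * assms(3) by (cases "esssup (lebesgue_on U) (\<lambda>x. ereal (norm (f x)))") (auto simp: lp_norm_def)
qed

text \<open>The essential supremum could be negative only on a null set, where it is \<open>- \<infinity>\<close> and its real value is \<open>0\<close>.\<close>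

lemma lp_norm_nonneg: "lp_norm p U f \<ge> 0"
proof (cases "p = \<infinity> \<and> (\<lambda>x. ereal (norm (f x))) \<in> borel_measurable (lebesgue_on U)")
  case False
  then show ?thesis
    by (cases "p = \<infinity>") (auto simp: lp_norm_def esssup_non_measurable top_ereal_def)
next
  case True
  let ?e = "esssup (lebesgue_on U) (\<lambda>x. ereal (norm (f x)))"
  have "real_of_ereal ?e \<ge> 0"
  proof (rule ccontr)
    assume neg: "\<not> ?thesis"
    then have "?e < 0" by (cases ?e) auto
    have "AE x in lebesgue_on U. False"
      using esssup_AE[of "\<lambda>x. ereal (norm (f x))" "lebesgue_on U"]
    proof eventually_elim
      case (elim x)
      then have "ereal (norm (f x)) < 0" using \<open>?e < 0\<close> by order
      then show False by simp
    qed
    then have "emeasure (lebesgue_on U) (space (lebesgue_on U)) = 0"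
      by (subst (asm) AE_iff_measurable[OF _ refl]) auto
    then have "?e = - \<infinity>" using True by (intro esssup_zero_space) auto
    then show False using neg by simp
  qed
  then show ?thesis using True by (simp add: lp_norm_def)
qed

lemma lp_norm_powr:
  assumes "p \<noteq> \<infinity>" "1 \<le> p"
  shows "lp_norm p U f powr real_of_ereal p = (LINT x|lebesgue_on U. norm (f x) powr real_of_ereal p)"
proof -
  obtain q where q: "p = ereal q" "q \<ge> 1" using assms by (cases p) auto
  have "(LINT x|lebesgue_on U. norm (f x) powr q) \<ge> 0" by (intro integral_nonneg_AE) auto
  then show ?thesis using q by (simp add: lp_norm_def powr_powr)
qed

lemma lp_norm_cong_AE:
  assumes "f \<in> borel_measurable (lebesgue_on U)" "g \<in> borel_measurable (lebesgue_on U)"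
    "AE x in lebesgue_on U. f x = g x"
  shows "lp_norm p U f = lp_norm p U g"
proof -
  have "(LINT x|lebesgue_on U. norm (f x) powr q) = (LINT x|lebesgue_on U. norm (g x) powr q)" for q
    using assms by (intro integral_cong_AE) (auto elim: eventually_mono)
  moreover have "esssup (lebesgue_on U) (\<lambda>x. ereal (norm (f x))) = esssup (lebesgue_on U) (\<lambda>x. ereal (norm (g x)))"
    using assms by (intro esssup_AE_cong) (auto elim: eventually_mono)
  ultimately show ?thesis by (simp add: lp_norm_def)
qed

lemma lp_space_cong_AE:
  assumes "f \<in> lp_space p U" "g \<in> borel_measurable (lebesgue_on U)"
    "AE x in lebesgue_on U. f x = g x"
  shows "g \<in> lp_space p U"
proof -
  have f: "f \<in> borel_measurable (lebesgue_on U)" using assms(1) by (simp add: lp_space_def)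
  have int: "integrable (lebesgue_on U) (\<lambda>x. norm (f x) powr q) \<longleftrightarrow> integrable (lebesgue_on U) (\<lambda>x. norm (g x) powr q)" for q
    using assms f by (intro integrable_cong_AE) (auto elim: eventually_mono)
  have ess: "esssup (lebesgue_on U) (\<lambda>x. ereal (norm (f x))) = esssup (lebesgue_on U) (\<lambda>x. ereal (norm (g x)))"
    using assms f by (intro esssup_AE_cong) (auto elim: eventually_mono)
  show ?thesis
    using assms(1,2) int[of "real_of_ereal p"] unfolding lp_space_def mem_Collect_eq ess by (cases "p = \<infinity>") simp_all
qed

text \<open>Lebesgue measure is complete. This is needed because a weak derivative that is picked arbitrarily is only
  known to agree almost everywhere with a function in \<open>L\<^sup>p\<close>.\<close>

lemma lebesgue_on_measurable_AE:
  fixes f g :: "'a::euclidean_space \<Rightarrow> 'b::euclidean_space"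
  assumes "open U" "f \<in> borel_measurable (lebesgue_on U)" "AE x in lebesgue_on U. f x = g x"
  shows "g \<in> borel_measurable (lebesgue_on U)"
proof -
  have U: "U \<in> sets lebesgue" using assms(1) by simp
  have ae: "AE x in lebesgue. x \<in> U \<longrightarrow> f x = g x" using assms(3) U by (simp add: AE_restrict_space_iff)
  show ?thesis
  proof (rule measurableI)
    fix S :: "'b set" assume S: "S \<in> sets borel"
    have "f -` S \<inter> space (lebesgue_on U) \<in> sets (lebesgue_on U)" by (rule measurable_sets[OF assms(2) S])
    then have "f -` S \<inter> U \<in> sets lebesgue" using U by (simp add: sets_restrict_space_iff)
    then have "g -` S \<inter> U \<in> sets lebesgue"
      by (rule completion.in_sets_AE[rotated]) (use ae in \<open>auto elim!: eventually_mono\<close>)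
    then show "g -` S \<inter> space (lebesgue_on U) \<in> sets (lebesgue_on U)" using U by (simp add: sets_restrict_space_iff)
  qed simp
qed

lemma lebesgue_on_finite:
  assumes "open U" "bounded U"
  shows "emeasure (lebesgue_on U) (space (lebesgue_on U)) < \<infinity>"
proof -
  have "emeasure (lebesgue_on U) U = emeasure lborel U"
    using assms(1) by (simp add: emeasure_restrict_space)
  then show ?thesis using emeasure_bounded_finite[OF assms(2)] by simp
qed

text \<open>On a set of finite measure every exponent controls the first power, since \<open>y \<le> 1 + y\<^sup>p\<close>.\<close>

lemma lp_space_integrable:
  fixes f :: "real^'d::finite \<Rightarrow> real^'m::finite"
  assumes "open U" "bounded U" "1 \<le> p" "f \<in> lp_space p U"
  shows "integrable (lebesgue_on U) f"
proof -
  have f: "f \<in> borel_measurable (lebesgue_on U)" using assms(4) by (simp add: lp_space_def)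
  have const: "integrable (lebesgue_on U) (\<lambda>_. c :: real)" for c
    using lebesgue_on_finite[OF assms(1,2)] by (intro finite_measure.integrable_const finite_measureI) auto
  show ?thesis
  proof (cases "p = \<infinity>")
    case True
    show ?thesis
    proof (rule Bochner_Integration.integrable_bound[OF const f])
      show "AE x in lebesgue_on U. norm (f x) \<le> norm (lp_norm \<infinity> U f)"
        using AE_lp_norm_bound[of f U] assms(4) True by (auto simp: lp_norm_nonneg)
    qed
  next
    case False
    then obtain q where q: "p = ereal q" "q \<ge> 1" using assms(3) by (cases p) auto
    have "integrable (lebesgue_on U) (\<lambda>x. 1 + norm (f x) powr q)"
      using assms(4) q const by (intro Bochner_Integration.integrable_add) (auto simp: lp_space_def)
    then show ?thesis
    proof (rule Bochner_Integration.integrable_bound[OF _ f])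
      have "y \<le> 1 + y powr q" if "y \<ge> 0" for y :: real
      proof (cases "y \<le> 1")
        case True
        then show ?thesis using powr_ge_zero[of y q] by linarith
      next
        case False
        then show ?thesis using q powr_mono[of 1 q y] by simp
      qed
      then show "AE x in lebesgue_on U. norm (f x) \<le> norm (1 + norm (f x) powr q)" by auto
    qed
  qed
qed

lemma lp_space_diff:
  fixes f g :: "real^'d::finite \<Rightarrow> real^'m::finite"
  assumes "1 \<le> p" "f \<in> lp_space p U" "g \<in> lp_space p U"
  shows "(\<lambda>x. f x - g x) \<in> lp_space p U"
proof -
  have m: "f \<in> borel_measurable (lebesgue_on U)" "g \<in> borel_measurable (lebesgue_on U)"
    using assms by (auto simp: lp_space_def)
  then have md: "(\<lambda>x. f x - g x) \<in> borel_measurable (lebesgue_on U)" by measurable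
  show ?thesis
  proof (cases "p = \<infinity>")
    case True
    have "AE x in lebesgue_on U. norm (f x - g x) \<le> lp_norm \<infinity> U f + lp_norm \<infinity> U g"
      using AE_lp_norm_bound[of f U] AE_lp_norm_bound[of g U] assms True
      by (auto elim!: eventually_elim2 intro: order.trans[OF norm_triangle_ineq4] add_mono)
    then show ?thesis using True md by (auto intro!: lp_norm_infinity_le add_nonneg_nonneg lp_norm_nonneg)
  next
    case False
    then obtain q where q: "p = ereal q" "q \<ge> 1" using assms(1) by (cases p) auto
    have "integrable (lebesgue_on U) (\<lambda>x. 2 powr q * (norm (f x) powr q + norm (g x) powr q))"
      using assms(2,3) q by (auto simp: lp_space_def)
    then have "integrable (lebesgue_on U) (\<lambda>x. norm (f x - g x) powr q)"
    proof (rule Bochner_Integration.integrable_bound)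
      show "(\<lambda>x. norm (f x - g x) powr q) \<in> borel_measurable (lebesgue_on U)" using md by measurable
      have "norm (f x - g x) powr q \<le> 2 powr q * (norm (f x) powr q + norm (g x) powr q)" for x
      proof -
        have "norm (f x - g x) powr q \<le> (norm (f x) + norm (g x)) powr q"
          using q by (intro powr_mono2 norm_triangle_ineq4) auto
        also have "\<dots> \<le> 2 powr q * (norm (f x) powr q + norm (g x) powr q)"
          using powr_sum_le_sum_powr[of "{True, False}" "\<lambda>b. if b then norm (f x) else norm (g x)" q] q by simp
        finally show ?thesis .
      qed
      then show "AE x in lebesgue_on U. norm (norm (f x - g x) powr q)
          \<le> norm (2 powr q * (norm (f x) powr q + norm (g x) powr q))" by auto
    qed
    then show ?thesis using md q by (simp add: lp_space_def)
  qed
qed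

lemma lp_space_bounded:
  fixes f :: "real^'d::finite \<Rightarrow> real^'m::finite"
  assumes "open U" "bounded U" "f \<in> borel_measurable (lebesgue_on U)" "\<And>x. x \<in> U \<Longrightarrow> norm (f x) \<le> B" "1 \<le> p"
  shows "f \<in> lp_space p U"
proof -
  have ae: "AE x in lebesgue_on U. norm (f x) \<le> max B 0"
    by (rule AE_I2) (use assms(4) in \<open>auto simp: le_max_iff_disj\<close>)
  show ?thesis
  proof (cases "p = \<infinity>")
    case True
    then show ?thesis using lp_norm_infinity_le(1)[OF assms(3) ae] by simp
  next
    case False
    then obtain q where q: "p = ereal q" "q \<ge> 1" using assms(5) by (cases p) auto
    have "integrable (lebesgue_on U) (\<lambda>_. max B 0 powr q)"
      using lebesgue_on_finite[OF assms(1,2)] by (intro finite_measure.integrable_const finite_measureI) auto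
    then have "integrable (lebesgue_on U) (\<lambda>x. norm (f x) powr q)"
    proof (rule Bochner_Integration.integrable_bound)
      show "(\<lambda>x. norm (f x) powr q) \<in> borel_measurable (lebesgue_on U)" using assms(3) by measurable
      show "AE x in lebesgue_on U. norm (norm (f x) powr q) \<le> norm (max B 0 powr q)"
        using ae by eventually_elim (use q in \<open>auto intro: powr_mono2\<close>)
    qed
    then show ?thesis using assms(3) q by (simp add: lp_space_def)
  qed
qed

lemma lp_space_continuous:
  fixes f :: "real^'d::finite \<Rightarrow> real^'m::finite"
  assumes "open U" "bounded U" "continuous_on UNIV f" "1 \<le> p"
  shows "f \<in> lp_space p U"
proof -
  have "compact (closure U)" using assms(2) by (simp add: compact_closure)
  then have "bounded (f ` closure U)"
    using assms(3) by (meson compact_continuous_image compact_imp_bounded continuous_on_subset subset_UNIV)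
  then obtain B where "\<And>x. x \<in> closure U \<Longrightarrow> norm (f x) \<le> B" by (auto simp: bounded_iff)
  moreover have "f \<in> borel_measurable (lebesgue_on U)"
    using borel_measurable_continuous_onI[OF assms(3)]
    by (simp add: measurable_completion measurable_restrict_space1)
  ultimately show ?thesis
    using assms closure_subset[of U] by (intro lp_space_bounded[where B = B]) auto
qed

lemma lp_space_subset:
  fixes f :: "real^'d::finite \<Rightarrow> real^'m::finite"
  assumes "open U" "open V" "V \<subseteq> U" "f \<in> lp_space p U"
  shows "f \<in> lp_space p V"
proof -
  have [simp]: "U \<in> sets lebesgue" "V \<in> sets lebesgue" using assms by auto
  have f: "f \<in> borel_measurable (lebesgue_on V)"
    using assms(3,4) by (auto simp: lp_space_def intro: measurable_restrict_mono)
  show ?thesis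
  proof (cases "p = \<infinity>")
    case True
    have "AE x in lebesgue_on V. norm (f x) \<le> lp_norm \<infinity> U f"
      using AE_lp_norm_bound[of f U] assms True
      by (auto simp: AE_restrict_space_iff elim!: eventually_mono)
    then show ?thesis using True f by (auto intro!: lp_norm_infinity_le lp_norm_nonneg)
  next
    case False
    have "integrable (lebesgue_on V) (\<lambda>x. norm (f x) powr q)"
      if "integrable (lebesgue_on U) (\<lambda>x. norm (f x) powr q)" for q
    proof -
      have "integrable lebesgue (\<lambda>x. indicator U x *\<^sub>R (norm (f x) powr q))"
        using that by (simp add: integrable_restrict_space)
      then have "integrable lebesgue (\<lambda>x. indicator V x *\<^sub>R (indicator U x *\<^sub>R (norm (f x) powr q)))"
        by (rule integrable_mult_indicator[rotated]) simp
      also have "(\<lambda>x. indicator V x *\<^sub>R (indicator U x *\<^sub>R (norm (f x) powr q))) = (\<lambda>x. indicator V x *\<^sub>R (norm (f x) powr q))"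
        using assms(3) by (auto simp: fun_eq_iff indicator_def)
      finally show ?thesis by (simp add: integrable_restrict_space)
    qed
    then show ?thesis using False f assms(4) by (auto simp: lp_space_def)
  qed
qed

lemma ex_borel_representative_on:
  fixes f :: "'a::euclidean_space \<Rightarrow> 'b::euclidean_space"
  assumes "open U" "f \<in> borel_measurable (lebesgue_on U)"
  obtains g where "g \<in> borel_measurable borel" "AE x in lebesgue_on U. f x = g x" "\<And>x. x \<notin> U \<Longrightarrow> g x = 0"
proof -
  have "(\<lambda>x. indicator U x *\<^sub>R f x) \<in> borel_measurable lebesgue"
    using assms by (simp add: borel_measurable_restrict_space_iff)
  then obtain g where g: "g \<in> borel_measurable borel" "AE x in lborel. indicator U x *\<^sub>R f x = g x"
    by (rule ex_borel_representative)
  show thesis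
  proof (rule that[of "\<lambda>x. indicator U x *\<^sub>R g x"])
    show "(\<lambda>x. indicator U x *\<^sub>R g x) \<in> borel_measurable borel" using g(1) assms(1) by simp
    have "AE x in lebesgue. indicator U x *\<^sub>R f x = g x" by (rule AE_completion[OF g(2)])
    then show "AE x in lebesgue_on U. f x = indicator U x *\<^sub>R g x"
      using assms(1) by (auto simp: AE_restrict_space_iff indicator_def elim!: eventually_mono split: if_splits)
  qed simp
qed

lemma integrable_lebesgue_on_support:
  fixes g :: "'a::euclidean_space \<Rightarrow> 'b::{banach, second_countable_topology}"
  assumes "g \<in> borel_measurable borel" "open U" "\<And>x. x \<notin> U \<Longrightarrow> g x = 0"
  shows "integrable (lebesgue_on U) g \<longleftrightarrow> integrable lborel g"
proof -
  have "integrable (lebesgue_on U) g \<longleftrightarrow> integrable lebesgue (\<lambda>x. indicator U x *\<^sub>R g x)"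
    using assms(2) by (intro integrable_restrict_space) auto
  also have "(\<lambda>x. indicator U x *\<^sub>R g x) = g" using assms(3) by (auto simp: fun_eq_iff indicator_def)
  finally show ?thesis using assms(1) by (simp add: integrable_completion)
qed

lemma AE_lebesgue_on_iff_lborel:
  assumes "open U" "{x. \<not> (x \<in> U \<longrightarrow> P x)} \<in> sets borel"
  shows "(AE x in lebesgue_on U. P x) \<longleftrightarrow> (AE x in lborel. x \<in> U \<longrightarrow> P x)"
proof -
  have "(AE x in lebesgue_on U. P x) \<longleftrightarrow> (AE x in lebesgue. x \<in> U \<longrightarrow> P x)"
    using assms(1) by (simp add: AE_restrict_space_iff)
  also have "\<dots> \<longleftrightarrow> {x. \<not> (x \<in> U \<longrightarrow> P x)} \<in> null_sets (completion lborel)"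
    by (simp only: AE_lebesgue_iff_negligible negligible_iff_null_sets)
  also have "\<dots> \<longleftrightarrow> {x. \<not> (x \<in> U \<longrightarrow> P x)} \<in> null_sets lborel"
    using assms(2) by (simp add: null_sets_completion_iff)
  also have "\<dots> \<longleftrightarrow> (AE x in lborel. x \<in> U \<longrightarrow> P x)"
    using assms(2) by (subst AE_iff_null_sets) auto
  finally show ?thesis .
qed

text \<open>The Poincare inequality for all exponents at once. The functions are replaced by Borel functions that
  vanish outside \<open>K\<close>, for which the integrals over chords are measurable.\<close>

lemma poincare_lp:
  fixes w :: "real^'d::finite \<Rightarrow> real^'m::finite" and h :: real
  assumes K: "open K" "convex K" "bounded K" "K \<noteq> {}" and p: "1 \<le> p"
    and w: "w \<in> lp_space p K" and g: "\<And>i. g i \<in> lp_space p K"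
    and wd: "\<And>i F x r. (\<And>j. tower (F j)) \<Longrightarrow> cball x r \<subseteq> K \<Longrightarrow>
      (\<And>y. y \<notin> cball x r \<Longrightarrow> tens F (\<lambda>_. 0) y = 0) \<Longrightarrow>
      (LINT y|lebesgue_on K. tens F (unit_mi i) y *\<^sub>R w y) = - (LINT y|lebesgue_on K. tens F (\<lambda>_. 0) y *\<^sub>R g i y)"
    and h: "\<And>x y. x \<in> K \<Longrightarrow> y \<in> K \<Longrightarrow> norm (x - y) \<le> h" "h > 0"
    and mean: "(LINT x|lebesgue_on K. w x) = 0"
  shows "lp_norm p K w \<le> 2 ^ CARD('d) * real CARD('d) * h * (\<Sum>i\<in>UNIV. lp_norm p K (g i))"
proof -
  have meas: "w \<in> borel_measurable (lebesgue_on K)" "g i \<in> borel_measurable (lebesgue_on K)" for i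
    using w g by (auto simp: lp_space_def)
  obtain w' where w': "w' \<in> borel_measurable borel" "AE x in lebesgue_on K. w x = w' x" "\<And>x. x \<notin> K \<Longrightarrow> w' x = 0"
    using ex_borel_representative_on[OF K(1) meas(1)] by blast
  have "\<exists>g'. g' \<in> borel_measurable borel \<and> (AE x in lebesgue_on K. g i x = g' x) \<and> (\<forall>x. x \<notin> K \<longrightarrow> g' x = 0)" for i
    using ex_borel_representative_on[OF K(1) meas(2)] by metis
  then obtain g' where g': "\<And>i. g' i \<in> borel_measurable borel" "\<And>i. AE x in lebesgue_on K. g i x = g' i x"
    "\<And>i x. x \<notin> K \<Longrightarrow> g' i x = 0" by metis
  note [measurable] = w'(1) g'(1)
  have borel_lebesgue: "f \<in> borel_measurable (lebesgue_on K)" if "f \<in> borel_measurable borel"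
    for f :: "real^'d \<Rightarrow> 'c::topological_space"
    using that by (simp add: measurable_completion measurable_restrict_space1)
  have lp': "w' \<in> lp_space p K" "g' i \<in> lp_space p K" for i
    using lp_space_cong_AE[OF w borel_lebesgue[OF w'(1)] w'(2)] lp_space_cong_AE[OF g borel_lebesgue[OF g'(1)] g'(2)] by auto
  have norm': "lp_norm p K w = lp_norm p K w'" "lp_norm p K (g i) = lp_norm p K (g' i)" for i
    using lp_norm_cong_AE[OF meas(1) borel_lebesgue[OF w'(1)] w'(2)]
      lp_norm_cong_AE[OF meas(2) borel_lebesgue[OF g'(1)] g'(2)] by auto
  have int': "integrable lborel w'" "integrable lborel (g' i)" for i
    using lp_space_integrable[OF K(1,3) p lp'(1)] lp_space_integrable[OF K(1,3) p lp'(2)]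
      integrable_lebesgue_on_support[OF w'(1) K(1) w'(3)] integrable_lebesgue_on_support[OF g'(1) K(1) g'(3)] by auto
  have mean': "(\<integral>x. w' x \<partial>lborel) = 0"
  proof -
    have "(\<integral>x. w' x \<partial>lborel) = (LINT x|lebesgue_on K. w' x)"
      by (rule integral_lebesgue_on_support[OF w'(1) K(1) w'(3), symmetric])
    also have "\<dots> = (LINT x|lebesgue_on K. w x)"
      using w'(2) by (intro integral_cong_AE borel_lebesgue w'(1) meas) (auto elim: eventually_mono)
    finally show ?thesis using mean by simp
  qed
  have wd': "tensor_weak_deriv K i w' (g' i)" for i
    unfolding tensor_weak_deriv_def
  proof (intro allI impI, elim conjE)
    fix F x r assume F: "\<forall>j. tower (F j)" and sub: "cball x r \<subseteq> K" and v: "\<forall>y. y \<notin> cball x r \<longrightarrow> tens F (\<lambda>_. 0) y = 0"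
    have T: "tens F \<alpha> \<in> borel_measurable borel" for \<alpha> by (rule tens_measurable) (use F in simp)
    have eq: "(\<integral>y. tens F \<alpha> y *\<^sub>R f' y \<partial>lborel) = (LINT y|lebesgue_on K. tens F \<alpha> y *\<^sub>R f y)"
      if f: "f \<in> borel_measurable (lebesgue_on K)" "f' \<in> borel_measurable borel" "AE x in lebesgue_on K. f x = f' x"
        "\<And>x. x \<notin> K \<Longrightarrow> f' x = 0" for \<alpha> and f f' :: "real^'d \<Rightarrow> real^'m"
    proof -
      have "(\<integral>y. tens F \<alpha> y *\<^sub>R f' y \<partial>lborel) = (LINT y|lebesgue_on K. tens F \<alpha> y *\<^sub>R f' y)"
        using T f K(1) by (intro integral_lebesgue_on_support[symmetric]) auto
      also have "\<dots> = (LINT y|lebesgue_on K. tens F \<alpha> y *\<^sub>R f y)"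
        using f(3) by (intro integral_cong_AE borel_measurable_scaleR borel_lebesgue T f(1,2)) (auto elim: eventually_mono)
      finally show ?thesis .
    qed
    show "(\<integral>y. tens F (unit_mi i) y *\<^sub>R w' y \<partial>lborel) = - (\<integral>y. tens F (\<lambda>_. 0) y *\<^sub>R g' i y \<partial>lborel)"
    proof -
      have "(\<integral>y. tens F (unit_mi i) y *\<^sub>R w' y \<partial>lborel) = (LINT y|lebesgue_on K. tens F (unit_mi i) y *\<^sub>R w y)"
        by (rule eq[OF meas(1) w'])
      also have "\<dots> = - (LINT y|lebesgue_on K. tens F (\<lambda>_. 0) y *\<^sub>R g i y)"
        using F v by (intro wd[OF _ sub]) auto
      also have "(LINT y|lebesgue_on K. tens F (\<lambda>_. 0) y *\<^sub>R g i y) = (\<integral>y. tens F (\<lambda>_. 0) y *\<^sub>R g' i y \<partial>lborel)"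
        by (rule eq[OF meas(2) g', symmetric])
      finally show ?thesis .
    qed
  qed
  let ?S = "\<Sum>i\<in>UNIV. lp_norm p K (g' i)"
  have S0: "?S \<ge> 0" by (intro sum_nonneg lp_norm_nonneg)
  have d2: "(1::real) \<le> 2 ^ CARD('d)" "1 \<le> real CARD('d)" by (auto simp: Suc_leI)
  show ?thesis
  proof (cases "p = \<infinity>")
    case True
    have "AE z in lebesgue_on K. \<forall>i\<in>UNIV. norm (g' i z) \<le> lp_norm p K (g' i)"
      using AE_lp_norm_bound lp'(2) True by (intro AE_finite_allI) auto
    then have "AE z in lebesgue_on K. (\<Sum>i\<in>UNIV. norm (g' i z)) \<le> ?S"
      by eventually_elim (auto intro: sum_mono)
    then have "AE z in lborel. z \<in> K \<longrightarrow> (\<Sum>i\<in>UNIV. norm (g' i z)) \<le> ?S"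
      using K(1) by (subst (asm) AE_lebesgue_on_iff_lborel) auto
    then have ae: "AE z in lborel. (\<Sum>i\<in>UNIV. norm (g' i z)) \<le> ?S"
    proof eventually_elim
      case (elim z)
      then show ?case using g'(3)[of z] S0 by (cases "z \<in> K") auto
    qed
    have "AE x in lborel. norm (w' x) \<le> h * ?S"
      by (rule poincare_essbound[OF K int' wd' h w'(3) mean' ae S0])
    then have "AE x in lebesgue_on K. norm (w' x) \<le> h * ?S"
      using K(1) by (subst AE_lebesgue_on_iff_lborel) (auto elim: eventually_mono)
    then have "lp_norm \<infinity> K w' \<le> h * ?S"
      using S0 h(2) by (intro lp_norm_infinity_le borel_lebesgue w'(1)) auto
    also have "\<dots> = 1 * (h * ?S)" by simp
    also have "\<dots> \<le> (2 ^ CARD('d) * real CARD('d)) * (h * ?S)"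
      using S0 h(2) mult_mono[OF d2] by (intro mult_right_mono) auto
    finally show ?thesis unfolding norm' using True by (simp add: mult.assoc)
  next
    case False
    then obtain q where q: "p = ereal q" "q \<ge> 1" using p by (cases p) auto
    have pw: "lp_norm p K f powr q = (\<integral>x. norm (f x) powr q \<partial>lborel)" "integrable lborel (\<lambda>x. norm (f x) powr q)"
      if "f \<in> lp_space p K" "f \<in> borel_measurable borel" "\<forall>x. x \<notin> K \<longrightarrow> f x = 0" for f :: "real^'d \<Rightarrow> real^'m"
    proof -
      have "(LINT x|lebesgue_on K. norm (f x) powr q) = (\<integral>x. norm (f x) powr q \<partial>lborel)"
        using that q K(1) by (intro integral_lebesgue_on_support) auto
      then show "lp_norm p K f powr q = (\<integral>x. norm (f x) powr q \<partial>lborel)"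
        using lp_norm_powr[OF False p, of K f] q by simp
      have "integrable (lebesgue_on K) (\<lambda>x. norm (f x) powr q)" using that q by (simp add: lp_space_def)
      then show "integrable lborel (\<lambda>x. norm (f x) powr q)"
        using that q K(1) by (subst (asm) integrable_lebesgue_on_support) auto
    qed
    have out: "\<forall>x. x \<notin> K \<longrightarrow> w' x = 0" "\<And>i. \<forall>x. x \<notin> K \<longrightarrow> g' i x = 0" using w'(3) g'(3) by auto
    note pw_w = pw[OF lp'(1) w'(1) out(1)] and pw_g = pw[OF lp'(2) g'(1) out(2)]
    define c where "c = 2 ^ CARD('d) * real CARD('d) * h"
    have c: "c > 0" using h(2) by (simp add: c_def)
    have "ennreal (lp_norm p K w' powr q) = (\<integral>\<^sup>+x. ennreal (norm (w' x) powr q) \<partial>lborel)"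
      unfolding pw_w(1) using pw_w(2) by (intro nn_integral_eq_integral[symmetric]) auto
    also have "\<dots> \<le> ennreal (h powr q * 2 ^ CARD('d)) * (\<integral>\<^sup>+z. ennreal ((\<Sum>i\<in>UNIV. norm (g' i z)) powr q) \<partial>lborel)"
      by (rule poincare_powr[OF K int' wd' h w'(3) mean' q(2)])
    also have "\<dots> \<le> ennreal (h powr q * 2 ^ CARD('d)) *
        (\<integral>\<^sup>+z. ennreal (CARD('d) powr q * (\<Sum>i\<in>UNIV. norm (g' i z) powr q)) \<partial>lborel)"
      using powr_sum_le_sum_powr[of UNIV "\<lambda>i. norm (g' i z)" q for z] q(2)
      by (intro mult_left_mono nn_integral_mono ennreal_leI) auto
    also have "(\<integral>\<^sup>+z. ennreal (CARD('d) powr q * (\<Sum>i\<in>UNIV. norm (g' i z) powr q)) \<partial>lborel)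
        = ennreal (\<integral>z. CARD('d) powr q * (\<Sum>i\<in>UNIV. norm (g' i z) powr q) \<partial>lborel)"
      using pw_g(2) by (intro nn_integral_eq_integral integrable_mult_right Bochner_Integration.integrable_sum)
        (auto intro!: AE_I2 mult_nonneg_nonneg sum_nonneg)
    also have "(\<integral>z. CARD('d) powr q * (\<Sum>i\<in>UNIV. norm (g' i z) powr q) \<partial>lborel)
        = CARD('d) powr q * (\<Sum>i\<in>UNIV. lp_norm p K (g' i) powr q)"
      unfolding pw_g(1) using pw_g(2) by (simp add: Bochner_Integration.integral_sum)
    also have "ennreal (h powr q * 2 ^ CARD('d)) * ennreal (CARD('d) powr q * (\<Sum>i\<in>UNIV. lp_norm p K (g' i) powr q))
        = ennreal (h powr q * 2 ^ CARD('d) * (CARD('d) powr q * (\<Sum>i\<in>UNIV. lp_norm p K (g' i) powr q)))"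
      by (rule ennreal_mult'[symmetric]) simp
    also have "\<dots> \<le> ennreal (h powr q * (2 ^ CARD('d)) powr q * (CARD('d) powr q * ?S powr q))"
    proof (intro ennreal_leI mult_mono)
      show "(2::real) ^ CARD('d) \<le> (2 ^ CARD('d)) powr q" using powr_mono[of 1 q "2 ^ CARD('d)"] q(2) by simp
      show "(\<Sum>i\<in>UNIV. lp_norm p K (g' i) powr q) \<le> ?S powr q"
        using q(2) by (intro sum_powr_le_powr_sum lp_norm_nonneg) auto
    qed (auto intro!: mult_nonneg_nonneg sum_nonneg)
    also have "h powr q * (2 ^ CARD('d)) powr q * (CARD('d) powr q * ?S powr q) = (c * ?S) powr q"
      using h(2) S0 by (simp add: c_def powr_mult mult_ac)
    finally have "lp_norm p K w' powr q \<le> (c * ?S) powr q" by (subst (asm) ennreal_le_iff) auto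
    then have "lp_norm p K w' \<le> c * ?S"
      using powr_less_mono2[of q "c * ?S" "lp_norm p K w'"] q(2) c S0 by (force simp: not_le)
    then show ?thesis unfolding norm' c_def .
  qed
qed

section \<open>Polynomial approximation on convex sets\<close>

lemma finite_mi_order_le: "finite {\<beta> :: 'd::finite \<Rightarrow> nat. mi_order \<beta> \<le> n}"
proof (rule finite_subset)
  show "{\<beta>. mi_order \<beta> \<le> n} \<subseteq> PiE (UNIV :: 'd set) (\<lambda>_. {..n})"
  proof (clarsimp simp: PiE_def)
    fix \<beta> :: "'d \<Rightarrow> nat" and i assume "mi_order \<beta> \<le> n"
    moreover have "\<beta> i \<le> mi_order \<beta>" unfolding mi_order_def by (intro member_le_sum) auto
    ultimately show "\<beta> i \<le> n" by simp
  qed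
  show "finite (PiE (UNIV :: 'd set) (\<lambda>_. {..n}))" by (intro finite_PiE) auto
qed

lemma finite_mi_order_less: "finite {\<beta> :: 'd::finite \<Rightarrow> nat. mi_order \<beta> < n}"
  by (rule finite_subset[OF _ finite_mi_order_le[of n]]) auto

lemma finite_mi_order_eq: "finite {\<beta> :: 'd::finite \<Rightarrow> nat. mi_order \<beta> = n}"
  by (rule finite_subset[OF _ finite_mi_order_le[of n]]) auto

text \<open>A monomial of at most the order of \<open>\<alpha>\<close> has, unless its exponents are \<open>\<alpha>\<close>, an exponent smaller than the
  corresponding entry of \<open>\<alpha>\<close>.\<close>

lemma mono_deriv_order_eq_0:
  fixes \<alpha> \<beta> :: "'d::finite \<Rightarrow> nat"
  assumes "mi_order \<beta> \<le> mi_order \<alpha>" "\<beta> \<noteq> \<alpha>"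
  shows "mono_deriv \<beta> \<alpha> x = 0"
proof -
  have "\<exists>i. \<alpha> i > \<beta> i"
  proof (rule ccontr)
    assume "\<nexists>i. \<alpha> i > \<beta> i"
    then have le: "\<alpha> i \<le> \<beta> i" for i by (simp add: not_less)
    obtain j where "\<alpha> j \<noteq> \<beta> j" using assms(2) by (metis ext)
    then have "mi_order \<alpha> < mi_order \<beta>"
      unfolding mi_order_def using le by (intro sum_strict_mono_ex1) (auto simp: le_less)
    then show False using assms(1) by simp
  qed
  then show ?thesis using mono_deriv_eq_0 by blast
qed

lemma measure_open_pos:
  fixes U :: "'a::euclidean_space set"
  assumes "open U" "bounded U" "U \<noteq> {}"
  shows "measure lebesgue U > 0"
proof -
  have "U \<in> lmeasurable" using assms by (simp add: lmeasurable_open)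
  then show ?thesis
    using assms open_not_negligible[OF assms(1,3)] measure_nonneg[of lebesgue U]
    by (auto simp: negligible_iff_measure order.strict_iff_order)
qed

text \<open>The coefficients are determined from the highest order downwards: a change of the coefficients of order
  \<open>l\<close> does not affect derivatives of higher order, and changes each derivative of order \<open>l\<close> by a constant.\<close>

lemma ex_mpoly_matching_means:
  fixes W :: "('d::finite \<Rightarrow> nat) \<Rightarrow> real^'d \<Rightarrow> real^'m::finite"
  assumes \<tau>: "open \<tau>" "bounded \<tau>" "\<tau> \<noteq> {}"
    and W: "\<And>\<alpha>. mi_order \<alpha> < r \<Longrightarrow> integrable (lebesgue_on \<tau>) (W \<alpha>)"
  shows "\<exists>c. \<forall>\<alpha>. mi_order \<alpha> < r \<longrightarrow>
    (LINT x|lebesgue_on \<tau>. W \<alpha> x - mpoly_deriv {\<beta>. mi_order \<beta> < r} c \<alpha> x) = 0"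
proof -
  let ?B = "{\<beta> :: 'd \<Rightarrow> nat. mi_order \<beta> < r}"
  have fin: "finite ?B" by (rule finite_mi_order_less)
  have pint: "integrable (lebesgue_on \<tau>) (mpoly_deriv ?B c \<alpha>)" for c :: "('d \<Rightarrow> nat) \<Rightarrow> real^'m" and \<alpha>
    by (rule lp_space_integrable[OF \<tau>(1,2) order.refl lp_space_continuous[OF \<tau>(1,2) mpoly_deriv_continuous order.refl]])
  have "\<exists>c. \<forall>\<alpha>. r - n \<le> mi_order \<alpha> \<and> mi_order \<alpha> < r \<longrightarrow>
    (LINT x|lebesgue_on \<tau>. W \<alpha> x - mpoly_deriv ?B c \<alpha> x) = 0" if "n \<le> r" for n
    using that
  proof (induction n)
    case 0
    then show ?case by auto
  next
    case (Suc n)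
    then obtain c where c: "\<And>\<alpha>. r - n \<le> mi_order \<alpha> \<Longrightarrow> mi_order \<alpha> < r \<Longrightarrow>
      (LINT x|lebesgue_on \<tau>. W \<alpha> x - mpoly_deriv ?B c \<alpha> x) = 0" by auto
    define l where "l = r - Suc n"
    have l: "l < r" "r - n = Suc l" using Suc.prems by (auto simp: l_def)
    define m where "m \<alpha> = (LINT x|lebesgue_on \<tau>. W \<alpha> x - mpoly_deriv ?B c \<alpha> x)" for \<alpha>
    define k where "k \<alpha> = measure lebesgue \<tau> * (\<Prod>i\<in>UNIV. fact (\<alpha> i))" for \<alpha> :: "'d \<Rightarrow> nat"
    have k: "k \<alpha> \<noteq> 0" for \<alpha> using measure_open_pos[OF \<tau>] by (simp add: k_def)
    \<comment> \<open>The correction of the coefficients of order \<open>l\<close>; \<open>k \<alpha>\<close> is the integral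
      of the derivative of order \<open>\<alpha>\<close> of the monomial with exponents \<open>\<alpha>\<close>.\<close>
    define e where "e \<alpha> = (if mi_order \<alpha> = l then (1 / k \<alpha>) *\<^sub>R m \<alpha> else 0)" for \<alpha>
    define c' where "c' \<alpha> = c \<alpha> + e \<alpha>" for \<alpha>
    have split: "mpoly_deriv ?B c' \<alpha> x = mpoly_deriv ?B c \<alpha> x + (\<Sum>\<beta>\<in>?B. mono_deriv \<beta> \<alpha> x *\<^sub>R e \<beta>)" for \<alpha> x
      by (simp add: mpoly_deriv_def c'_def scaleR_add_right sum.distrib)
    have "(LINT x|lebesgue_on \<tau>. W \<alpha> x - mpoly_deriv ?B c' \<alpha> x) = 0" if \<alpha>: "l \<le> mi_order \<alpha>" "mi_order \<alpha> < r" for \<alpha>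
    proof (cases "mi_order \<alpha> = l")
      case False
      have "(\<Sum>\<beta>\<in>?B. mono_deriv \<beta> \<alpha> x *\<^sub>R e \<beta>) = 0" for x
      proof (intro sum.neutral ballI)
        fix \<beta>
        show "mono_deriv \<beta> \<alpha> x *\<^sub>R e \<beta> = 0"
        proof (cases "mi_order \<beta> = l")
          case True
          then have "mono_deriv \<beta> \<alpha> x = 0" using False \<alpha> by (intro mono_deriv_order_eq_0) auto
          then show ?thesis by simp
        qed (simp add: e_def)
      qed
      then show ?thesis unfolding split using c[of \<alpha>] \<alpha> False l by simp
    next
      case True
      have "(\<Sum>\<beta>\<in>?B. mono_deriv \<beta> \<alpha> x *\<^sub>R e \<beta>) = (\<Sum>\<beta>\<in>?B. if \<beta> = \<alpha> then mono_deriv \<alpha> \<alpha> x *\<^sub>R e \<alpha> else 0)" for x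
        by (rule sum.cong) (use True in \<open>auto simp: e_def mono_deriv_order_eq_0\<close>)
      then have sum: "(\<Sum>\<beta>\<in>?B. mono_deriv \<beta> \<alpha> x *\<^sub>R e \<beta>) = (\<Prod>i\<in>UNIV. fact (\<alpha> i)) *\<^sub>R e \<alpha>" for x
        using fin \<alpha> by (simp add: mono_deriv_same)
      have ci: "integrable (lebesgue_on \<tau>) (\<lambda>_. z)" for z :: "real^'m"
        using lebesgue_on_finite[OF \<tau>(1,2)] by (intro finite_measure.integrable_const finite_measureI) auto
      have "(LINT x|lebesgue_on \<tau>. W \<alpha> x - mpoly_deriv ?B c' \<alpha> x)
          = (LINT x|lebesgue_on \<tau>. (W \<alpha> x - mpoly_deriv ?B c \<alpha> x) - (\<Prod>i\<in>UNIV. fact (\<alpha> i)) *\<^sub>R e \<alpha>)"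
        unfolding split sum by (simp add: algebra_simps)
      also have "\<dots> = m \<alpha> - (LINT x|lebesgue_on \<tau>. (\<Prod>i\<in>UNIV. fact (\<alpha> i)) *\<^sub>R e \<alpha>)"
        unfolding m_def using W[OF \<alpha>(2)] pint by (intro Bochner_Integration.integral_diff ci) auto
      also have "(LINT x|lebesgue_on \<tau>. (\<Prod>i\<in>UNIV. fact (\<alpha> i)) *\<^sub>R e \<alpha>) = k \<alpha> *\<^sub>R e \<alpha>"
        using \<tau>(1) by (simp add: k_def measure_restrict_space)
      also have "k \<alpha> *\<^sub>R e \<alpha> = m \<alpha>" using True k by (simp add: e_def)
      finally show ?thesis by simp
    qed
    then show ?case unfolding l_def[symmetric] by blast
  qed
  from this[of r] show ?thesis by simp
qed

text \<open>Testing with a partial derivative of a tensor product, which is itself a tensor product, shows that the derivative of order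
  \<open>\<alpha> + unit_mi i\<close> is a weak partial derivative of \<open>w\<close>.\<close>

lemma weak_deriv_chain:
  fixes u :: "real^'d::finite \<Rightarrow> real^'m::finite"
  assumes w: "is_weak_deriv U \<alpha> u w" and w': "is_weak_deriv U (\<lambda>j. \<alpha> j + unit_mi i j) u w'"
    and F: "\<And>j. tower (F j)" and sub: "cball x r \<subseteq> U" and v: "\<And>y. y \<notin> cball x r \<Longrightarrow> tens F (\<lambda>_. 0) y = 0"
  shows "(LINT y|lebesgue_on U. tens F (unit_mi i) y *\<^sub>R w y) = - (LINT y|lebesgue_on U. tens F (\<lambda>_. 0) y *\<^sub>R w' y)"
proof -
  \<comment> \<open>The tensor product of these functions is the \<open>i\<close>-th partial derivative of the one of \<open>F\<close>.\<close>
  define G where "G j n = F j (n + unit_mi i j)" for j n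
  have G: "tower (G j)" for j using F[of j] by (simp add: tower_def G_def)
  have GF: "tens G \<beta> = tens F (\<lambda>j. \<beta> j + unit_mi i j)" for \<beta> by (simp add: tens_def[abs_def] G_def)
  have G0: "tens G (\<lambda>_. 0) = partial_deriv i (tens F (\<lambda>_. 0))"
    using GF[of "\<lambda>_. 0"] by (simp add: partial_deriv_tens[of F, OF F] unit_mi_def fun_upd_def)
  have "tens G (\<lambda>_. 0) y = 0" if "y \<notin> cball x r" for y
    unfolding G0 by (rule partial_deriv_outside_support[OF closed_cball v that])
  then have "test_function U (tens G (\<lambda>_. 0))" by (rule test_function_tens[OF G _ sub])
  then have 1: "(LINT y|lebesgue_on U. multi_deriv \<alpha> (tens G (\<lambda>_. 0)) y *\<^sub>R u y) =
        (- 1) ^ mi_order \<alpha> *\<^sub>R (LINT y|lebesgue_on U. tens G (\<lambda>_. 0) y *\<^sub>R w y)"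
    using w by (simp add: is_weak_deriv_def)
  have "test_function U (tens F (\<lambda>_. 0))" by (rule test_function_tens[OF F v sub])
  then have 2: "(LINT y|lebesgue_on U. multi_deriv (\<lambda>j. \<alpha> j + unit_mi i j) (tens F (\<lambda>_. 0)) y *\<^sub>R u y) =
        (- 1) ^ mi_order (\<lambda>j. \<alpha> j + unit_mi i j) *\<^sub>R (LINT y|lebesgue_on U. tens F (\<lambda>_. 0) y *\<^sub>R w' y)"
    using w' by (simp add: is_weak_deriv_def)
  have eq: "multi_deriv \<alpha> (tens G (\<lambda>_. 0)) = multi_deriv (\<lambda>j. \<alpha> j + unit_mi i j) (tens F (\<lambda>_. 0))"
    by (simp add: multi_deriv_tens[of G, OF G] multi_deriv_tens[of F, OF F] GF add.commute)
  have ord: "mi_order (\<lambda>j. \<alpha> j + unit_mi i j) = Suc (mi_order \<alpha>)"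
    using mi_order_unit[of i] by (simp add: mi_order_def sum.distrib)
  have "(- 1) ^ mi_order \<alpha> *\<^sub>R (LINT y|lebesgue_on U. tens G (\<lambda>_. 0) y *\<^sub>R w y)
      = (- 1) ^ mi_order \<alpha> *\<^sub>R (- (LINT y|lebesgue_on U. tens F (\<lambda>_. 0) y *\<^sub>R w' y))"
    using 1 2 unfolding eq ord by simp
  then have "(LINT y|lebesgue_on U. tens G (\<lambda>_. 0) y *\<^sub>R w y) = - (LINT y|lebesgue_on U. tens F (\<lambda>_. 0) y *\<^sub>R w' y)"
    by (rule scaleR_left_imp_eq[rotated]) simp
  then show ?thesis by (simp add: GF)
qed

text \<open>The Poincare inequality is iterated from order \<open>r\<close> down to the order of \<open>\<alpha>\<close>. All derivatives of lower
  order than \<open>r\<close> of the difference have mean value zero, and its derivatives of order \<open>r\<close> are those of \<open>u\<close>.\<close>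

lemma bramble_hilbert:
  fixes u :: "real^'d::finite \<Rightarrow> real^'m::finite" and h :: real
  assumes \<tau>: "open \<tau>" "convex \<tau>" "bounded \<tau>" "\<tau> \<noteq> {}" and p: "1 \<le> p"
    and lp: "\<And>\<alpha>. mi_order \<alpha> \<le> r \<Longrightarrow> W \<alpha> \<in> lp_space p \<tau>"
    and wd: "\<And>\<alpha>. mi_order \<alpha> \<le> r \<Longrightarrow> is_weak_deriv \<tau> \<alpha> u (W \<alpha>)"
    and h: "\<And>x y. x \<in> \<tau> \<Longrightarrow> y \<in> \<tau> \<Longrightarrow> norm (x - y) \<le> h" "h > 0"
  obtains c where "\<And>\<alpha>. mi_order \<alpha> \<le> r \<Longrightarrow>
      (\<lambda>x. W \<alpha> x - mpoly_deriv {\<beta>. mi_order \<beta> < r} c \<alpha> x) \<in> lp_space p \<tau>"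
    "\<And>\<alpha>. mi_order \<alpha> \<le> r \<Longrightarrow>
      is_weak_deriv \<tau> \<alpha> (\<lambda>x. u x - mpoly_deriv {\<beta>. mi_order \<beta> < r} c (\<lambda>_. 0) x)
        (\<lambda>x. W \<alpha> x - mpoly_deriv {\<beta>. mi_order \<beta> < r} c \<alpha> x)"
    "\<And>\<alpha>. mi_order \<alpha> \<le> r \<Longrightarrow>
      lp_norm p \<tau> (\<lambda>x. W \<alpha> x - mpoly_deriv {\<beta>. mi_order \<beta> < r} c \<alpha> x)
        \<le> (2 ^ CARD('d) * real CARD('d) * real CARD('d) * h) ^ (r - mi_order \<alpha>) * (\<Sum>\<beta> | mi_order \<beta> = r. lp_norm p \<tau> (W \<beta>))"
proof -
  let ?B = "{\<beta> :: 'd \<Rightarrow> nat. mi_order \<beta> < r}"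
  have "\<exists>c. \<forall>\<alpha>. mi_order \<alpha> < r \<longrightarrow> (LINT x|lebesgue_on \<tau>. W \<alpha> x - mpoly_deriv ?B c \<alpha> x) = 0"
    by (rule ex_mpoly_matching_means[OF \<tau>(1,3,4)]) (use lp in \<open>auto intro!: lp_space_integrable[OF \<tau>(1,3) p]\<close>)
  then obtain c where c: "\<And>\<alpha>. mi_order \<alpha> < r \<Longrightarrow> (LINT x|lebesgue_on \<tau>. W \<alpha> x - mpoly_deriv ?B c \<alpha> x) = 0"
    by blast
  define E where "E \<alpha> = (\<lambda>x. W \<alpha> x - mpoly_deriv ?B c \<alpha> x)" for \<alpha>
  define v where "v = (\<lambda>x. u x - mpoly_deriv ?B c (\<lambda>_. 0) x)"
  have Elp: "E \<alpha> \<in> lp_space p \<tau>" if "mi_order \<alpha> \<le> r" for \<alpha>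
    unfolding E_def by (rule lp_space_diff[OF p lp[OF that] lp_space_continuous[OF \<tau>(1,3) mpoly_deriv_continuous p]])
  have Ewd: "is_weak_deriv \<tau> \<alpha> v (E \<alpha>)" if "mi_order \<alpha> \<le> r" for \<alpha>
    unfolding E_def v_def by (rule is_weak_deriv_diff[OF \<tau>(1) wd[OF that] is_weak_deriv_mpoly[OF \<tau>(1)]])
  have top: "E \<beta> = W \<beta>" if "mi_order \<beta> = r" for \<beta>
  proof -
    have "mpoly_deriv ?B c \<beta> x = 0" for x
      unfolding mpoly_deriv_def
    proof (intro sum.neutral ballI)
      fix \<gamma> :: "'d \<Rightarrow> nat" assume "\<gamma> \<in> ?B"
      then have "mono_deriv \<gamma> \<beta> x = 0" using that by (intro mono_deriv_order_eq_0) auto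
      then show "mono_deriv \<gamma> \<beta> x *\<^sub>R c \<gamma> = 0" by simp
    qed
    then show ?thesis by (simp add: E_def)
  qed
  define R where "R = (\<Sum>\<beta> | mi_order \<beta> = r. lp_norm p \<tau> (W \<beta>))"
  define A where "A = 2 ^ CARD('d) * real CARD('d) * h"
  have A0: "A \<ge> 0" using h(2) by (simp add: A_def)
  have R0: "R \<ge> 0" unfolding R_def by (intro sum_nonneg lp_norm_nonneg)
  have bound: "lp_norm p \<tau> (E \<alpha>) \<le> (A * CARD('d)) ^ n * R" if "mi_order \<alpha> \<le> r" "r - mi_order \<alpha> = n" for n \<alpha>
    using that
  proof (induction n arbitrary: \<alpha>)
    case 0
    then have "mi_order \<alpha> = r" by simp
    then have "lp_norm p \<tau> (W \<alpha>) \<le> R"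
      unfolding R_def by (intro member_le_sum lp_norm_nonneg finite_mi_order_eq) auto
    then show ?case using top[OF \<open>mi_order \<alpha> = r\<close>] by simp
  next
    case (Suc n)
    let ?a = "\<lambda>i j. \<alpha> j + unit_mi i j"
    have ord: "mi_order (?a i) = Suc (mi_order \<alpha>)" for i
      using mi_order_unit[of i] by (simp add: mi_order_def sum.distrib)
    have less: "mi_order \<alpha> < r" using Suc.prems by simp
    have "lp_norm p \<tau> (E \<alpha>) \<le> A * (\<Sum>i\<in>UNIV. lp_norm p \<tau> (E (?a i)))"
      unfolding A_def
    proof (rule poincare_lp[OF \<tau> p Elp Elp _ h])
      show "(LINT y|lebesgue_on \<tau>. tens F (unit_mi i) y *\<^sub>R E \<alpha> y) = - (LINT y|lebesgue_on \<tau>. tens F (\<lambda>_. 0) y *\<^sub>R E (?a i) y)"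
        if "\<And>j. tower (F j)" "cball x s \<subseteq> \<tau>" "\<And>y. y \<notin> cball x s \<Longrightarrow> tens F (\<lambda>_. 0) y = 0" for i F x s
        using less by (intro weak_deriv_chain[OF Ewd Ewd that]) (auto simp: ord)
      show "(LINT x|lebesgue_on \<tau>. E \<alpha> x) = 0" using c[OF less] by (simp add: E_def)
    qed (use less in \<open>auto simp: ord\<close>)
    also have "\<dots> \<le> A * (\<Sum>i\<in>(UNIV :: 'd set). (A * CARD('d)) ^ n * R)"
      using A0 Suc.prems by (intro mult_left_mono sum_mono Suc.IH) (auto simp: ord)
    also have "\<dots> = (A * CARD('d)) ^ Suc n * R" by simp
    finally show ?case .
  qed
  have eqA: "A * CARD('d) = 2 ^ CARD('d) * real CARD('d) * real CARD('d) * h" by (simp add: A_def)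
  show thesis
  proof (rule that[of c])
    show "(\<lambda>x. W \<alpha> x - mpoly_deriv ?B c \<alpha> x) \<in> lp_space p \<tau>" if "mi_order \<alpha> \<le> r" for \<alpha>
      using Elp[OF that] by (simp add: E_def)
    show "is_weak_deriv \<tau> \<alpha> (\<lambda>x. u x - mpoly_deriv ?B c (\<lambda>_. 0) x) (\<lambda>x. W \<alpha> x - mpoly_deriv ?B c \<alpha> x)"
      if "mi_order \<alpha> \<le> r" for \<alpha>
      using Ewd[OF that] by (simp add: E_def v_def)
    show "lp_norm p \<tau> (\<lambda>x. W \<alpha> x - mpoly_deriv ?B c \<alpha> x)
        \<le> (2 ^ CARD('d) * real CARD('d) * real CARD('d) * h) ^ (r - mi_order \<alpha>) * (\<Sum>\<beta> | mi_order \<beta> = r. lp_norm p \<tau> (W \<beta>))"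
      if "mi_order \<alpha> \<le> r" for \<alpha>
      using bound[OF that refl] unfolding eqA E_def R_def by simp
  qed
qed

section \<open>Polynomials as sums of powers of positive affine functions\<close>

interpretation fun_space: vector_space "\<lambda>(c::real) (f::'a \<Rightarrow> real) x. c * f x"
  by unfold_locales (auto simp: fun_eq_iff algebra_simps)

lemma sum_fun_apply: "(\<Sum>a\<in>A. F a) x = (\<Sum>a\<in>A. F a x :: real)"
  by (induction A rule: infinite_finite_induct) auto

text \<open>A polynomial in \<open>t\<close> with values in the subspace for small positive \<open>t\<close> has its coefficients there, even
  without a topology on the subspace: the combination \<open>p (2 t) - 2\<^sup>n p t\<close> eliminates the leading
  coefficient.\<close>

lemma polynomial_coefficients_in_subspace:
  fixes f :: "nat \<Rightarrow> 'a \<Rightarrow> real"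
  assumes V: "fun_space.subspace V" and "\<epsilon> > 0"
    and "\<And>t. 0 < t \<Longrightarrow> t < \<epsilon> \<Longrightarrow> (\<lambda>x. \<Sum>j\<le>n. t ^ j * f j x) \<in> V" and "j \<le> n"
  shows "f j \<in> V"
  using assms(2-4)
proof (induction n arbitrary: f \<epsilon> j)
  case 0
  have "(\<lambda>x. \<Sum>j\<le>0. (\<epsilon> / 2) ^ j * f j x) \<in> V" using 0 by (intro 0(2)) auto
  then show ?case using 0 by simp
next
  case (Suc n)
  note scale = fun_space.subspace_scale[OF V] and diff = fun_space.subspace_diff[OF V]
  have low: "f i \<in> V" if "i \<le> n" for i
  proof -
    \<comment> \<open>The coefficients of \<open>p (2 t) - 2 ^ Suc n * p t\<close>, whose degree is at most \<open>n\<close>.\<close>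
    define g where "g i x = (2 ^ i - 2 ^ Suc n) * f i x" for i x
    have "g i \<in> V"
    proof (rule Suc.IH[of "\<epsilon> / 2"])
      fix t :: real assume t: "0 < t" "t < \<epsilon> / 2"
      have "(\<lambda>x. \<Sum>j\<le>Suc n. (2 * t) ^ j * f j x) - (\<lambda>x. 2 ^ Suc n * (\<Sum>j\<le>Suc n. t ^ j * f j x)) \<in> V"
        using t by (intro diff scale Suc.prems) auto
      also have "(\<lambda>x. \<Sum>j\<le>Suc n. (2 * t) ^ j * f j x) - (\<lambda>x. 2 ^ Suc n * (\<Sum>j\<le>Suc n. t ^ j * f j x))
          = (\<lambda>x. \<Sum>j\<le>Suc n. (2 ^ j - 2 ^ Suc n) * t ^ j * f j x)"
        by (simp add: fun_eq_iff sum_distrib_left power_mult_distrib algebra_simps flip: sum_subtractf)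
      also have "\<dots> = (\<lambda>x. \<Sum>j\<le>n. t ^ j * g j x)" by (simp add: g_def mult_ac)
      finally show "(\<lambda>x. \<Sum>j\<le>n. t ^ j * g j x) \<in> V" .
    qed (use Suc.prems that in auto)
    then have "(\<lambda>x. 1 / (2 ^ i - 2 ^ Suc n) * g i x) \<in> V" by (rule scale)
    moreover have "(2::real) ^ i < 2 ^ Suc n" using that by (intro power_strict_increasing) auto
    ultimately show ?thesis by (simp add: g_def)
  qed
  show ?case
  proof (cases "j \<le> n")
    case False
    then have j: "j = Suc n" using Suc.prems(3) by simp
    define t where "t = \<epsilon> / 2"
    have t: "0 < t" "t < \<epsilon>" using Suc.prems(1) by (auto simp: t_def)
    have "(\<Sum>i\<le>n. (\<lambda>x. t ^ i * f i x)) \<in> V"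
      by (intro fun_space.subspace_sum[OF V] scale low) auto
    then have "(\<lambda>x. \<Sum>i\<le>n. t ^ i * f i x) \<in> V"
    proof -
      have "(\<Sum>i\<le>n. (\<lambda>x. t ^ i * f i x)) = (\<lambda>x. \<Sum>i\<le>n. t ^ i * f i x)"
        by (rule ext) (rule sum_fun_apply)
      with \<open>_ \<in> V\<close> show ?thesis by simp
    qed
    then have "(\<lambda>x. \<Sum>i\<le>Suc n. t ^ i * f i x) - (\<lambda>x. \<Sum>i\<le>n. t ^ i * f i x) \<in> V"
      using t by (intro diff Suc.prems)
    then have "(\<lambda>x. 1 / t ^ Suc n * ((\<lambda>x. \<Sum>i\<le>Suc n. t ^ i * f i x) - (\<lambda>x. \<Sum>i\<le>n. t ^ i * f i x)) x) \<in> V"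
      by (rule scale)
    then show ?thesis using t j by simp
  qed (rule low)
qed

definition affine_fun :: "(real^'d::finite \<Rightarrow> real) \<Rightarrow> bool" where
  "affine_fun l \<longleftrightarrow> (\<exists>v c. l = (\<lambda>x. v \<bullet> x + c))"

lemma affine_fun_const: "affine_fun (\<lambda>x. c)"
  unfolding affine_fun_def by (rule exI[of _ 0]) auto

lemma affine_fun_coord: "affine_fun (\<lambda>x. x $ i)"
  unfolding affine_fun_def by (rule exI[of _ "axis i 1"], rule exI[of _ 0]) (auto simp: inner_axis inner_commute)

lemma affine_fun_add_mult: "affine_fun l \<Longrightarrow> affine_fun m \<Longrightarrow> affine_fun (\<lambda>x. l x + t * m x)"
  unfolding affine_fun_def
proof (elim exE)
  fix v c v' c' assume "l = (\<lambda>x. v \<bullet> x + c)" "m = (\<lambda>x. v' \<bullet> x + c')"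
  then show "\<exists>w d. (\<lambda>x. l x + t * m x) = (\<lambda>x. w \<bullet> x + d)"
    by (intro exI[of _ "v + t *\<^sub>R v'"] exI[of _ "c + t * c'"]) (auto simp: inner_add_left algebra_simps)
qed

lemma affine_fun_bounded:
  assumes "affine_fun l" "bounded K"
  obtains C where "C > 0" "\<And>x. x \<in> K \<Longrightarrow> \<bar>l x\<bar> \<le> C"
proof -
  obtain v c where l: "l = (\<lambda>x. v \<bullet> x + c)" using assms(1) by (auto simp: affine_fun_def)
  obtain R where R: "R > 0" "\<And>x. x \<in> K \<Longrightarrow> norm x \<le> R" using assms(2) by (auto simp: bounded_pos)
  show thesis
  proof (rule that[of "norm v * R + \<bar>c\<bar> + 1"])
    show "norm v * R + \<bar>c\<bar> + 1 > 0" using R(1) by (intro add_nonneg_pos add_nonneg_nonneg) auto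
    fix x assume "x \<in> K"
    then have "\<bar>v \<bullet> x\<bar> \<le> norm v * R"
      using Cauchy_Schwarz_ineq2[of v x] R(2)[of x] mult_left_mono[of "norm x" R "norm v"] by auto
    then show "\<bar>l x\<bar> \<le> norm v * R + \<bar>c\<bar> + 1" unfolding l by linarith
  qed
qed

text \<open>A positive lower bound, rather than positivity alone, keeps small perturbations of \<open>l\<close> positive on a
  bounded set.\<close>

definition positive_affine :: "(real^'d::finite) set \<Rightarrow> (real^'d \<Rightarrow> real) \<Rightarrow> bool" where
  "positive_affine K l \<longleftrightarrow> affine_fun l \<and> (\<exists>\<delta>>0. \<forall>x\<in>K. \<delta> \<le> l x)"

definition powers_of_positive :: "nat \<Rightarrow> (real^'d::finite) set \<Rightarrow> (real^'d \<Rightarrow> real) set" where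
  "powers_of_positive k K = {\<lambda>x. l x ^ k | l. positive_affine K l}"

text \<open>Polarisation by differentiation: \<open>(a + t l)\<close> is positive for small \<open>t\<close>, and up to a constant the product
  with one factor \<open>a\<close> replaced by \<open>l\<close> is the coefficient of \<open>t\<close> in the power of \<open>a + t l\<close>. The factors \<open>a\<close>
  are replaced one after the other.\<close>

lemma products_in_span_powers:
  fixes K :: "(real^'d::finite) set"
  assumes "bounded K" "i \<le> k" "positive_affine K a" "\<forall>l\<in>set ls. affine_fun l" "length ls = k - i"
  shows "(\<lambda>x. a x ^ i * (\<Prod>l\<leftarrow>ls. l x)) \<in> fun_space.span (powers_of_positive k K)"
  using assms(2-)
proof (induction i arbitrary: a ls rule: inc_induct)
  case base
  then show ?case by (auto simp: powers_of_positive_def intro!: fun_space.span_base)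
next
  case (step i)
  obtain l ls' where ls: "ls = l # ls'" "length ls' = k - Suc i"
    using step.prems(3) step.hyps by (cases ls) auto
  have l: "affine_fun l" "\<forall>l\<in>set ls'. affine_fun l" using step.prems(2) ls by auto
  obtain \<delta> where \<delta>: "\<delta> > 0" "\<And>x. x \<in> K \<Longrightarrow> \<delta> \<le> a x" and a: "affine_fun a"
    using step.prems(1) by (auto simp: positive_affine_def)
  obtain C where C: "C > 0" "\<And>x. x \<in> K \<Longrightarrow> \<bar>l x\<bar> \<le> C"
    using affine_fun_bounded[OF l(1) assms(1)] by blast
  let ?P = "\<lambda>x. \<Prod>l\<leftarrow>ls'. l x"
  \<comment> \<open>The coefficients of the expansion in powers of \<open>t\<close>.\<close>
  define f where "f j x = real (Suc i choose j) * (l x ^ j * a x ^ (Suc i - j)) * ?P x" for j x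
  have "f 1 \<in> fun_space.span (powers_of_positive k K)"
  proof (rule polynomial_coefficients_in_subspace[OF fun_space.subspace_span])
    show "\<delta> / (2 * C) > 0" using \<delta> C by simp
    fix t :: real assume t: "0 < t" "t < \<delta> / (2 * C)"
    have "positive_affine K (\<lambda>x. a x + t * l x)"
      unfolding positive_affine_def
    proof (intro conjI affine_fun_add_mult a l exI[of _ "\<delta> / 2"] ballI)
      fix x assume "x \<in> K"
      have "\<bar>t * l x\<bar> \<le> t * C" using t C(2)[OF \<open>x \<in> K\<close>] by (simp add: abs_mult)
      also have "\<dots> \<le> \<delta> / 2" using t C(1) by (simp add: field_simps)
      finally show "\<delta> / 2 \<le> a x + t * l x" using \<delta>(2)[OF \<open>x \<in> K\<close>] by linarith
    qed (use \<delta> in auto)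
    from step.IH[OF this l(2) ls(2)]
    have "(\<lambda>x. (a x + t * l x) ^ Suc i * ?P x) \<in> fun_space.span (powers_of_positive k K)" .
    also have "(\<lambda>x. (a x + t * l x) ^ Suc i * ?P x) = (\<lambda>x. \<Sum>j\<le>Suc i. t ^ j * f j x)"
    proof
      fix x
      have "(a x + t * l x) ^ Suc i = (\<Sum>j\<le>Suc i. real (Suc i choose j) * (t * l x) ^ j * a x ^ (Suc i - j))"
        using binomial_ring[of "t * l x" "a x" "Suc i"] by (simp add: add.commute)
      then have "(a x + t * l x) ^ Suc i * ?P x
          = (\<Sum>j\<le>Suc i. real (Suc i choose j) * (t * l x) ^ j * a x ^ (Suc i - j) * ?P x)"
        by (simp only: sum_distrib_right)
      also have "\<dots> = (\<Sum>j\<le>Suc i. t ^ j * f j x)"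
        by (rule sum.cong[OF refl]) (simp only: f_def power_mult_distrib mult_ac)
      finally show "(a x + t * l x) ^ Suc i * ?P x = (\<Sum>j\<le>Suc i. t ^ j * f j x)" .
    qed
    finally show "(\<lambda>x. \<Sum>j\<le>Suc i. t ^ j * f j x) \<in> fun_space.span (powers_of_positive k K)" .
  qed simp
  then have "(\<lambda>x. 1 / real (Suc i) * f 1 x) \<in> fun_space.span (powers_of_positive k K)"
    by (rule fun_space.span_scale)
  moreover have "(\<lambda>x. 1 / real (Suc i) * f 1 x) = (\<lambda>x. a x ^ i * (\<Prod>l\<leftarrow>ls. l x))"
    by (simp add: fun_eq_iff f_def ls)
  ultimately show ?case by simp
qed

definition monomial :: "('d::finite \<Rightarrow> nat) \<Rightarrow> real^'d \<Rightarrow> real" where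
  "monomial \<beta> x = (\<Prod>i\<in>UNIV. x $ i ^ \<beta> i)"

lemma monomial_as_product:
  "\<exists>ls. length ls = mi_order \<beta> \<and> (\<forall>l\<in>set ls. affine_fun l) \<and> (\<forall>x. monomial \<beta> x = (\<Prod>l\<leftarrow>ls. l x))"
proof -
  have "\<exists>ls. length ls = (\<Sum>i\<in>A. \<beta> i) \<and> (\<forall>l\<in>set ls. affine_fun l) \<and> (\<forall>x. (\<Prod>i\<in>A. x $ i ^ \<beta> i) = (\<Prod>l\<leftarrow>ls. l x))"
    if "finite A" for A
    using that
  proof (induction A)
    case (insert i A)
    then obtain ls where ls: "length ls = (\<Sum>i\<in>A. \<beta> i)" "\<forall>l\<in>set ls. affine_fun l" "\<forall>x. (\<Prod>i\<in>A. x $ i ^ \<beta> i) = (\<Prod>l\<leftarrow>ls. l x)"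
      by blast
    show ?case
      using insert ls by (intro exI[of _ "replicate (\<beta> i) (\<lambda>x. x $ i) @ ls"])
        (auto simp: affine_fun_coord prod_list_replicate)
  qed simp
  from this[of UNIV] show ?thesis by (simp add: mi_order_def monomial_def)
qed

text \<open>A monomial is padded with factors \<open>1\<close> to a product of \<open>k\<close> factors.\<close>

lemma monomial_in_span_powers:
  assumes "bounded K" "mi_order \<beta> \<le> k"
  shows "monomial \<beta> \<in> fun_space.span (powers_of_positive k K)"
proof -
  obtain ls where ls: "length ls = mi_order \<beta>" "\<forall>l\<in>set ls. affine_fun l" "\<forall>x. monomial \<beta> x = (\<Prod>l\<leftarrow>ls. l x)"
    using monomial_as_product by blast
  have "positive_affine K (\<lambda>_. 1)" by (auto simp: positive_affine_def affine_fun_const intro: exI[of _ 1])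
  from products_in_span_powers[OF assms(1) _ this ls(2), of "k - mi_order \<beta>" k]
  have "(\<lambda>x. \<Prod>l\<leftarrow>ls. l x) \<in> fun_space.span (powers_of_positive k K)" using assms(2) ls(1) by simp
  moreover have "monomial \<beta> = (\<lambda>x. \<Prod>l\<leftarrow>ls. l x)" using ls(3) by auto
  ultimately show ?thesis by simp
qed

lemma affine_power_in_span_monomials:
  fixes l :: "real^'d::finite \<Rightarrow> real"
  assumes "affine_fun l"
  shows "(\<lambda>x. l x ^ k) \<in> fun_space.span (monomial ` {\<beta>. mi_order \<beta> \<le> k})"
proof (induction k)
  case 0
  have eq: "monomial (\<lambda>_. 0) = (\<lambda>x. l x ^ 0)" by (auto simp: monomial_def)
  have "monomial (\<lambda>_. 0) \<in> monomial ` {\<beta> :: 'd \<Rightarrow> nat. mi_order \<beta> \<le> 0}" by (auto simp: mi_order_def)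
  from fun_space.span_base[OF this] show ?case unfolding eq .
next
  case (Suc k)
  obtain v c where l: "l = (\<lambda>x. v \<bullet> x + c)" using assms by (auto simp: affine_fun_def)
  let ?S = "\<lambda>k. fun_space.span (monomial ` {\<beta> :: 'd \<Rightarrow> nat. mi_order \<beta> \<le> k})"
  have mono: "?S k \<subseteq> ?S (Suc k)" by (intro fun_space.span_mono image_mono) auto
  have "(\<lambda>x. l x * g x) \<in> ?S (Suc k)" if "g \<in> ?S k" for g
    using that
  proof (induction rule: fun_space.span_induct_alt)
    case base
    have "(\<lambda>x. l x * (0 :: real^'d \<Rightarrow> real) x) = 0" by (simp add: fun_eq_iff)
    then show ?case by (simp add: fun_space.span_zero)
  next
    case (step a m g)
    then obtain \<beta> where \<beta>: "mi_order \<beta> \<le> k" "m = monomial \<beta>" by auto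
    have xi: "(\<lambda>x. x $ i * m x) \<in> ?S (Suc k)" for i
    proof -
      let ?b = "\<beta>(i := Suc (\<beta> i))"
      have "(\<lambda>x. x $ i * m x) = monomial ?b"
        unfolding \<beta>(2) monomial_def
        by (rule ext, subst (1 2) prod.remove[of UNIV i]) (auto intro!: prod.cong)
      moreover have "mi_order ?b = Suc (mi_order \<beta>)"
        unfolding mi_order_def by (subst (1 2) sum.remove[of UNIV i]) (auto intro!: sum.cong)
      ultimately show ?thesis using \<beta>(1) by (intro fun_space.span_base) (auto intro!: image_eqI[of _ _ ?b])
    qed
    have "m \<in> ?S (Suc k)" using \<beta> by (intro fun_space.span_base) auto
    then have "(\<Sum>i\<in>UNIV. (\<lambda>x. v $ i * (x $ i * m x))) + (\<lambda>x. c * m x) \<in> ?S (Suc k)"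
      by (intro fun_space.span_add fun_space.span_sum fun_space.span_scale[OF xi] fun_space.span_scale)
    moreover have "(\<Sum>i\<in>UNIV. (\<lambda>x. v $ i * (x $ i * m x))) + (\<lambda>x. c * m x) = (\<lambda>x. l x * m x)"
      by (simp add: fun_eq_iff sum_fun_apply l inner_vec_def algebra_simps sum_distrib_left)
    ultimately have "(\<lambda>x. a * (l x * m x)) + (\<lambda>x. l x * g x) \<in> ?S (Suc k)"
      using step by (intro fun_space.span_add fun_space.span_scale) auto
    moreover have "(\<lambda>x. a * (l x * m x)) + (\<lambda>x. l x * g x) = (\<lambda>x. l x * ((\<lambda>x. a * m x) + g) x)"
      by (simp add: fun_eq_iff algebra_simps)
    ultimately show ?case by simp
  qed
  from this[OF Suc.IH] show ?case by simp
qed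

text \<open>The slack \<open>k - mi_order \<beta>\<close> turns a multi-index into a list of length \<open>d + 1\<close> with sum \<open>k\<close>.\<close>

lemma card_mi_order_le: "card {\<beta> :: 'd::finite \<Rightarrow> nat. mi_order \<beta> \<le> k} \<le> (CARD('d) + k) choose CARD('d)"
proof -
  obtain e where e: "bij_betw e {0..<CARD('d)} (UNIV :: 'd set)" using ex_bij_betw_nat_finite[OF finite] by blast
  let ?L = "{l::nat list. length l = Suc (CARD('d)) \<and> sum_list l = k}"
  define \<Phi> where "\<Phi> \<beta> = (k - mi_order \<beta>) # map (\<lambda>j. \<beta> (e j)) [0..<CARD('d)]" for \<beta>
  have "card ?L = (k + CARD('d)) choose k" using card_length_sum_list[of "Suc (CARD('d))" k] by simp
  also have "\<dots> = (CARD('d) + k) choose CARD('d)"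
    using binomial_symmetric[of k "k + CARD('d)"] by (simp add: add.commute)
  finally have card: "card ?L = (CARD('d) + k) choose CARD('d)" .
  then have "card ?L > 0" by (simp add: zero_less_binomial)
  then have "finite ?L" by (rule card_ge_0_finite)
  moreover have "inj_on \<Phi> {\<beta>. mi_order \<beta> \<le> k}"
  proof (rule inj_onI)
    fix \<beta> \<gamma> assume "\<Phi> \<beta> = \<Phi> \<gamma>"
    then have "\<beta> (e j) = \<gamma> (e j)" if "j \<in> {0..<CARD('d)}" for j using that by (auto simp: \<Phi>_def)
    then show "\<beta> = \<gamma>" using e by (metis (no_types, lifting) ext UNIV_I bij_betw_imp_surj_on imageE)
  qed
  moreover have "\<Phi> ` {\<beta>. mi_order \<beta> \<le> k} \<subseteq> ?L"
  proof clarsimp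
    fix \<beta> :: "'d \<Rightarrow> nat" assume "mi_order \<beta> \<le> k"
    moreover have "(\<Sum>j\<leftarrow>[0..<CARD('d)]. \<beta> (e j)) = mi_order \<beta>"
      using sum.reindex_bij_betw[OF e, of \<beta>] by (simp add: mi_order_def sum_list_distinct_conv_sum_set)
    ultimately show "length (\<Phi> \<beta>) = Suc CARD('d) \<and> sum_list (\<Phi> \<beta>) = k" by (simp add: \<Phi>_def)
  qed
  ultimately have "card {\<beta> :: 'd \<Rightarrow> nat. mi_order \<beta> \<le> k} \<le> card ?L" using card_inj_on_le by blast
  then show ?thesis using card by simp
qed

text \<open>A maximal independent set of \<open>k\<close>-th powers spans all monomials, and it is no larger than the set of
  monomials of degree at most \<open>k\<close>, in whose span it lies. Missing terms are filled up with zero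
  coefficients.\<close>

lemma mpoly_as_sum_of_powers:
  fixes c :: "('d::finite \<Rightarrow> nat) \<Rightarrow> real^'m::finite"
  assumes "bounded K" and B: "B \<subseteq> {\<beta>. mi_order \<beta> \<le> k}"
  defines "M \<equiv> (CARD('d) + k) choose CARD('d)"
  shows "\<exists>l z. (\<forall>j<M. positive_affine K (l j)) \<and> (\<forall>x. mpoly_deriv B c (\<lambda>_. 0) x = (\<Sum>j<M. l j x ^ k *\<^sub>R z j))"
proof -
  let ?Mo = "monomial ` {\<beta> :: 'd \<Rightarrow> nat. mi_order \<beta> \<le> k}"
  have finMo: "finite ?Mo" by (intro finite_imageI finite_mi_order_le)
  obtain D where D: "D \<subseteq> powers_of_positive k K" "fun_space.independent D" "powers_of_positive k K \<subseteq> fun_space.span D"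
    using fun_space.maximal_independent_subset by blast
  have "powers_of_positive k K \<subseteq> fun_space.span ?Mo"
    by (auto simp: powers_of_positive_def positive_affine_def intro: affine_power_in_span_monomials)
  then have "D \<subseteq> fun_space.span ?Mo" using D(1) by blast
  then have finD: "finite D" and "card D \<le> card ?Mo" using fun_space.independent_span_bound[OF finMo D(2)] by auto
  then have cardD: "card D \<le> M"
    using card_image_le[OF finite_mi_order_le[where 'd = 'd], of monomial k] card_mi_order_le[where 'd = 'd, of k] unfolding M_def by linarith
  have "\<exists>u. \<forall>x. monomial \<beta> x = (\<Sum>f\<in>D. u f * f x)" if "\<beta> \<in> B" for \<beta>
  proof -
    have "mi_order \<beta> \<le> k" using B that by auto
    then have "monomial \<beta> \<in> fun_space.span (powers_of_positive k K)" by (rule monomial_in_span_powers[OF assms(1)])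
    also have "\<dots> \<subseteq> fun_space.span D" using D(3) fun_space.span_minimal fun_space.subspace_span by blast
    finally show ?thesis
      unfolding fun_space.span_finite[OF finD] by (auto simp: sum_fun_apply)
  qed
  then obtain u where u: "\<And>\<beta> x. \<beta> \<in> B \<Longrightarrow> monomial \<beta> x = (\<Sum>f\<in>D. u \<beta> f * f x)" by metis
  obtain e where e: "bij_betw e {0..<card D} D" using ex_bij_betw_nat_finite[OF finD] by blast
  have "\<exists>l. positive_affine K l \<and> f = (\<lambda>x. l x ^ k)" if "f \<in> D" for f
    using D(1) that by (auto simp: powers_of_positive_def)
  then obtain L where L: "\<And>f. f \<in> D \<Longrightarrow> positive_affine K (L f)" "\<And>f. f \<in> D \<Longrightarrow> f = (\<lambda>x. L f x ^ k)" by metis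
  define l where "l j = (if j < card D then L (e j) else (\<lambda>_. 1))" for j
  define z where "z j = (if j < card D then (\<Sum>\<beta>\<in>B. u \<beta> (e j) *\<^sub>R c \<beta>) else 0)" for j
  show ?thesis
  proof (intro exI[of _ l] exI[of _ z] conjI allI impI)
    fix j assume "j < M"
    have "e j \<in> D" if "j < card D" using bij_betwE[OF e] that by auto
    then show "positive_affine K (l j)"
      using L(1) by (auto simp: l_def positive_affine_def affine_fun_const intro: exI[of _ 1])
  next
    fix x
    have "mpoly_deriv B c (\<lambda>_. 0) x = (\<Sum>\<beta>\<in>B. (\<Sum>f\<in>D. u \<beta> f * f x) *\<^sub>R c \<beta>)"
      unfolding mpoly_deriv_def mono_deriv_0 using u by (intro sum.cong) (auto simp: monomial_def)
    also have "\<dots> = (\<Sum>\<beta>\<in>B. \<Sum>f\<in>D. f x *\<^sub>R (u \<beta> f *\<^sub>R c \<beta>))" by (simp add: scaleR_sum_left mult.commute)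
    also have "\<dots> = (\<Sum>f\<in>D. \<Sum>\<beta>\<in>B. f x *\<^sub>R (u \<beta> f *\<^sub>R c \<beta>))" by (rule sum.swap)
    also have "\<dots> = (\<Sum>f\<in>D. f x *\<^sub>R (\<Sum>\<beta>\<in>B. u \<beta> f *\<^sub>R c \<beta>))" by (simp add: scaleR_sum_right)
    also have "\<dots> = (\<Sum>j\<in>{0..<card D}. e j x *\<^sub>R (\<Sum>\<beta>\<in>B. u \<beta> (e j) *\<^sub>R c \<beta>))"
      by (rule sum.reindex_bij_betw[OF e, symmetric])
    also have "\<dots> = (\<Sum>j\<in>{0..<card D}. l j x ^ k *\<^sub>R z j)"
    proof (rule sum.cong[OF refl])
      fix j assume j: "j \<in> {0..<card D}"
      then have "e j \<in> D" using bij_betwE[OF e] by auto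
      then have "e j x = l j x ^ k" using L(2)[of "e j"] j unfolding l_def by (metis atLeastLessThan_iff)
      then show "e j x *\<^sub>R (\<Sum>\<beta>\<in>B. u \<beta> (e j) *\<^sub>R c \<beta>) = l j x ^ k *\<^sub>R z j" using j by (simp add: z_def)
    qed
    also have "\<dots> = (\<Sum>j<M. l j x ^ k *\<^sub>R z j)"
      using cardD by (intro sum.mono_neutral_left) (auto simp: z_def)
    finally show "mpoly_deriv B c (\<lambda>_. 0) x = (\<Sum>j<M. l j x ^ k *\<^sub>R z j)" .
  qed
qed

section \<open>Simplices and their facet hyperplanes\<close>

lemma hyperplane_eq_imp_scaled:
  fixes a A :: "'a::euclidean_space"
  assumes "{x. a \<bullet> x = c} = {x. A \<bullet> x = B}" "a \<noteq> 0" "A \<noteq> 0"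
  obtains s where "s \<noteq> 0" "a = s *\<^sub>R A" "c = s * B"
proof -
  define x0 where "x0 = (B / (A \<bullet> A)) *\<^sub>R A"
  have x0: "A \<bullet> x0 = B" using assms(3) by (simp add: x0_def)
  then have ax0: "a \<bullet> x0 = c" using assms(1) by blast
  define s where "s = (a \<bullet> A) / (A \<bullet> A)"
  define y where "y = a - s *\<^sub>R A"
  have Ay: "A \<bullet> y = 0" using assms(3) by (simp add: y_def s_def inner_diff_right inner_commute)
  then have "A \<bullet> (x0 + y) = B" by (simp add: inner_add_right x0)
  then have "a \<bullet> (x0 + y) = c" using assms(1) by blast
  then have "a \<bullet> y = 0" using ax0 by (simp add: inner_add_right)
  then have "y \<bullet> y = 0" using Ay by (simp add: y_def inner_diff_left)
  then have a: "a = s *\<^sub>R A" by (simp add: y_def)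
  then have "s \<noteq> 0" using assms(2) by auto
  moreover have "c = s * B" using ax0 x0 a by simp
  ultimately show thesis using that a by blast
qed

text \<open>The simplex as an intersection of halfspaces whose boundaries are exactly the facet hyperplanes.\<close>

definition facet_description ::
    "(real^'d::finite) set \<Rightarrow> (real^'d) set set \<Rightarrow> ((real^'d) set \<Rightarrow> real^'d) \<Rightarrow> ((real^'d) set \<Rightarrow> real) \<Rightarrow> bool" where
  "facet_description \<tau> F a b \<longleftrightarrow>
     finite F \<and> (\<forall>h\<in>F. a h \<noteq> 0) \<and> \<tau> = {x. \<forall>h\<in>F. a h \<bullet> x < b h} \<and>
     closure \<tau> = {x. \<forall>h\<in>F. a h \<bullet> x \<le> b h} \<and>
     {affine hull C |C. C facet_of closure \<tau>} = (\<lambda>h. {x. a h \<bullet> x = b h}) ` F"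

lemma open_simplex_structure:
  fixes \<tau> :: "(real^'d::finite) set"
  assumes "open_simplex \<tau>"
  shows "open \<tau>" "convex \<tau>" "bounded \<tau>" "\<tau> \<noteq> {}"
    and "\<exists>F a b. facet_description \<tau> F a b"
proof -
  obtain S where S: "int CARD('d) simplex S" "\<tau> = interior S" using assms by (auto simp: open_simplex_def)
  have poly: "polytope S" by (rule simplex_imp_polytope[OF S(1)])
  have dim: "aff_dim S = int DIM(real^'d)" using aff_dim_simplex[OF S(1)] by simp
  then have hull: "affine hull S = UNIV" by (simp only: aff_dim_eq_full)
  have cv: "convex S" and bd: "bounded S" and cl: "closed S"
    using poly by (auto simp: polytope_imp_convex polytope_imp_bounded polytope_imp_closed)
  have ri: "rel_interior S = \<tau>" using rel_interior_interior[OF hull] S(2) by simp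
  have "S \<noteq> {}" using hull by (metis affine_hull_empty UNIV_not_empty)
  then show "\<tau> \<noteq> {}" using rel_interior_eq_empty[OF cv] ri by simp
  show "open \<tau>" "convex \<tau>" unfolding S(2) using cv by (auto simp: convex_interior)
  show "bounded \<tau>" unfolding S(2) using bd interior_subset by (rule bounded_subset)
  have cS: "closure \<tau> = S" using convex_closure_rel_interior[OF cv] ri cl by simp
  obtain F where F: "finite F" "S = affine hull S \<inter> \<Inter>F"
    and Fh: "\<forall>h\<in>F. \<exists>a b. a \<noteq> 0 \<and> h = {x. a \<bullet> x \<le> b}"
    and Fmin: "\<And>F'. F' \<subset> F \<Longrightarrow> S \<subset> affine hull S \<inter> \<Inter>F'"
    using polytope_imp_polyhedron[OF poly] unfolding polyhedron_Int_affine_minimal by blast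
  obtain a b where ab: "\<And>h. h \<in> F \<Longrightarrow> a h \<noteq> 0 \<and> h = {x. a h \<bullet> x \<le> b h}" using Fh by metis
  have SF: "S = {x. \<forall>h\<in>F. a h \<bullet> x \<le> b h}" using F(2) ab unfolding hull by auto
  have \<tau>F: "\<tau> = {x. \<forall>h\<in>F. a h \<bullet> x < b h}"
    using rel_interior_polyhedron_explicit[OF F ab Fmin] ri SF by (auto simp: less_imp_le)
  have facets: "C facet_of S \<longleftrightarrow> (\<exists>h. h \<in> F \<and> C = S \<inter> {x. a h \<bullet> x = b h})" for C
    by (rule facet_of_polyhedron_explicit[OF F ab Fmin])
  have aff: "affine hull (S \<inter> {x. a h \<bullet> x = b h}) = {x. a h \<bullet> x = b h}" if "h \<in> F" for h
  proof (rule affine_dim_equal)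
    have fac: "(S \<inter> {x. a h \<bullet> x = b h}) facet_of S" using facets that by blast
    then have d: "aff_dim (S \<inter> {x. a h \<bullet> x = b h}) = aff_dim S - 1" "S \<inter> {x. a h \<bullet> x = b h} \<noteq> {}"
      by (auto simp: facet_of_def)
    show "affine (affine hull (S \<inter> {x. a h \<bullet> x = b h}))" by simp
    show "affine {x. a h \<bullet> x = b h}" by (rule affine_hyperplane)
    show "affine hull (S \<inter> {x. a h \<bullet> x = b h}) \<noteq> {}" using d(2) by simp
    show "affine hull (S \<inter> {x. a h \<bullet> x = b h}) \<subseteq> {x. a h \<bullet> x = b h}"
      by (rule hull_minimal) (auto simp: affine_hyperplane)
    show "aff_dim (affine hull (S \<inter> {x. a h \<bullet> x = b h})) = aff_dim {x. a h \<bullet> x = b h}"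
      using ab[OF that] by (simp add: d(1) dim aff_dim_hyperplane)
  qed
  have facets_eq: "{affine hull C |C. C facet_of S} = (\<lambda>h. {x. a h \<bullet> x = b h}) ` F"
    using aff unfolding facets by (auto simp: image_iff)
  show "\<exists>F a b. facet_description \<tau> F a b"
    unfolding facet_description_def cS
    by (intro exI[of _ F] exI[of _ a] exI[of _ b] conjI F(1) \<tau>F SF facets_eq) (use ab in blast)
qed

text \<open>A vector orthogonal to all normals would be the direction of a line contained in the set.\<close>

lemma span_normals_of_bounded:
  fixes a :: "'h \<Rightarrow> 'a::euclidean_space"
  assumes "bounded {x. \<forall>h\<in>F. a h \<bullet> x < b h}" "{x. \<forall>h\<in>F. a h \<bullet> x < b h} \<noteq> {}"
  shows "span (a ` F) = UNIV"
proof (rule ccontr)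
  assume "span (a ` F) \<noteq> UNIV"
  then obtain y where y: "y \<noteq> 0" "\<And>v. v \<in> span (a ` F) \<Longrightarrow> y \<bullet> v = 0" using span_not_UNIV_orthogonal by metis
  obtain x where x: "\<forall>h\<in>F. a h \<bullet> x < b h" using assms(2) by blast
  obtain R where R: "\<And>z. \<forall>h\<in>F. a h \<bullet> z < b h \<Longrightarrow> norm z \<le> R" using assms(1) by (auto simp: bounded_iff)
  define t where "t = (R + norm x + 1) / norm y"
  have "a h \<bullet> y = 0" if "h \<in> F" for h using y(2)[of "a h"] that by (simp add: span_base inner_commute)
  then have "\<forall>h\<in>F. a h \<bullet> (x + t *\<^sub>R y) < b h" using x by (simp add: inner_add_right)
  then have "norm (x + t *\<^sub>R y) \<le> R" by (rule R)
  moreover have "norm (t *\<^sub>R y) = R + norm x + 1"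
  proof -
    have "R + norm x + 1 > 0" using R[OF x] norm_ge_zero[of x] by linarith
    then show ?thesis using y(1) by (simp add: t_def abs_of_pos)
  qed
  moreover have "norm (t *\<^sub>R y) \<le> norm (x + t *\<^sub>R y) + norm x"
    using norm_triangle_ineq4[of "x + t *\<^sub>R y" x] by simp
  ultimately show False by linarith
qed

section \<open>Networks\<close>

text \<open>The inputs that a neuron of the second layer can receive from the first layer.\<close>

definition first_layer :: "nat \<Rightarrow> (nat \<Rightarrow> real^'d::finite) \<Rightarrow> (nat \<Rightarrow> real) \<Rightarrow> (real^'d \<Rightarrow> real) set" where
  "first_layer n W b = {f. \<exists>w0 w1 c. \<forall>x. f x =
     (\<Sum>i<n. w0 i * rho 0 (W i \<bullet> x + b i)) + (\<Sum>i<n. w1 i * rho 1 (W i \<bullet> x + b i)) + c}"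

lemma first_layer_const: "(\<lambda>x. c) \<in> first_layer n W b"
  unfolding first_layer_def by (intro CollectI exI[of _ "\<lambda>_. 0"] exI[of _ c]) simp

lemma first_layer_add:
  assumes "f \<in> first_layer n W b" "g \<in> first_layer n W b"
  shows "(\<lambda>x. f x + g x) \<in> first_layer n W b"
proof -
  obtain w0 w1 c where f: "\<And>x. f x = (\<Sum>i<n. w0 i * rho 0 (W i \<bullet> x + b i)) + (\<Sum>i<n. w1 i * rho 1 (W i \<bullet> x + b i)) + c"
    using assms(1) by (auto simp: first_layer_def)
  obtain w0' w1' c' where g: "\<And>x. g x = (\<Sum>i<n. w0' i * rho 0 (W i \<bullet> x + b i)) + (\<Sum>i<n. w1' i * rho 1 (W i \<bullet> x + b i)) + c'"
    using assms(2) by (auto simp: first_layer_def)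
  show ?thesis
    unfolding first_layer_def
    by (intro CollectI exI[of _ "\<lambda>i. w0 i + w0' i"] exI[of _ "\<lambda>i. w1 i + w1' i"] exI[of _ "c + c'"])
       (simp add: f g distrib_right sum.distrib)
qed

lemma first_layer_scale:
  assumes "f \<in> first_layer n W b"
  shows "(\<lambda>x. s * f x) \<in> first_layer n W b"
proof -
  obtain w0 w1 c where f: "\<And>x. f x = (\<Sum>i<n. w0 i * rho 0 (W i \<bullet> x + b i)) + (\<Sum>i<n. w1 i * rho 1 (W i \<bullet> x + b i)) + c"
    using assms(1) by (auto simp: first_layer_def)
  show ?thesis
    unfolding first_layer_def
    by (intro CollectI exI[of _ "\<lambda>i. s * w0 i"] exI[of _ "\<lambda>i. s * w1 i"] exI[of _ "s * c"])
       (simp add: f distrib_left sum_distrib_left mult.assoc)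
qed

lemma first_layer_sum:
  assumes "\<And>h. h \<in> F \<Longrightarrow> f h \<in> first_layer n W b"
  shows "(\<lambda>x. \<Sum>h\<in>F. f h x) \<in> first_layer n W b"
  using assms
  by (induction F rule: infinite_finite_induct) (auto simp: first_layer_const first_layer_add)

lemma first_layer_unit:
  assumes "i < n"
  shows "(\<lambda>x. rho 0 (W i \<bullet> x + b i)) \<in> first_layer n W b" "(\<lambda>x. rho 1 (W i \<bullet> x + b i)) \<in> first_layer n W b"
proof -
  have single: "(\<Sum>j<n. (if j = i then 1 else 0) * g j) = g i" for g :: "nat \<Rightarrow> real"
    using assms by (simp add: if_distrib[of "\<lambda>z. z * _"] cong: if_cong)
  show "(\<lambda>x. rho 0 (W i \<bullet> x + b i)) \<in> first_layer n W b"
    unfolding first_layer_def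
    by (intro CollectI exI[of _ "\<lambda>j. if j = i then 1 else 0"] exI[of _ "\<lambda>_. 0"] exI[of _ 0]) (simp add: single)
  show "(\<lambda>x. rho 1 (W i \<bullet> x + b i)) \<in> first_layer n W b"
    unfolding first_layer_def
    by (intro CollectI exI[of _ "\<lambda>_. 0"] exI[of _ "\<lambda>j. if j = i then 1 else 0"] exI[of _ 0]) (simp add: single)
qed

lemma rho_1_difference: "rho 1 t - rho 1 (- t) = t"
  by (auto simp: rho_def)

lemma rho_0_scale: "s > 0 \<Longrightarrow> rho 0 (s * t) = rho 0 t"
  by (auto simp: rho_def zero_less_mult_iff)

text \<open>Each hyperplane has one neuron for either side. The activation \<open>rho 0\<close> does not see a positive factor
  in the equation of the hyperplane, hence a hyperplane shared by several elements needs only one pair of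
  neurons. The difference of both \<open>rho 1\<close> outputs is the affine function itself.\<close>

lemma first_layer_for_hyperplanes:
  fixes Hs :: "(real^'d::finite) set set"
  assumes "finite Hs" "\<And>H. H \<in> Hs \<Longrightarrow> \<exists>a b. a \<noteq> 0 \<and> H = {x. a \<bullet> x = b}"
  obtains W b where
    "\<And>a c. a \<noteq> 0 \<Longrightarrow> {x. a \<bullet> x = c} \<in> Hs \<Longrightarrow> (\<lambda>x. rho 0 (a \<bullet> x - c)) \<in> first_layer (2 * card Hs) W b"
    "\<And>a c. a \<noteq> 0 \<Longrightarrow> {x. a \<bullet> x = c} \<in> Hs \<Longrightarrow> (\<lambda>x. a \<bullet> x) \<in> first_layer (2 * card Hs) W b"
proof -
  define n where "n = card Hs"
  obtain A B where AB: "\<And>H. H \<in> Hs \<Longrightarrow> A H \<noteq> 0 \<and> H = {x. A H \<bullet> x = B H}" using assms(2) by metis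
  obtain e where e: "bij_betw e {0..<n} Hs" using ex_bij_betw_nat_finite[OF assms(1), folded n_def] by (elim exE) (rule that)
  \<comment> \<open>The first \<open>n\<close> neurons look at one side of the hyperplanes, the others at the opposite side.\<close>
  define W where "W i = (if i < n then A (e i) else - A (e (i - n)))" for i
  define b where "b i = (if i < n then - B (e i) else B (e (i - n)))" for i
  have unit: "(\<lambda>x. rho 0 (A H \<bullet> x - B H)) \<in> first_layer (2 * n) W b"
    "(\<lambda>x. rho 0 (B H - A H \<bullet> x)) \<in> first_layer (2 * n) W b"
    "(\<lambda>x. rho 1 (A H \<bullet> x - B H)) \<in> first_layer (2 * n) W b"
    "(\<lambda>x. rho 1 (B H - A H \<bullet> x)) \<in> first_layer (2 * n) W b" if "H \<in> Hs" for H
  proof -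
    have "H \<in> e ` {0..<n}" using that bij_betw_imp_surj_on[OF e] by simp
    then obtain i where i: "i < n" "e i = H" by auto
    have "i < 2 * n" "n + i < 2 * n" using i by auto
    note first_layer_unit[OF this(1), of W b] first_layer_unit[OF this(2), of W b]
    moreover have "W i \<bullet> x + b i = A H \<bullet> x - B H" "W (n + i) \<bullet> x + b (n + i) = B H - A H \<bullet> x" for x
      using i by (auto simp: W_def b_def)
    ultimately show "(\<lambda>x. rho 0 (A H \<bullet> x - B H)) \<in> first_layer (2 * n) W b"
      "(\<lambda>x. rho 0 (B H - A H \<bullet> x)) \<in> first_layer (2 * n) W b"
      "(\<lambda>x. rho 1 (A H \<bullet> x - B H)) \<in> first_layer (2 * n) W b"
      "(\<lambda>x. rho 1 (B H - A H \<bullet> x)) \<in> first_layer (2 * n) W b" by simp_all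
  qed
  have main: "(\<lambda>x. rho 0 (a \<bullet> x - c)) \<in> first_layer (2 * n) W b \<and> (\<lambda>x. a \<bullet> x) \<in> first_layer (2 * n) W b"
    if H: "a \<noteq> 0" "{x. a \<bullet> x = c} \<in> Hs" for a c
  proof -
    let ?H = "{x. a \<bullet> x = c}"
    obtain s where s: "s \<noteq> 0" "a = s *\<^sub>R A ?H" "c = s * B ?H"
      using hyperplane_eq_imp_scaled[of a c "A ?H" "B ?H"] AB[OF H(2)] H(1) by blast
    have eq: "a \<bullet> x - c = s * (A ?H \<bullet> x - B ?H)" for x
    proof -
      have "a \<bullet> x = s * (A ?H \<bullet> x)" by (subst s(2)) simp
      moreover have "c = s * B ?H" by (rule s(3))
      ultimately show ?thesis unfolding right_diff_distrib by linarith
    qed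
    have "(\<lambda>x. rho 0 (a \<bullet> x - c)) \<in> first_layer (2 * n) W b"
    proof (cases "s > 0")
      case True
      then show ?thesis using unit(1)[OF H(2)] unfolding eq by (simp add: rho_0_scale)
    next
      case False
      have "s * (A ?H \<bullet> x - B ?H) = (- s) * (B ?H - A ?H \<bullet> x)" for x by (simp add: algebra_simps)
      then have "rho 0 (a \<bullet> x - c) = rho 0 (B ?H - A ?H \<bullet> x)" for x
        unfolding eq using rho_0_scale[of "- s"] False s(1) by simp
      then show ?thesis using unit(2)[OF H(2)] by simp
    qed
    moreover have "(\<lambda>x. a \<bullet> x) \<in> first_layer (2 * n) W b"
    proof -
      have eqf: "(\<lambda>x. s * (rho 1 (A ?H \<bullet> x - B ?H) + (- 1) * rho 1 (B ?H - A ?H \<bullet> x)) + c) = (\<lambda>x. a \<bullet> x)"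
      proof
        fix x
        show "s * (rho 1 (A ?H \<bullet> x - B ?H) + (- 1) * rho 1 (B ?H - A ?H \<bullet> x)) + c = a \<bullet> x"
          using eq[of x] rho_1_difference[of "A ?H \<bullet> x - B ?H"] by simp
      qed
      have "(\<lambda>x. s * (rho 1 (A ?H \<bullet> x - B ?H) + (- 1) * rho 1 (B ?H - A ?H \<bullet> x)) + c) \<in> first_layer (2 * n) W b"
        by (intro first_layer_add first_layer_scale first_layer_const unit H)
      then show ?thesis unfolding eqf .
    qed
    ultimately show ?thesis by blast
  qed
  show thesis
    by (rule that[of W b]) (use main n_def in auto)
qed

text \<open>The input is \<open>l - B v\<close>, where \<open>v\<close> is the number of facet inequalities that are strictly violated. It is
  \<open>l\<close> on the simplex and at most \<open>0\<close> at points of the domain outside its closure. The normals of a simplex span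
  the space, so its own hyperplanes suffice to represent \<open>l\<close>.\<close>

lemma first_layer_gate:
  fixes \<tau> :: "(real^'d::finite) set"
  assumes \<tau>: "open_simplex \<tau>"
    and sides: "\<And>a c. a \<noteq> 0 \<Longrightarrow> {x. a \<bullet> x = c} \<in> {affine hull C |C. C facet_of closure \<tau>} \<Longrightarrow>
      (\<lambda>x. rho 0 (a \<bullet> x - c)) \<in> first_layer n W b"
    and lin: "\<And>a c. a \<noteq> 0 \<Longrightarrow> {x. a \<bullet> x = c} \<in> {affine hull C |C. C facet_of closure \<tau>} \<Longrightarrow>
      (\<lambda>x. a \<bullet> x) \<in> first_layer n W b"
    and l: "affine_fun l" and pos: "\<And>x. x \<in> \<tau> \<Longrightarrow> l x > 0" and bd: "\<And>x. x \<in> \<Omega> \<Longrightarrow> l x \<le> B" "B \<ge> 0"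
  shows "\<exists>g\<in>first_layer n W b. \<forall>x. (x \<in> \<tau> \<longrightarrow> rho k (g x) = l x ^ k) \<and>
    (x \<in> \<Omega> - closure \<tau> \<longrightarrow> rho k (g x) = 0)"
proof -
  obtain F a c where "facet_description \<tau> F a c" using open_simplex_structure(5)[OF \<tau>] by blast
  then have F: "finite F" "\<forall>h\<in>F. a h \<noteq> 0" "\<tau> = {x. \<forall>h\<in>F. a h \<bullet> x < c h}"
    "closure \<tau> = {x. \<forall>h\<in>F. a h \<bullet> x \<le> c h}"
    "{affine hull C |C. C facet_of closure \<tau>} = (\<lambda>h. {x. a h \<bullet> x = c h}) ` F"
    unfolding facet_description_def by blast+
  have normals: "span (a ` F) = UNIV"
    using open_simplex_structure(3,4)[OF \<tau>] F(3) by (intro span_normals_of_bounded[of F a c]) auto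
  obtain v d where lv: "l = (\<lambda>x. v \<bullet> x + d)" using l by (auto simp: affine_fun_def)
  have "v \<in> span (a ` F)" using normals by simp
  then have "(\<lambda>x. v \<bullet> x) \<in> first_layer n W b"
  proof (induction rule: span_induct_alt)
    case base
    then show ?case by (simp add: first_layer_const)
  next
    case (step s y z)
    then obtain h where h: "h \<in> F" "y = a h" by auto
    have "(\<lambda>x. y \<bullet> x) \<in> first_layer n W b" unfolding h(2) by (rule lin[of _ "c h"]) (use F(2,5) h in auto)
    then have "(\<lambda>x. s * (y \<bullet> x) + z \<bullet> x) \<in> first_layer n W b" using step by (intro first_layer_add first_layer_scale)
    then show ?case by (simp add: inner_add_left)
  qed
  then have lfl: "l \<in> first_layer n W b" unfolding lv by (intro first_layer_add first_layer_const)
  define viol where "viol x = (\<Sum>h\<in>F. rho 0 (a h \<bullet> x - c h))" for x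
  have vfl: "viol \<in> first_layer n W b"
    unfolding viol_def by (intro first_layer_sum sides) (use F(2,5) in auto)
  have vin: "viol x = 0" if "x \<in> \<tau>" for x
    unfolding viol_def by (rule sum.neutral) (use that F(3) in \<open>auto simp: rho_def\<close>)
  have vout: "viol x \<ge> 1" if out: "x \<notin> closure \<tau>" for x
  proof -
    obtain h where h: "h \<in> F" "a h \<bullet> x > c h" using out unfolding F(4) by (auto simp: not_le)
    have "1 = rho 0 (a h \<bullet> x - c h)" using h by (simp add: rho_def)
    also have "\<dots> \<le> viol x" unfolding viol_def using h F(1) by (intro member_le_sum) (auto simp: rho_def)
    finally show ?thesis .
  qed
  show ?thesis
  proof (intro bexI[of _ "\<lambda>x. l x + (- B) * viol x"] allI conjI impI)
    show "(\<lambda>x. l x + (- B) * viol x) \<in> first_layer n W b" by (intro first_layer_add first_layer_scale lfl vfl)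
  next
    fix x assume x: "x \<in> \<tau>"
    show "rho k (l x + (- B) * viol x) = l x ^ k" using vin[OF x] pos[OF x] by (simp add: rho_def)
  next
    fix x assume x: "x \<in> \<Omega> - closure \<tau>"
    have "B * 1 \<le> B * viol x" using vout x bd(2) by (intro mult_left_mono) auto
    then have "l x + (- B) * viol x \<le> 0" using bd(1)[of x] x by simp
    then show "rho k (l x + (- B) * viol x) = 0" by (simp add: rho_def max_def power_0_left)
  qed
qed

lemma NN_I:
  assumes "finite J" "card J = n2" "\<And>j. j \<in> J \<Longrightarrow> g j \<in> first_layer n1 W b"
  shows "(\<lambda>x. \<Sum>j\<in>J. rho k (g j x) *\<^sub>R z j) \<in> NN k n1 n2"
proof -
  have "\<forall>j\<in>J. \<exists>p. \<forall>x. g j x = (\<Sum>i<n1. fst p i * rho 0 (W i \<bullet> x + b i)) +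
      (\<Sum>i<n1. fst (snd p) i * rho 1 (W i \<bullet> x + b i)) + snd (snd p)"
  proof
    fix j assume "j \<in> J"
    then obtain w0 w1 c where "\<forall>x. g j x =
        (\<Sum>i<n1. w0 i * rho 0 (W i \<bullet> x + b i)) + (\<Sum>i<n1. w1 i * rho 1 (W i \<bullet> x + b i)) + c"
      using assms(3)[OF \<open>j \<in> J\<close>] unfolding first_layer_def by blast
    then show "\<exists>p. \<forall>x. g j x = (\<Sum>i<n1. fst p i * rho 0 (W i \<bullet> x + b i)) +
      (\<Sum>i<n1. fst (snd p) i * rho 1 (W i \<bullet> x + b i)) + snd (snd p)"
      by (intro exI[of _ "(w0, w1, c)"]) simp
  qed
  from bchoice[OF this] obtain p where p: "\<forall>j\<in>J. \<forall>x. g j x = (\<Sum>i<n1. fst (p j) i * rho 0 (W i \<bullet> x + b i)) +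
      (\<Sum>i<n1. fst (snd (p j)) i * rho 1 (W i \<bullet> x + b i)) + snd (snd (p j))" by blast
  define w0 w1 c where "w0 j = fst (p j)" and "w1 j = fst (snd (p j))" and "c j = snd (snd (p j))" for j
  have g: "g j x = (\<Sum>i<n1. w0 j i * rho 0 (W i \<bullet> x + b i)) + (\<Sum>i<n1. w1 j i * rho 1 (W i \<bullet> x + b i)) + c j"
    if "j \<in> J" for j x
    using p that by (simp add: w0_def w1_def c_def)
  obtain e where e: "bij_betw e {0..<n2} J" using ex_bij_betw_nat_finite[OF assms(1), unfolded assms(2)] by (elim exE) (rule that)
  have "(\<Sum>j\<in>J. rho k (g j x) *\<^sub>R z j) = (\<Sum>j<n2. rho k ((\<Sum>i<n1. w0 (e j) i * rho 0 (W i \<bullet> x + b i)) +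
      (\<Sum>i<n1. w1 (e j) i * rho 1 (W i \<bullet> x + b i)) + c (e j)) *\<^sub>R z (e j))" for x
  proof -
    have "(\<Sum>j\<in>J. rho k (g j x) *\<^sub>R z j) = (\<Sum>j\<in>{0..<n2}. rho k (g (e j) x) *\<^sub>R z (e j))"
      by (rule sum.reindex_bij_betw[OF e, symmetric])
    also have "\<dots> = (\<Sum>j<n2. rho k ((\<Sum>i<n1. w0 (e j) i * rho 0 (W i \<bullet> x + b i)) +
      (\<Sum>i<n1. w1 (e j) i * rho 1 (W i \<bullet> x + b i)) + c (e j)) *\<^sub>R z (e j))"
    proof (rule sum.cong)
      fix j assume "j \<in> {..<n2}"
      then have "e j \<in> J" using bij_betwE[OF e] by auto
      then show "rho k (g (e j) x) *\<^sub>R z (e j) = rho k ((\<Sum>i<n1. w0 (e j) i * rho 0 (W i \<bullet> x + b i)) +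
        (\<Sum>i<n1. w1 (e j) i * rho 1 (W i \<bullet> x + b i)) + c (e j)) *\<^sub>R z (e j)" by (simp only: g)
    qed auto
    finally show ?thesis .
  qed
  then show ?thesis
    unfolding NN_def
    by (intro CollectI exI[of _ W] exI[of _ b] exI[of _ "\<lambda>j. w0 (e j)"] exI[of _ "\<lambda>j. w1 (e j)"]
        exI[of _ "\<lambda>j. c (e j)"] exI[of _ "\<lambda>j. z (e j)"] ext)
qed

text \<open>An element different from \<open>\<tau>\<close> is open and disjoint from \<open>\<tau>\<close>, hence disjoint from the closure of \<open>\<tau>\<close>. So
  only the neurons that belong to the element of \<open>x\<close> contribute at \<open>x\<close>.\<close>

lemma piecewise_polynomial_network:
  fixes T :: "(real^'d::finite) set set" and c :: "(real^'d) set \<Rightarrow> ('d \<Rightarrow> nat) \<Rightarrow> real^'m::finite"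
  assumes T: "finite T" "\<And>\<tau>. \<tau> \<in> T \<Longrightarrow> open_simplex \<tau>" "pairwise disjnt T" and B: "B \<subseteq> {\<beta>. mi_order \<beta> \<le> k}"
  shows "\<exists>\<N>\<in>NN k (2 * card (facet_hyperplanes T)) (((CARD('d) + k) choose CARD('d)) * card T).
    \<forall>\<tau>\<in>T. \<forall>x\<in>\<tau>. \<N> x = mpoly_deriv B (c \<tau>) (\<lambda>_. 0) x"
proof -
  define M where "M = (CARD('d) + k) choose CARD('d)"
  let ?Hs = "facet_hyperplanes T"
  have HsU: "?Hs = (\<Union>\<tau>\<in>T. {affine hull C |C. C facet_of closure \<tau>})" by (auto simp: facet_hyperplanes_def)
  have loc: "finite {affine hull C |C. C facet_of closure \<tau>} \<and>
      (\<forall>H\<in>{affine hull C |C. C facet_of closure \<tau>}. \<exists>a b. a \<noteq> 0 \<and> H = {x. a \<bullet> x = b})" if \<tau>: "\<tau> \<in> T" for \<tau>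
  proof -
    obtain F a b where "facet_description \<tau> F a b" using open_simplex_structure(5)[OF T(2)[OF \<tau>]] by blast
    then have "finite F" "\<forall>h\<in>F. a h \<noteq> 0"
      "{affine hull C |C. C facet_of closure \<tau>} = (\<lambda>h. {x. a h \<bullet> x = b h}) ` F"
      unfolding facet_description_def by blast+
    then show ?thesis by auto
  qed
  have "finite ?Hs" unfolding HsU using T(1) loc by blast
  moreover have "\<exists>a b. a \<noteq> 0 \<and> H = {x. a \<bullet> x = b}" if "H \<in> ?Hs" for H
    using that loc unfolding HsU by blast
  ultimately obtain W b where
    W: "\<And>a c. a \<noteq> 0 \<Longrightarrow> {x. a \<bullet> x = c} \<in> ?Hs \<Longrightarrow> (\<lambda>x. rho 0 (a \<bullet> x - c)) \<in> first_layer (2 * card ?Hs) W b"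
    "\<And>a c. a \<noteq> 0 \<Longrightarrow> {x. a \<bullet> x = c} \<in> ?Hs \<Longrightarrow> (\<lambda>x. a \<bullet> x) \<in> first_layer (2 * card ?Hs) W b"
    using first_layer_for_hyperplanes by blast
  have bddT: "bounded (\<Union>T)" using T(1,2) open_simplex_structure(3) by (intro bounded_Union) auto
  have "\<forall>\<tau>\<in>T. \<exists>l z. (\<forall>j<M. positive_affine \<tau> (l j)) \<and>
      (\<forall>x. mpoly_deriv B (c \<tau>) (\<lambda>_. 0) x = (\<Sum>j<M. l j x ^ k *\<^sub>R z j))"
    unfolding M_def using mpoly_as_sum_of_powers[OF open_simplex_structure(3)[OF T(2)] B] by blast
  then obtain l z where lz: "\<And>\<tau> j. \<tau> \<in> T \<Longrightarrow> j < M \<Longrightarrow> positive_affine \<tau> (l \<tau> j)"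
    "\<And>\<tau> x. \<tau> \<in> T \<Longrightarrow> mpoly_deriv B (c \<tau>) (\<lambda>_. 0) x = (\<Sum>j<M. l \<tau> j x ^ k *\<^sub>R z \<tau> j)" by metis
  have "\<exists>g\<in>first_layer (2 * card ?Hs) W b. \<forall>x. (x \<in> \<tau> \<longrightarrow> rho k (g x) = l \<tau> j x ^ k) \<and>
    (x \<in> \<Union>T - closure \<tau> \<longrightarrow> rho k (g x) = 0)" if "\<tau> \<in> T" "j < M" for \<tau> j
  proof -
    have aff: "affine_fun (l \<tau> j)" and pos: "\<And>x. x \<in> \<tau> \<Longrightarrow> l \<tau> j x > 0"
      using lz(1)[OF that] by (force simp: positive_affine_def)+
    obtain C where C: "C > 0" "\<And>x. x \<in> \<Union>T \<Longrightarrow> \<bar>l \<tau> j x\<bar> \<le> C" using affine_fun_bounded[OF aff bddT] by blast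
    have inHs: "H \<in> ?Hs" if "H \<in> {affine hull C |C. C facet_of closure \<tau>}" for H
      using that \<open>\<tau> \<in> T\<close> HsU by blast
    show ?thesis
    proof (rule first_layer_gate[OF T(2)[OF that(1)] _ _ aff pos])
      fix a :: "real^'d" and c
      assume a: "a \<noteq> 0" "{x. a \<bullet> x = c} \<in> {affine hull C |C. C facet_of closure \<tau>}"
      show "(\<lambda>x. rho 0 (a \<bullet> x - c)) \<in> first_layer (2 * card ?Hs) W b" by (rule W(1)[OF a(1) inHs[OF a(2)]])
      show "(\<lambda>x. a \<bullet> x) \<in> first_layer (2 * card ?Hs) W b" by (rule W(2)[OF a(1) inHs[OF a(2)]])
    next
      fix x assume "x \<in> \<Union>T"
      then show "l \<tau> j x \<le> C" using C(2)[of x] by linarith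
    qed (use C(1) in auto)
  qed
  then obtain g where g: "\<And>\<tau> j. \<tau> \<in> T \<Longrightarrow> j < M \<Longrightarrow> g \<tau> j \<in> first_layer (2 * card ?Hs) W b"
    "\<And>\<tau> j x. \<tau> \<in> T \<Longrightarrow> j < M \<Longrightarrow> x \<in> \<tau> \<Longrightarrow> rho k (g \<tau> j x) = l \<tau> j x ^ k"
    "\<And>\<tau> j x. \<tau> \<in> T \<Longrightarrow> j < M \<Longrightarrow> x \<in> \<Union>T - closure \<tau> \<Longrightarrow> rho k (g \<tau> j x) = 0" by metis
  define N where "N x = (\<Sum>p\<in>T \<times> {..<M}. rho k (g (fst p) (snd p) x) *\<^sub>R z (fst p) (snd p))" for x
  have "N \<in> NN k (2 * card ?Hs) (M * card T)"
    unfolding N_def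
    by (rule NN_I[of _ _ _ _ W b]) (use T(1) g(1) in \<open>auto simp: card_cartesian_product mult.commute\<close>)
  moreover have "N x = mpoly_deriv B (c \<tau>) (\<lambda>_. 0) x" if "\<tau> \<in> T" "x \<in> \<tau>" for \<tau> x
  proof -
    have "N x = (\<Sum>\<sigma>\<in>T. \<Sum>j<M. rho k (g \<sigma> j x) *\<^sub>R z \<sigma> j)"
      unfolding N_def by (simp add: sum.cartesian_product split_def)
    also have "\<dots> = (\<Sum>\<sigma>\<in>T. if \<sigma> = \<tau> then \<Sum>j<M. l \<tau> j x ^ k *\<^sub>R z \<tau> j else 0)"
    proof (rule sum.cong[OF refl])
      fix \<sigma> assume \<sigma>: "\<sigma> \<in> T"
      show "(\<Sum>j<M. rho k (g \<sigma> j x) *\<^sub>R z \<sigma> j) = (if \<sigma> = \<tau> then \<Sum>j<M. l \<tau> j x ^ k *\<^sub>R z \<tau> j else 0)"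
      proof (cases "\<sigma> = \<tau>")
        case True
        then show ?thesis using g(2) that by simp
      next
        case False
        then have "\<tau> \<inter> \<sigma> = {}" using T(3) \<sigma> that(1) by (auto simp: pairwise_def disjnt_def)
        then have "x \<notin> closure \<sigma>"
          using open_Int_closure_eq_empty[OF open_simplex_structure(1)[OF T(2)[OF that(1)]]] that(2) by blast
        then have "x \<in> \<Union>T - closure \<sigma>" using that by blast
        then have "rho k (g \<sigma> j x) = 0" if "j < M" for j using g(3)[OF \<sigma> that] by blast
        then show ?thesis using False by simp
      qed
    qed
    also have "\<dots> = mpoly_deriv B (c \<tau>) (\<lambda>_. 0) x" using T(1) that(1) lz(2) by simp
    finally show ?thesis .
  qed
  ultimately show ?thesis unfolding M_def by blast
qed

section \<open>Sobolev norms\<close>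

lemma mi_order_concentrated: "mi_order (\<lambda>j. if j = i then n else 0) = n"
  by (simp add: mi_order_def)

lemma sobolev_weak_deriv:
  fixes u :: "real^'d::finite \<Rightarrow> real^'m::finite"
  assumes U: "open U" and u: "u \<in> sobolev_space r p U" and "mi_order \<alpha> \<le> r"
  shows "is_weak_deriv U \<alpha> u (weak_deriv U \<alpha> u)" "weak_deriv U \<alpha> u \<in> lp_space p U"
proof -
  obtain w where w: "w \<in> lp_space p U" "is_weak_deriv U \<alpha> u w"
    using u assms(3) unfolding sobolev_space_def by blast
  show wd: "is_weak_deriv U \<alpha> u (weak_deriv U \<alpha> u)"
    unfolding weak_deriv_def by (rule someI[of _ w]) (rule w(2))
  have ae: "AE x in lebesgue_on U. w x = weak_deriv U \<alpha> u x" by (rule weak_deriv_unique[OF U w(2) wd])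
  have "weak_deriv U \<alpha> u \<in> borel_measurable (lebesgue_on U)"
    by (rule lebesgue_on_measurable_AE[OF U _ ae]) (use w(1) in \<open>simp add: lp_space_def\<close>)
  then show "weak_deriv U \<alpha> u \<in> lp_space p U" by (rule lp_space_cong_AE[OF w(1) _ ae])
qed

text \<open>The norm does not depend on the weak derivative picked by \<open>weak_deriv\<close>.\<close>

lemma lp_norm_weak_deriv:
  fixes u :: "real^'d::finite \<Rightarrow> real^'m::finite"
  assumes U: "open U" and w: "w \<in> lp_space p U" "is_weak_deriv U \<alpha> u w"
  shows "lp_norm p U (weak_deriv U \<alpha> u) = lp_norm p U w"
proof -
  have wd: "is_weak_deriv U \<alpha> u (weak_deriv U \<alpha> u)"
    unfolding weak_deriv_def by (rule someI[of _ w]) (rule w(2))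
  have ae: "AE x in lebesgue_on U. w x = weak_deriv U \<alpha> u x" by (rule weak_deriv_unique[OF U w(2) wd])
  have m: "w \<in> borel_measurable (lebesgue_on U)" using w(1) by (simp add: lp_space_def)
  show ?thesis
    by (rule lp_norm_cong_AE[OF m lebesgue_on_measurable_AE[OF U m ae] ae, symmetric])
qed

lemma is_weak_deriv_cong:
  fixes u :: "real^'d::finite \<Rightarrow> real^'m::finite"
  assumes "is_weak_deriv U \<alpha> u w" "\<And>x. x \<in> U \<Longrightarrow> u x = u' x"
  shows "is_weak_deriv U \<alpha> u' w"
  unfolding is_weak_deriv_def
proof (intro conjI allI impI)
  show "w locally_integrable_on U" using assms(1) by (simp add: is_weak_deriv_def)
  have "u locally_integrable_on U" using assms(1) by (simp add: is_weak_deriv_def)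
  moreover have "u absolutely_integrable_on K \<longleftrightarrow> u' absolutely_integrable_on K" if "K \<subseteq> U" for K
    unfolding set_integrable_def
    by (intro Bochner_Integration.integrable_cong refl) (use that assms(2) in \<open>auto simp: indicator_def\<close>)
  ultimately show "u' locally_integrable_on U" unfolding locally_integrable_on_def by blast
  fix \<phi> assume "test_function U \<phi>"
  moreover have "(LINT x|lebesgue_on U. multi_deriv \<alpha> \<phi> x *\<^sub>R u x) = (LINT x|lebesgue_on U. multi_deriv \<alpha> \<phi> x *\<^sub>R u' x)"
    by (intro Bochner_Integration.integral_cong refl) (use assms(2) in simp)
  ultimately show "(LINT x|lebesgue_on U. multi_deriv \<alpha> \<phi> x *\<^sub>R u' x) =
        (- 1) ^ mi_order \<alpha> *\<^sub>R (LINT x|lebesgue_on U. \<phi> x *\<^sub>R w x)"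
    using assms(1) by (simp add: is_weak_deriv_def)
qed

lemma lp_norm_infinity_subset:
  fixes f :: "real^'d::finite \<Rightarrow> real^'m::finite"
  assumes "open U" "open V" "V \<subseteq> U" "f \<in> lp_space \<infinity> U"
  shows "lp_norm \<infinity> V f \<le> lp_norm \<infinity> U f"
proof (rule lp_norm_infinity_le(2))
  show "f \<in> borel_measurable (lebesgue_on V)" using lp_space_subset[OF assms] by (simp add: lp_space_def)
  show "AE x in lebesgue_on V. norm (f x) \<le> lp_norm \<infinity> U f"
    using AE_lp_norm_bound[OF assms(4)] assms(1-3)
    by (auto simp: AE_restrict_space_iff elim!: eventually_mono)
qed (rule lp_norm_nonneg)

lemma lp_norm_powr_sum_disjoint:
  fixes f :: "real^'d::finite \<Rightarrow> real^'m::finite"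
  assumes "open U" "finite T" "\<And>V. V \<in> T \<Longrightarrow> open V \<and> V \<subseteq> U" "pairwise disjnt T"
    and p: "p = ereal q" "q \<ge> 1" and f: "f \<in> lp_space p U"
  shows "(\<Sum>V\<in>T. lp_norm p V f powr q) \<le> lp_norm p U f powr q"
proof -
  let ?g = "\<lambda>x. norm (f x) powr q"
  have int: "integrable lebesgue (\<lambda>x. indicator V x *\<^sub>R ?g x)" if "open V" "V \<subseteq> U" for V
  proof -
    have "integrable (lebesgue_on V) ?g"
      using lp_space_subset[OF assms(1) that f] p by (simp add: lp_space_def)
    then show ?thesis using that by (simp add: integrable_restrict_space)
  qed
  have norm: "lp_norm p V f powr q = (LINT x|lebesgue. indicator V x *\<^sub>R ?g x)" if "open V" for V
    using lp_norm_powr[of p V f] p that by (simp add: integral_restrict_space)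
  have "(\<Sum>V\<in>T. lp_norm p V f powr q) = (LINT x|lebesgue. (\<Sum>V\<in>T. indicator V x *\<^sub>R ?g x))"
    using assms(3) int by (subst Bochner_Integration.integral_sum) (auto simp: norm intro!: sum.cong)
  also have "\<dots> \<le> (LINT x|lebesgue. indicator U x *\<^sub>R ?g x)"
  proof (rule integral_mono)
    show "integrable lebesgue (\<lambda>x. \<Sum>V\<in>T. indicator V x *\<^sub>R ?g x)"
      using assms(3) int by (intro Bochner_Integration.integrable_sum) auto
    show "integrable lebesgue (\<lambda>x. indicator U x *\<^sub>R ?g x)" using assms(1) by (intro int) auto
    fix x
    show "(\<Sum>V\<in>T. indicator V x *\<^sub>R ?g x) \<le> indicator U x *\<^sub>R ?g x"
    proof (cases "\<exists>V0\<in>T. x \<in> V0")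
      case True
      then obtain V0 where V0: "V0 \<in> T" "x \<in> V0" by blast
      have "(\<Sum>V\<in>T. indicator V x *\<^sub>R ?g x) = (\<Sum>V\<in>T. if V = V0 then ?g x else 0)"
        using V0 assms(4) by (intro sum.cong) (auto simp: indicator_def pairwise_def disjnt_iff)
      also have "\<dots> = ?g x" using assms(2) V0(1) by simp
      also have "\<dots> = indicator U x *\<^sub>R ?g x" using assms(3)[OF V0(1)] V0(2) by (auto simp: indicator_def)
      finally show ?thesis by simp
    next
      case False
      then have "(\<Sum>V\<in>T. indicator V x *\<^sub>R ?g x) = 0" by (intro sum.neutral) auto
      then show ?thesis by simp
    qed
  qed
  also have "\<dots> = lp_norm p U f powr q" using norm[OF assms(1)] by simp
  finally show ?thesis .
qed

lemma powr_inverse_le: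
  assumes "x \<le> y powr q" "x \<ge> 0" "y \<ge> 0" "q \<ge> (1::real)"
  shows "x powr (1 / q) \<le> y"
proof -
  have "x powr (1 / q) \<le> (y powr q) powr (1 / q)" using assms by (intro powr_mono2) auto
  then show ?thesis using assms by (simp add: powr_powr)
qed

lemma sobolev_norm_le_sum:
  fixes f :: "real^'d::finite \<Rightarrow> real^'m::finite"
  assumes "1 \<le> p"
  shows "sobolev_norm s p U f \<le> (\<Sum>\<alpha> | mi_order \<alpha> \<le> s. lp_norm p U (weak_deriv U \<alpha> f))"
proof (cases "p = \<infinity>")
  case True
  have ne: "{\<alpha> :: 'd \<Rightarrow> nat. mi_order \<alpha> \<le> s} \<noteq> {}" using mi_order_concentrated[of undefined s] by (metis empty_Collect_eq order_refl)
  have "(MAX \<alpha>\<in>{\<alpha>. mi_order \<alpha> \<le> s}. lp_norm p U (weak_deriv U \<alpha> f)) \<le> (\<Sum>\<alpha> | mi_order \<alpha> \<le> s. lp_norm p U (weak_deriv U \<alpha> f))"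
    using ne finite_mi_order_le[where 'd = 'd, of s]
    by (intro Max.boundedI) (auto intro!: member_le_sum lp_norm_nonneg)
  then show ?thesis using True by (simp add: sobolev_norm_def)
next
  case False
  then obtain q where q: "p = ereal q" "q \<ge> 1" using assms by (cases p) auto
  then show ?thesis
    unfolding sobolev_norm_def using False
    by (auto intro!: powr_inverse_le sum_powr_le_powr_sum finite_mi_order_le sum_nonneg lp_norm_nonneg)
qed

lemma sobolev_norm_nonneg:
  fixes f :: "real^'d::finite \<Rightarrow> real^'m::finite"
  shows "sobolev_norm s p U f \<ge> 0"
proof (cases "p = \<infinity>")
  case True
  let ?\<alpha> = "(\<lambda>j. if j = undefined then s else 0) :: 'd \<Rightarrow> nat"
  have "0 \<le> lp_norm p U (weak_deriv U ?\<alpha> f)" by (rule lp_norm_nonneg)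
  also have "\<dots> \<le> (MAX \<alpha>\<in>{\<alpha>. mi_order \<alpha> \<le> s}. lp_norm p U (weak_deriv U \<alpha> f))"
    using mi_order_concentrated[of "undefined :: 'd" s]
    by (intro Max_ge finite_imageI finite_mi_order_le imageI) simp
  finally show ?thesis using True by (simp add: sobolev_norm_def)
qed (simp add: sobolev_norm_def)

text \<open>Summation of the local estimates. For finite exponents the elements are disjoint subsets of \<open>\<Omega>\<close>, and the
  conversion between the sum of the norms of the derivatives and the seminorm costs at most their number.\<close>

lemma broken_norm_le_seminorm:
  fixes f u :: "real^'d::finite \<Rightarrow> real^'m::finite"
  assumes \<Omega>: "open \<Omega>" and T: "finite T" "T \<noteq> {}" "\<And>\<tau>. \<tau> \<in> T \<Longrightarrow> open \<tau> \<and> \<tau> \<subseteq> \<Omega>" "pairwise disjnt T"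
    and p: "1 \<le> p" and u: "u \<in> sobolev_space r p \<Omega>" and Y: "Y \<ge> 0"
    and loc: "\<And>\<tau>. \<tau> \<in> T \<Longrightarrow>
      sobolev_norm s p \<tau> f \<le> Y * (\<Sum>\<beta> | mi_order \<beta> = r. lp_norm p \<tau> (weak_deriv \<Omega> \<beta> u))"
  shows "broken_sobolev_norm s p T f \<le> Y * card {\<beta> :: 'd \<Rightarrow> nat. mi_order \<beta> \<le> r} * sobolev_seminorm r p \<Omega> u"
proof -
  let ?I = "{\<beta> :: 'd \<Rightarrow> nat. mi_order \<beta> = r}" and ?N = "card {\<beta> :: 'd \<Rightarrow> nat. mi_order \<beta> \<le> r}"
  let ?W = "\<lambda>\<beta>. weak_deriv \<Omega> \<beta> u"
  have W: "?W \<beta> \<in> lp_space p \<Omega>" if "\<beta> \<in> ?I" for \<beta>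
    using sobolev_weak_deriv(2)[OF \<Omega> u, of \<beta>] that by auto
  have fin: "finite ?I" by (rule finite_mi_order_eq)
  have card: "card ?I \<le> ?N" by (intro card_mono finite_mi_order_le) auto
  show ?thesis
  proof (cases "p = \<infinity>")
    case True
    have "sobolev_norm s p \<tau> f \<le> Y * ?N * sobolev_seminorm r p \<Omega> u" if "\<tau> \<in> T" for \<tau>
    proof -
      have semi: "lp_norm p \<Omega> (?W \<beta>) \<le> sobolev_seminorm r p \<Omega> u" if "\<beta> \<in> ?I" for \<beta>
        unfolding sobolev_seminorm_def using True fin that by auto
      have s0: "sobolev_seminorm r p \<Omega> u \<ge> 0"
        using semi[of "\<lambda>j. if j = undefined then r else 0"] lp_norm_nonneg mi_order_concentrated order.trans by blast
      have "(\<Sum>\<beta>\<in>?I. lp_norm p \<tau> (?W \<beta>)) \<le> (\<Sum>\<beta>\<in>?I. sobolev_seminorm r p \<Omega> u)"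
        using lp_norm_infinity_subset[OF \<Omega>] T(3)[OF that] W semi True by (intro sum_mono) (blast intro: order.trans)
      also have "\<dots> \<le> ?N * sobolev_seminorm r p \<Omega> u" using card s0 by (simp add: mult_right_mono)
      finally have "Y * (\<Sum>\<beta>\<in>?I. lp_norm p \<tau> (?W \<beta>)) \<le> Y * (?N * sobolev_seminorm r p \<Omega> u)"
        using Y by (rule mult_left_mono)
      then show ?thesis using loc[OF that] by (simp add: mult.assoc)
    qed
    then show ?thesis unfolding broken_sobolev_norm_def using True T(1,2) by auto
  next
    case False
    then obtain q where q: "p = ereal q" "q \<ge> 1" using p by (cases p) auto
    define S where "S = (\<Sum>\<beta>\<in>?I. lp_norm p \<Omega> (?W \<beta>) powr q)"
    have S0: "S \<ge> 0" by (simp add: S_def sum_nonneg)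
    have semi: "sobolev_seminorm r p \<Omega> u = S powr (1 / q)"
      using q by (simp add: sobolev_seminorm_def S_def)
    have "(\<Sum>\<tau>\<in>T. sobolev_norm s p \<tau> f powr q) \<le> (\<Sum>\<tau>\<in>T. Y powr q * (?N powr q * (\<Sum>\<beta>\<in>?I. lp_norm p \<tau> (?W \<beta>) powr q)))"
    proof (rule sum_mono)
      fix \<tau> assume \<tau>: "\<tau> \<in> T"
      have R0: "(\<Sum>\<beta>\<in>?I. lp_norm p \<tau> (?W \<beta>)) \<ge> 0" by (intro sum_nonneg lp_norm_nonneg)
      have "sobolev_norm s p \<tau> f powr q \<le> (Y * (\<Sum>\<beta>\<in>?I. lp_norm p \<tau> (?W \<beta>))) powr q"
        using q by (intro powr_mono2 loc[OF \<tau>] sobolev_norm_nonneg) auto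
      also have "\<dots> = Y powr q * (\<Sum>\<beta>\<in>?I. lp_norm p \<tau> (?W \<beta>)) powr q" using Y R0 by (simp add: powr_mult)
      also have "\<dots> \<le> Y powr q * (card ?I powr q * (\<Sum>\<beta>\<in>?I. lp_norm p \<tau> (?W \<beta>) powr q))"
        using q by (intro mult_left_mono powr_sum_le_sum_powr fin lp_norm_nonneg) auto
      also have "\<dots> \<le> Y powr q * (?N powr q * (\<Sum>\<beta>\<in>?I. lp_norm p \<tau> (?W \<beta>) powr q))"
        using q card by (intro mult_left_mono mult_right_mono powr_mono2 sum_nonneg) auto
      finally show "sobolev_norm s p \<tau> f powr q \<le> Y powr q * (?N powr q * (\<Sum>\<beta>\<in>?I. lp_norm p \<tau> (?W \<beta>) powr q))" .
    qed
    also have "\<dots> = Y powr q * (?N powr q * (\<Sum>\<beta>\<in>?I. \<Sum>\<tau>\<in>T. lp_norm p \<tau> (?W \<beta>) powr q))"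
      by (simp add: sum_distrib_left sum.swap[of _ ?I T])
    also have "\<dots> \<le> Y powr q * (?N powr q * S)"
      unfolding S_def using W
      by (intro mult_left_mono sum_mono lp_norm_powr_sum_disjoint[OF \<Omega> T(1,3,4) q]) auto
    also have "\<dots> = (Y * ?N * S powr (1 / q)) powr q"
      using Y S0 q by (simp add: powr_mult powr_powr)
    finally have "(\<Sum>\<tau>\<in>T. sobolev_norm s p \<tau> f powr q) powr (1 / q) \<le> Y * ?N * S powr (1 / q)"
      using q Y by (intro powr_inverse_le) (auto intro!: sum_nonneg)
    then show ?thesis unfolding broken_sobolev_norm_def semi using q by simp
  qed
qed

section \<open>Approximation on a mesh\<close>

lemma mesh_facts:
  fixes \<Omega> :: "(real^'d::finite) set"
  assumes \<Omega>: "bounded_polyhedral_domain \<Omega>" and T: "conforming_mesh \<Omega> T"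
  shows "T \<noteq> {}" "\<And>\<tau> x y. \<tau> \<in> T \<Longrightarrow> x \<in> \<tau> \<Longrightarrow> y \<in> \<tau> \<Longrightarrow> norm (x - y) \<le> mesh_size T" "mesh_size T > 0"
proof -
  have "\<Omega> \<noteq> {}" using \<Omega> by (simp add: bounded_polyhedral_domain_def)
  moreover have un: "(\<Union>\<tau>\<in>T. closure \<tau>) = closure \<Omega>" using T by (simp add: conforming_mesh_def)
  ultimately show ne: "T \<noteq> {}" using closure_subset[of \<Omega>] by auto
  have fin: "finite T" and simp: "\<And>\<tau>. \<tau> \<in> T \<Longrightarrow> open_simplex \<tau>" using T by (auto simp: conforming_mesh_def)
  show dist: "norm (x - y) \<le> mesh_size T" if "\<tau> \<in> T" "x \<in> \<tau>" "y \<in> \<tau>" for \<tau> x y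
  proof -
    have "dist x y \<le> diameter \<tau>"
      by (rule diameter_bounded_bound[OF open_simplex_structure(3)[OF simp[OF that(1)]] that(2,3)])
    also have "\<dots> \<le> mesh_size T" unfolding mesh_size_def using fin that(1) by (intro Max_ge) auto
    finally show ?thesis by (simp add: dist_norm)
  qed
  obtain \<tau> where \<tau>: "\<tau> \<in> T" using ne by blast
  obtain x where x: "x \<in> \<tau>" using open_simplex_structure(4)[OF simp[OF \<tau>]] by blast
  obtain e where e: "e > 0" "cball x e \<subseteq> \<tau>"
    using open_simplex_structure(1)[OF simp[OF \<tau>]] x by (metis open_contains_cball)
  obtain v :: "real^'d" where v: "norm v = e" using vector_choose_size[of e] e(1) by auto
  have "x + v \<in> \<tau>" using e v by (auto simp: subset_iff dist_norm)
  then have "norm ((x + v) - x) \<le> mesh_size T" by (rule dist[OF \<tau> _ x])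
  then show "mesh_size T > 0" using v e(1) by simp
qed

text \<open>The bound for a derivative of order \<open>a \<le> s\<close> contains \<open>h\<close> to the power \<open>r - a\<close>, which is at most \<open>h\<close> to the
  power \<open>r - s\<close> because \<open>h \<le> 1\<close>.\<close>

lemma piecewise_approximation:
  fixes \<Omega> :: "(real^'d::finite) set" and u :: "real^'d \<Rightarrow> real^'m::finite"
  assumes p: "1 \<le> p" and r: "1 \<le> r" "r \<le> k + 1"
    and \<Omega>: "bounded_polyhedral_domain \<Omega>" and T: "conforming_mesh \<Omega> T" and h1: "mesh_size T \<le> 1"
    and u: "u \<in> sobolev_space r p \<Omega>"
  defines "N\<^sub>0 \<equiv> real (card {\<beta> :: 'd \<Rightarrow> nat. mi_order \<beta> \<le> r})"
    and "C\<^sub>1 \<equiv> 2 ^ CARD('d) * real CARD('d) * real CARD('d)"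
  shows "\<exists>\<N> \<in> NN k (2 * card (facet_hyperplanes T)) (((CARD('d) + k) choose CARD('d)) * card T).
    \<forall>s\<le>r. (\<lambda>x. u x - \<N> x) \<in> broken_sobolev_space s p T \<and>
      broken_sobolev_norm s p T (\<lambda>x. u x - \<N> x)
        \<le> N\<^sub>0 * C\<^sub>1 ^ r * N\<^sub>0 * mesh_size T ^ (r - s) * sobolev_seminorm r p \<Omega> u"
proof -
  let ?h = "mesh_size T" and ?B = "{\<beta> :: 'd \<Rightarrow> nat. mi_order \<beta> < r}"
  have op: "open \<Omega>" using \<Omega> by (simp add: bounded_polyhedral_domain_def)
  note mf = mesh_facts[OF \<Omega> T]
  have mesh: "finite T" "pairwise disjnt T" "\<And>\<tau>. \<tau> \<in> T \<Longrightarrow> open_simplex \<tau>" "\<And>\<tau>. \<tau> \<in> T \<Longrightarrow> \<tau> \<subseteq> \<Omega>"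
    using T by (auto simp: conforming_mesh_def)
  note simplex = open_simplex_structure(1-4)[OF mesh(3)]
  define W where "W \<alpha> = weak_deriv \<Omega> \<alpha> u" for \<alpha>
  have W: "is_weak_deriv \<Omega> \<alpha> u (W \<alpha>)" "W \<alpha> \<in> lp_space p \<Omega>" if "mi_order \<alpha> \<le> r" for \<alpha>
    using sobolev_weak_deriv[OF op u that] by (auto simp: W_def)
  have C1: "C\<^sub>1 \<ge> 1" unfolding C\<^sub>1_def
    by (intro mult_ge1_I) (auto simp: Suc_leI)
  define E where "E c \<alpha> = (\<lambda>x. W \<alpha> x - mpoly_deriv ?B c \<alpha> x)" for c \<alpha>
  have "\<forall>\<tau>\<in>T. \<exists>c. \<forall>\<alpha>. mi_order \<alpha> \<le> r \<longrightarrow> E c \<alpha> \<in> lp_space p \<tau> \<and>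
      is_weak_deriv \<tau> \<alpha> (\<lambda>x. u x - mpoly_deriv ?B c (\<lambda>_. 0) x) (E c \<alpha>) \<and>
      lp_norm p \<tau> (E c \<alpha>) \<le> (C\<^sub>1 * ?h) ^ (r - mi_order \<alpha>) * (\<Sum>\<beta> | mi_order \<beta> = r. lp_norm p \<tau> (W \<beta>))"
  proof
    fix \<tau> assume \<tau>: "\<tau> \<in> T"
    have lp\<tau>: "W \<alpha> \<in> lp_space p \<tau>" if "mi_order \<alpha> \<le> r" for \<alpha>
      by (rule lp_space_subset[OF op simplex(1)[OF \<tau>] mesh(4)[OF \<tau>] W(2)[OF that]])
    have wd\<tau>: "is_weak_deriv \<tau> \<alpha> u (W \<alpha>)" if "mi_order \<alpha> \<le> r" for \<alpha>
      by (rule is_weak_deriv_subset[OF op simplex(1)[OF \<tau>] mesh(4)[OF \<tau>] W(1)[OF that]])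
    show "\<exists>c. \<forall>\<alpha>. mi_order \<alpha> \<le> r \<longrightarrow> E c \<alpha> \<in> lp_space p \<tau> \<and>
      is_weak_deriv \<tau> \<alpha> (\<lambda>x. u x - mpoly_deriv ?B c (\<lambda>_. 0) x) (E c \<alpha>) \<and>
      lp_norm p \<tau> (E c \<alpha>) \<le> (C\<^sub>1 * ?h) ^ (r - mi_order \<alpha>) * (\<Sum>\<beta> | mi_order \<beta> = r. lp_norm p \<tau> (W \<beta>))"
    proof (rule bramble_hilbert[OF simplex[OF \<tau>] p lp\<tau> wd\<tau> mf(2)[OF \<tau>] mf(3)])
      fix c assume "\<And>\<alpha>. mi_order \<alpha> \<le> r \<Longrightarrow> (\<lambda>x. W \<alpha> x - mpoly_deriv ?B c \<alpha> x) \<in> lp_space p \<tau>"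
        "\<And>\<alpha>. mi_order \<alpha> \<le> r \<Longrightarrow> is_weak_deriv \<tau> \<alpha> (\<lambda>x. u x - mpoly_deriv ?B c (\<lambda>_. 0) x)
          (\<lambda>x. W \<alpha> x - mpoly_deriv ?B c \<alpha> x)"
        "\<And>\<alpha>. mi_order \<alpha> \<le> r \<Longrightarrow> lp_norm p \<tau> (\<lambda>x. W \<alpha> x - mpoly_deriv ?B c \<alpha> x)
          \<le> (2 ^ CARD('d) * real CARD('d) * real CARD('d) * ?h) ^ (r - mi_order \<alpha>) * (\<Sum>\<beta> | mi_order \<beta> = r. lp_norm p \<tau> (W \<beta>))"
      then show ?thesis unfolding E_def C\<^sub>1_def by (intro exI[of _ c] allI impI conjI)
    qed
  qed
  from bchoice[OF this] obtain c where c: "\<forall>\<tau>\<in>T. \<forall>\<alpha>. mi_order \<alpha> \<le> r \<longrightarrow> E (c \<tau>) \<alpha> \<in> lp_space p \<tau> \<and>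
      is_weak_deriv \<tau> \<alpha> (\<lambda>x. u x - mpoly_deriv ?B (c \<tau>) (\<lambda>_. 0) x) (E (c \<tau>) \<alpha>) \<and>
      lp_norm p \<tau> (E (c \<tau>) \<alpha>) \<le> (C\<^sub>1 * ?h) ^ (r - mi_order \<alpha>) * (\<Sum>\<beta> | mi_order \<beta> = r. lp_norm p \<tau> (W \<beta>))"
    by blast
  have "?B \<subseteq> {\<beta>. mi_order \<beta> \<le> k}" using r by auto
  from piecewise_polynomial_network[OF mesh(1,3,2) this, of c]
  obtain \<N> where \<N>: "\<N> \<in> NN k (2 * card (facet_hyperplanes T)) (((CARD('d) + k) choose CARD('d)) * card T)"
    and \<N>eq: "\<And>\<tau> x. \<tau> \<in> T \<Longrightarrow> x \<in> \<tau> \<Longrightarrow> \<N> x = mpoly_deriv ?B (c \<tau>) (\<lambda>_. 0) x" by blast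
  let ?e = "\<lambda>x. u x - \<N> x"
  have wd: "is_weak_deriv \<tau> \<alpha> ?e (E (c \<tau>) \<alpha>)" if "\<tau> \<in> T" "mi_order \<alpha> \<le> r" for \<tau> \<alpha>
    by (rule is_weak_deriv_cong[of _ _ "\<lambda>x. u x - mpoly_deriv ?B (c \<tau>) (\<lambda>_. 0) x"]) (use c that \<N>eq in auto)
  have lpe: "?e \<in> lp_space p \<tau>" if \<tau>: "\<tau> \<in> T" for \<tau>
  proof -
    have "u \<in> lp_space p \<Omega>" using u by (simp add: sobolev_space_def)
    then have "u \<in> lp_space p \<tau>" by (rule lp_space_subset[OF op simplex(1)[OF \<tau>] mesh(4)[OF \<tau>]])
    then have lp: "(\<lambda>x. u x - mpoly_deriv ?B (c \<tau>) (\<lambda>_. 0) x) \<in> lp_space p \<tau>"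
      by (rule lp_space_diff[OF p _ lp_space_continuous[OF simplex(1,3)[OF \<tau>] mpoly_deriv_continuous p]])
    have ae: "AE x in lebesgue_on \<tau>. u x - mpoly_deriv ?B (c \<tau>) (\<lambda>_. 0) x = ?e x"
      by (rule AE_I2) (use \<N>eq[OF \<tau>] in simp)
    have "?e \<in> borel_measurable (lebesgue_on \<tau>)"
      by (rule lebesgue_on_measurable_AE[OF simplex(1)[OF \<tau>] _ ae]) (use lp in \<open>simp add: lp_space_def\<close>)
    then show ?thesis by (rule lp_space_cong_AE[OF lp _ ae])
  qed
  show ?thesis
  proof (intro bexI[OF _ \<N>] allI impI conjI)
    fix s assume s: "s \<le> r"
    show "?e \<in> broken_sobolev_space s p T"
      unfolding broken_sobolev_space_def sobolev_space_def
    proof (intro INT_I CollectI conjI allI impI)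
      fix \<tau> and \<alpha> :: "'d \<Rightarrow> nat" assume "\<tau> \<in> T" "mi_order \<alpha> \<le> s"
      then show "\<exists>w\<in>lp_space p \<tau>. is_weak_deriv \<tau> \<alpha> ?e w" using wd[of \<tau> \<alpha>] c s by auto
    qed (rule lpe)
    define Y where "Y = N\<^sub>0 * C\<^sub>1 ^ r * ?h ^ (r - s)"
    have Y: "Y \<ge> 0" using C1 mf(3) by (simp add: Y_def N\<^sub>0_def)
    have loc: "sobolev_norm s p \<tau> ?e \<le> Y * (\<Sum>\<beta> | mi_order \<beta> = r. lp_norm p \<tau> (W \<beta>))" if \<tau>: "\<tau> \<in> T" for \<tau>
    proof -
      let ?R = "\<Sum>\<beta> | mi_order \<beta> = r. lp_norm p \<tau> (W \<beta>)"
      have R0: "?R \<ge> 0" by (intro sum_nonneg lp_norm_nonneg)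
      have each: "lp_norm p \<tau> (weak_deriv \<tau> \<alpha> ?e) \<le> C\<^sub>1 ^ r * ?h ^ (r - s) * ?R" if \<alpha>: "mi_order \<alpha> \<le> s" for \<alpha>
      proof -
        have \<alpha>r: "mi_order \<alpha> \<le> r" using \<alpha> s by simp
        have cE: "E (c \<tau>) \<alpha> \<in> lp_space p \<tau>"
          "lp_norm p \<tau> (E (c \<tau>) \<alpha>) \<le> (C\<^sub>1 * ?h) ^ (r - mi_order \<alpha>) * ?R" using c \<tau> \<alpha>r by auto
        have "lp_norm p \<tau> (weak_deriv \<tau> \<alpha> ?e) = lp_norm p \<tau> (E (c \<tau>) \<alpha>)"
          by (rule lp_norm_weak_deriv[OF simplex(1)[OF \<tau>] cE(1) wd[OF \<tau> \<alpha>r]])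
        also have "\<dots> \<le> (C\<^sub>1 * ?h) ^ (r - mi_order \<alpha>) * ?R" by (rule cE(2))
        also have "\<dots> \<le> (C\<^sub>1 ^ r * ?h ^ (r - s)) * ?R"
          unfolding power_mult_distrib using C1 mf(3) h1 \<alpha> R0
          by (intro mult_right_mono mult_mono power_increasing power_decreasing) auto
        finally show ?thesis .
      qed
      have "sobolev_norm s p \<tau> ?e \<le> (\<Sum>\<alpha> | mi_order \<alpha> \<le> s. lp_norm p \<tau> (weak_deriv \<tau> \<alpha> ?e))"
        by (rule sobolev_norm_le_sum[OF p])
      also have "\<dots> \<le> (\<Sum>\<alpha> | mi_order (\<alpha> :: 'd \<Rightarrow> nat) \<le> s. C\<^sub>1 ^ r * ?h ^ (r - s) * ?R)"
        using each by (intro sum_mono) auto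
      also have "\<dots> = real (card {\<alpha> :: 'd \<Rightarrow> nat. mi_order \<alpha> \<le> s}) * (C\<^sub>1 ^ r * ?h ^ (r - s) * ?R)" by simp
      also have "\<dots> \<le> N\<^sub>0 * (C\<^sub>1 ^ r * ?h ^ (r - s) * ?R)"
      proof (rule mult_right_mono)
        show "real (card {\<alpha> :: 'd \<Rightarrow> nat. mi_order \<alpha> \<le> s}) \<le> N\<^sub>0"
          unfolding N\<^sub>0_def using s by (intro of_nat_mono card_mono finite_mi_order_le) auto
        show "0 \<le> C\<^sub>1 ^ r * ?h ^ (r - s) * ?R" using C1 mf(3) R0 by (intro mult_nonneg_nonneg) auto
      qed
      finally show ?thesis by (simp add: Y_def mult.assoc)
    qed
    have "broken_sobolev_norm s p T ?e \<le> Y * N\<^sub>0 * sobolev_seminorm r p \<Omega> u"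
      unfolding N\<^sub>0_def
    proof (rule broken_norm_le_seminorm[OF op mesh(1) mf(1) _ mesh(2) p u Y])
      show "open \<tau> \<and> \<tau> \<subseteq> \<Omega>" if "\<tau> \<in> T" for \<tau> using simplex(1)[OF that] mesh(4)[OF that] by simp
      show "sobolev_norm s p \<tau> ?e \<le> Y * (\<Sum>\<beta> | mi_order \<beta> = r. lp_norm p \<tau> (weak_deriv \<Omega> \<beta> u))" if "\<tau> \<in> T" for \<tau>
        using loc[OF that] by (simp add: W_def)
    qed
    then show "broken_sobolev_norm s p T ?e
        \<le> N\<^sub>0 * C\<^sub>1 ^ r * N\<^sub>0 * ?h ^ (r - s) * sobolev_seminorm r p \<Omega> u"
      by (simp add: Y_def mult_ac)
  qed
qed

theorem corollary6:
  fixes k r :: nat and p :: ereal and \<sigma> :: real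
  assumes "1 \<le> p" and "1 \<le> r" and "r \<le> k + 1"
  shows "\<exists>C>0. \<forall>(b :: 'm::finite \<Rightarrow> 'e::real_vector) (\<Omega> :: (real^'d::finite) set) \<T>.
    is_basis b \<and> bounded_polyhedral_domain \<Omega> \<and>
    (\<forall>T\<in>\<T>. conforming_mesh \<Omega> T \<and> mesh_size T \<le> 1) \<and> shape_regular_family \<sigma> \<T> \<longrightarrow>
    (\<forall>T\<in>\<T>. \<forall>v :: real^'d \<Rightarrow> 'e.
       coords b \<circ> v \<in> sobolev_space r p \<Omega> \<longrightarrow>
       (\<exists>\<N> \<in> NN k (2 * card (facet_hyperplanes T)) (((CARD('d) + k) choose CARD('d)) * card T).
          \<forall>s\<le>r.
            (\<lambda>x. coords b (v x) - \<N> x) \<in> broken_sobolev_space s p T \<and>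
            broken_sobolev_norm s p T (\<lambda>x. coords b (v x) - \<N> x)
              \<le> C * mesh_size T ^ (r - s) * sobolev_seminorm r p \<Omega> (coords b \<circ> v)))"
proof -
  define N\<^sub>0 where "N\<^sub>0 = real (card {\<beta> :: 'd \<Rightarrow> nat. mi_order \<beta> \<le> r})"
  define C\<^sub>1 where "C\<^sub>1 = 2 ^ CARD('d) * real CARD('d) * real CARD('d)"
  have "card {\<beta> :: 'd \<Rightarrow> nat. mi_order \<beta> \<le> r} > 0"
    using finite_mi_order_le[where 'd = 'd, of r] mi_order_concentrated[of "undefined :: 'd" r]
    by (metis (mono_tags, lifting) card_gt_0_iff empty_iff mem_Collect_eq order_refl)
  then have pos: "N\<^sub>0 * C\<^sub>1 ^ r * N\<^sub>0 > 0" by (simp add: N\<^sub>0_def C\<^sub>1_def)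
  show ?thesis
  proof (intro exI[of _ "N\<^sub>0 * C\<^sub>1 ^ r * N\<^sub>0"] conjI pos allI impI ballI, elim conjE)
    fix b :: "'m \<Rightarrow> 'e" and \<Omega> :: "(real^'d) set" and \<T> T and v :: "real^'d \<Rightarrow> 'e"
    assume "T \<in> \<T>" and u: "coords b \<circ> v \<in> sobolev_space r p \<Omega>" and \<Omega>: "bounded_polyhedral_domain \<Omega>"
      and "\<forall>T\<in>\<T>. conforming_mesh \<Omega> T \<and> mesh_size T \<le> 1"
    then have "conforming_mesh \<Omega> T" "mesh_size T \<le> 1" by auto
    from piecewise_approximation[OF assms \<Omega> this u]
    show "\<exists>\<N> \<in> NN k (2 * card (facet_hyperplanes T)) (((CARD('d) + k) choose CARD('d)) * card T).
          \<forall>s\<le>r.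
            (\<lambda>x. coords b (v x) - \<N> x) \<in> broken_sobolev_space s p T \<and>
            broken_sobolev_norm s p T (\<lambda>x. coords b (v x) - \<N> x)
              \<le> N\<^sub>0 * C\<^sub>1 ^ r * N\<^sub>0 * mesh_size T ^ (r - s) * sobolev_seminorm r p \<Omega> (coords b \<circ> v)"
      by (simp add: N\<^sub>0_def C\<^sub>1_def)
  qed
qed

end
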